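(* Let $k,l$ be coprime positive integers, $s\in\{0,1,\ldots,l-1\}$, $t\in\{0,1,\ldots,k-1\}$, and let $\tau^+_{s,t}$ be the cyclic cocycle (trace) on $\mathcal{O}(S^2_{pq}(k,l^+))$ described in the context. For $n\in\mathbb{Z}$ let $E[n]$ be the idempotent determined by $\omega(u^n)$. Then $$\tau^+_{s,t}(\mathrm{Tr}\,E[n])=-n.$$ Consequently, for $n\neq0$, the left $\mathcal{O}(S^2_{pq}(k,l^+))$-modules $\mathcal{L}[n]$ corresponding to $E[n]$ are not free.
   Context: $\mathbb{N}=\{0,1,2,\ldots\}$. Fix real numbers $0<p,q,\theta<1$ with $\theta$ irrational. $\mathcal{O}(S^3_{pq\theta})$ is the unital complex $*$-algebra generated by $a,b$ subject to $$ab=e^{2\pi i\theta}ba,\quad ab^*=e^{-2\pi i\theta}b^*a,\quad a^*a-paa^*=1-p,\quad b^*b-qbb^*=1-q,\quad (1-aa^* )(1-bb^* )=0.$$ Put $A=1-aa^*$, $B=1-bb^*$. $\mathcal{O}(U(1))=\mathbb{C}[u,u^*]$ with $uu^*=u^*u=1$, $\Delta(u)=u\otimes u$. For coprime positive integers $k,l$, $\mathcal{O}(S^2_{pq}(k,l^+))$ is the $*$-subalgebra of $\mathcal{O}(S^3_{pq\theta})$ generated by $A$, $B$, $C_+=a^lb^{*k}$ (the fixed points of the coaction $a\mapsto a\otimes u^k$, $b\mapsto b\otimes u^l$), and $\mathcal{A}_{k,l}$ is the $*$-subalgebra generated by $x=a^l$, $y=b^k$, $z=A$, $w=B$. The $*$-algebra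 map $\rho_{k,l}:\mathcal{A}_{k,l}\to\mathcal{A}_{k,l}\otimes\mathcal{O}(U(1))$, $x\mapsto x\otimes u$, $y\mapsto y\otimes u$, $z\mapsto z\otimes1$, $w\mapsto w\otimes1$, makes $\mathcal{A}_{k,l}$ a right comodule algebra with coinvariant subalgebra $\mathcal{O}(S^2_{pq}(k,l^+))$. Let $f(z)=1-\prod_{i=1}^l(1-p^iz)$. The strong connection $\omega:\mathcal{O}(U(1))\to\mathcal{A}_{k,l}\otimes\mathcal{A}_{k,l}$ is defined by $\omega(1)=1\otimes1$ and, for $n\ge1$, $$\omega(u^n)=x^*\omega(u^{n-1})x+f(z)y^*\omega(u^{n-1})y,\qquad \omega(u^{-n})=x\,\omega(u^{-n+1})x^*+f(p^{-l}z)\,y\,\omega(u^{-n+1})y^*,$$ where left multiplication acts on the first tensor factor and right multiplication on the second. Write $\omega(u^n)=\sum_i\omega(u^n)^{[1]}_i\otimes\omega(u^n)^{[2]}_i$ for the resulting finite sum. For $n\in\mathbb{Z}$, $$\mathcal{L}[n]=\{c\in\mathcal{A}_{k,l}:\rho_{k,l}(c)=c\otimes u^n\},$$ a left $\mathcal{O}(S^2_{pq}(k,l^+))$-module (projective module of sections of a line bundle), with idempotent matrix $E[n]$ having entries $E[n]_{ij}=\omega(u^n)^{[2]}_i\,\omega(u^n)^{[1]}_j\in\mathcal{O}(S^2_{pq}(k,l^+))$; $\mathrm{Tr}\,E[n]=\sum_iE[n]_{ii}$. The functional $\tau^+_{s,t}$ is $\tau^+_{s,t}(c)=\mathrm{Tr}(\pi_{s,t}(c)-\pi_c(c))$,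 where $\pi_{s,t}$ and $\pi_c$ are the $*$-representations of $\mathcal{O}(S^2_{pq}(k,l^+))$ on the Hilbert space with orthonormal basis $f_m$, $m\in\mathbb{Z}$, given as follows. $\pi_c(A)=\pi_c(B)=0$, $\pi_c(C_+)f_m=f_{m+1}$. For $m\ge0$: $\pi_{s,t}(A)f_m=p^{ml+s}f_m$, $\pi_{s,t}(B)f_m=0$, $\pi_{s,t}(C_+)f_m=\prod_{i=1}^l(1-p^{i+ml+s})^{1/2}f_{m+1}$. For $m<0$, writing $m=-n-1$ with $n\in\mathbb{N}$: $\pi_{s,t}(A)f_m=0$, $\pi_{s,t}(B)f_m=q^{nk+t}f_m$, $\pi_{s,t}(C_+)f_m=\prod_{j=1}^k(1-q^{j+(n-1)k+t})^{1/2}f_{m+1}$. Explicitly, with $C_+^{\#\mu}=C_+^\mu$ for $\mu\ge0$ and $C_+^{*|\mu|}$ for $\mu<0$: $\tau^+_{s,t}(A^\lambda)=\frac{p^{\lambda s}}{1-p^{\lambda l}}$ and $\tau^+_{s,t}(B^\lambda)=\frac{q^{\lambda t}}{1-q^{\lambda k}}$ for $\lambda\geq 1$, and $\tau^+_{s,t}$ vanishes on $1$ and on all $A^\lambda C_+^{\#\mu}$, $B^\lambda C_+^{\#\mu}$ with $\mu\ne0$, $\lambda\in\mathbb{N}$. *)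

theory Defs
  imports "HOL-Analysis.Analysis" "HOL-Algebra.QuotRing" "HOL-Algebra.Subrings"
    "HOL-Library.Poly_Mapping"
begin

section \<open>Complex star-algebras\<close>

record 'b star_alg = "(complex, 'b) module" +
  star :: "'b \<Rightarrow> 'b"

definition star_subalgebra :: "'b set \<Rightarrow> ('b, 'x) star_alg_scheme \<Rightarrow> bool" where
  "star_subalgebra S R \<longleftrightarrow> subring S R \<and>
     (\<forall>c. \<forall>x\<in>S. c \<odot>\<^bsub>R\<^esub> x \<in> S) \<and> (\<forall>x\<in>S. star R x \<in> S)"

definition generated_star_subalgebra :: "'b star_alg \<Rightarrow> 'b set \<Rightarrow> 'b star_alg" where
  "generated_star_subalgebra R H = R\<lparr>carrier := \<Inter>{S. star_subalgebra S R \<and> H \<subseteq> S}\<rparr>"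

definition star_alg_hom :: "'b star_alg \<Rightarrow> 'c star_alg \<Rightarrow> ('b \<Rightarrow> 'c) \<Rightarrow> bool" where
  "star_alg_hom R S h \<longleftrightarrow> h \<in> ring_hom R S \<and>
     (\<forall>c. \<forall>x\<in>carrier R. h (c \<odot>\<^bsub>R\<^esub> x) = c \<odot>\<^bsub>S\<^esub> h x) \<and>
     (\<forall>x\<in>carrier R. h (star R x) = star S (h x))"


subsection \<open>Presentations by generators and relations\<close>

datatype 'g letter = Gen 'g | Adj 'g

fun adj_letter :: "'g letter \<Rightarrow> 'g letter" where
  "adj_letter (Gen g) = Adj g"
| "adj_letter (Adj g) = Gen g"

text \<open>The free monoid on the letters, written additively: \<open>Poly_Mapping\<close> multiplies finitely
  supported functions on a \<open>monoid_add\<close> by convolution.\<close>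

datatype 'g word = Word "'g letter list"

fun letters :: "'g word \<Rightarrow> 'g letter list" where
  "letters (Word u) = u"

instantiation word :: (type) monoid_add
begin

definition zero_word :: "'g word" where
  "zero_word = Word []"

definition plus_word :: "'g word \<Rightarrow> 'g word \<Rightarrow> 'g word" where
  "plus_word v w = Word (letters v @ letters w)"

instance
proof
  fix u v w :: "'g word"
  show "u + v + w = u + (v + w)" by (simp add: plus_word_def)
  show "0 + u = u" by (cases u) (simp add: plus_word_def zero_word_def)
  show "u + 0 = u" by (cases u) (simp add: plus_word_def zero_word_def)
qed

end

definition adj_word :: "'g word \<Rightarrow> 'g word" where
  "adj_word w = Word (rev (map adj_letter (letters w)))"

text \<open>\<open>map_key\<close> precomposes with its first argument, so the coefficient of a word \<open>w\<close> in the
  adjoint of \<open>f\<close> is the conjugate of the coefficient of \<open>adj_word w\<close> in \<open>f\<close>.\<close>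

definition free_star_alg :: "('g word \<Rightarrow>\<^sub>0 complex) star_alg" where
  "free_star_alg =
     \<lparr>carrier = UNIV, mult = (*), one = 1, zero = 0, add = (+),
      smult = (\<lambda>c. Poly_Mapping.map ((*) c)),
      star = (\<lambda>f. Poly_Mapping.map_key adj_word (Poly_Mapping.map cnj f))\<rparr>"

definition free_gen :: "'g \<Rightarrow> 'g word \<Rightarrow>\<^sub>0 complex" where
  "free_gen g = Poly_Mapping.single (Word [Gen g]) 1"

definition quot_star_alg :: "'b star_alg \<Rightarrow> 'b set \<Rightarrow> 'b set star_alg" where
  "quot_star_alg R I =
     \<lparr>carrier = carrier (R Quot I), mult = mult (R Quot I), one = one (R Quot I),
      zero = zero (R Quot I), add = add (R Quot I),
      smult = (\<lambda>c X. \<Union>x\<in>X. I +>\<^bsub>R\<^esub> (c \<odot>\<^bsub>R\<^esub> x)),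
      star = (\<lambda>X. \<Union>x\<in>X. I +>\<^bsub>R\<^esub> star R x)\<rparr>"

definition relation_ideal :: "('g word \<Rightarrow>\<^sub>0 complex) set \<Rightarrow> ('g word \<Rightarrow>\<^sub>0 complex) set" where
  "relation_ideal \<R> = genideal free_star_alg (\<R> \<union> star free_star_alg ` \<R>)"

definition presented_star_alg ::
    "('g word \<Rightarrow>\<^sub>0 complex) set \<Rightarrow> ('g word \<Rightarrow>\<^sub>0 complex) set star_alg" where
  "presented_star_alg \<R> = quot_star_alg free_star_alg (relation_ideal \<R>)"

definition presented_gen ::
    "('g word \<Rightarrow>\<^sub>0 complex) set \<Rightarrow> 'g \<Rightarrow> ('g word \<Rightarrow>\<^sub>0 complex) set" where
  "presented_gen \<R> g = relation_ideal \<R> +>\<^bsub>free_star_alg\<^esub> free_gen g"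


subsection \<open>Tensor product with the coordinate algebra of the circle\<close>

text \<open>The powers of \<open>u\<close> form a vector space basis of \<open>\<O>(U(1)) = \<complex>[u,u*]\<close>. So every element of
  \<open>R \<otimes> \<O>(U(1))\<close> is uniquely a finite sum of elementary tensors \<open>r\<^sub>n \<otimes> u\<^sup>n\<close>; it is
  represented by the family of its coefficients \<open>r\<^sub>n\<close>.\<close>

definition tensor_circle :: "'b star_alg \<Rightarrow> (int \<Rightarrow> 'b) star_alg" where
  "tensor_circle R =
     \<lparr>carrier = {f. (\<forall>n. f n \<in> carrier R) \<and> finite {n. f n \<noteq> \<zero>\<^bsub>R\<^esub>}},
      mult = (\<lambda>f g n. \<Oplus>\<^bsub>R\<^esub>i\<in>{i. f i \<noteq> \<zero>\<^bsub>R\<^esub>}. f i \<otimes>\<^bsub>R\<^esub> g (n - i)),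
      one = (\<lambda>n. if n = 0 then \<one>\<^bsub>R\<^esub> else \<zero>\<^bsub>R\<^esub>),
      zero = (\<lambda>n. \<zero>\<^bsub>R\<^esub>),
      add = (\<lambda>f g n. f n \<oplus>\<^bsub>R\<^esub> g n),
      smult = (\<lambda>c f n. c \<odot>\<^bsub>R\<^esub> f n),
      star = (\<lambda>f n. star R (f (- n)))\<rparr>"

definition tensor_u :: "'b star_alg \<Rightarrow> 'b \<Rightarrow> int \<Rightarrow> int \<Rightarrow> 'b" where
  "tensor_u R r n = (\<lambda>i. if i = n then r else \<zero>\<^bsub>R\<^esub>)"


section \<open>Free left modules over a not necessarily commutative ring\<close>

definition free_left_module :: "('r, 'x) ring_scheme \<Rightarrow> ('r, 'm, 'y) module_scheme \<Rightarrow> bool" where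
  "free_left_module R M \<longleftrightarrow>
     (\<exists>X \<subseteq> carrier M.
        (\<forall>F c. finite F \<and> F \<subseteq> X \<and> c \<in> F \<rightarrow> carrier R \<and>
               (\<Oplus>\<^bsub>M\<^esub>e\<in>F. c e \<odot>\<^bsub>M\<^esub> e) = \<zero>\<^bsub>M\<^esub> \<longrightarrow> (\<forall>e\<in>F. c e = \<zero>\<^bsub>R\<^esub>)) \<and>
        (\<forall>v \<in> carrier M. \<exists>F c. finite F \<and> F \<subseteq> X \<and> c \<in> F \<rightarrow> carrier R \<and>
               v = (\<Oplus>\<^bsub>M\<^esub>e\<in>F. c e \<odot>\<^bsub>M\<^esub> e)))"


section \<open>Operators on the Hilbert space with orthonormal basis indexed by the integers\<close>

type_synonym vec = "int \<Rightarrow> complex"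

definition ell2 :: "vec set" where
  "ell2 = {v. (\<lambda>m. (cmod (v m))\<^sup>2) summable_on UNIV}"

definition ell2_inner :: "vec \<Rightarrow> vec \<Rightarrow> complex" where
  "ell2_inner v w = (\<Sum>\<^sub>\<infinity>m. cnj (v m) * w m)"

definition ell2_norm :: "vec \<Rightarrow> real" where
  "ell2_norm v = sqrt (\<Sum>\<^sub>\<infinity>m. (cmod (v m))\<^sup>2)"

definition basis_vec :: "int \<Rightarrow> vec" where
  "basis_vec m = (\<lambda>i. if i = m then 1 else 0)"

definition bounded_operator :: "(vec \<Rightarrow> vec) \<Rightarrow> bool" where
  "bounded_operator T \<longleftrightarrow>
     (\<forall>v\<in>ell2. T v \<in> ell2) \<and>
     (\<forall>v\<in>ell2. \<forall>w\<in>ell2. T (\<lambda>i. v i + w i) = (\<lambda>i. T v i + T w i)) \<and>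
     (\<forall>c. \<forall>v\<in>ell2. T (\<lambda>i. c * v i) = (\<lambda>i. c * T v i)) \<and>
     (\<exists>K. \<forall>v\<in>ell2. ell2_norm (T v) \<le> K * ell2_norm v)"

definition star_representation :: "'b star_alg \<Rightarrow> ('b \<Rightarrow> vec \<Rightarrow> vec) \<Rightarrow> bool" where
  "star_representation R \<pi> \<longleftrightarrow>
     (\<forall>x\<in>carrier R. bounded_operator (\<pi> x)) \<and>
     (\<forall>v\<in>ell2. \<pi> \<one>\<^bsub>R\<^esub> v = v) \<and>
     (\<forall>x\<in>carrier R. \<forall>y\<in>carrier R. \<forall>v\<in>ell2.
        \<pi> (x \<oplus>\<^bsub>R\<^esub> y) v = (\<lambda>i. \<pi> x v i + \<pi> y v i) \<and> \<pi> (x \<otimes>\<^bsub>R\<^esub> y) v = \<pi> x (\<pi> y v)) \<and>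
     (\<forall>c. \<forall>x\<in>carrier R. \<forall>v\<in>ell2. \<pi> (c \<odot>\<^bsub>R\<^esub> x) v = (\<lambda>i. c * \<pi> x v i)) \<and>
     (\<forall>x\<in>carrier R. \<forall>v\<in>ell2. \<forall>w\<in>ell2.
        ell2_inner (\<pi> (star R x) v) w = ell2_inner v (\<pi> x w))"

text \<open>The trace of a trace class operator, computed in the orthonormal basis \<open>basis_vec\<close>.\<close>

definition operator_trace :: "(vec \<Rightarrow> vec) \<Rightarrow> complex" where
  "operator_trace T = (\<Sum>\<^sub>\<infinity>m. ell2_inner (basis_vec m) (T (basis_vec m)))"


section \<open>The quantum sphere and its subalgebras\<close>

datatype gen = gen_a | gen_b

type_synonym sphere = "(gen word \<Rightarrow>\<^sub>0 complex) set"

definition sphere_relations :: "real \<Rightarrow> real \<Rightarrow> real \<Rightarrow> (gen word \<Rightarrow>\<^sub>0 complex) set" where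
  "sphere_relations p q \<theta> =
    (let a = free_gen gen_a; b = free_gen gen_b;
         a' = star free_star_alg a; b' = star free_star_alg b;
         scalar = (\<lambda>c :: complex. Poly_Mapping.single 0 c)
     in {a * b - scalar (exp (2 * pi * \<i> * \<theta>)) * (b * a),
         a * b' - scalar (exp (- (2 * pi * \<i> * \<theta>))) * (b' * a),
         a' * a - scalar (of_real p) * (a * a') - scalar (of_real (1 - p)),
         b' * b - scalar (of_real q) * (b * b') - scalar (of_real (1 - q)),
         (1 - a * a') * (1 - b * b')})"

definition S3 :: "real \<Rightarrow> real \<Rightarrow> real \<Rightarrow> sphere star_alg" where
  "S3 p q \<theta> = presented_star_alg (sphere_relations p q \<theta>)"

definition S3_a :: "real \<Rightarrow> real \<Rightarrow> real \<Rightarrow> sphere" where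
  "S3_a p q \<theta> = presented_gen (sphere_relations p q \<theta>) gen_a"

definition S3_b :: "real \<Rightarrow> real \<Rightarrow> real \<Rightarrow> sphere" where
  "S3_b p q \<theta> = presented_gen (sphere_relations p q \<theta>) gen_b"

definition S3_A :: "real \<Rightarrow> real \<Rightarrow> real \<Rightarrow> sphere" where
  "S3_A p q \<theta> = (let R = S3 p q \<theta>; a = S3_a p q \<theta> in \<one>\<^bsub>R\<^esub> \<ominus>\<^bsub>R\<^esub> (a \<otimes>\<^bsub>R\<^esub> star R a))"

definition S3_B :: "real \<Rightarrow> real \<Rightarrow> real \<Rightarrow> sphere" where
  "S3_B p q \<theta> = (let R = S3 p q \<theta>; b = S3_b p q \<theta> in \<one>\<^bsub>R\<^esub> \<ominus>\<^bsub>R\<^esub> (b \<otimes>\<^bsub>R\<^esub> star R b))"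

definition gen_x :: "real \<Rightarrow> real \<Rightarrow> real \<Rightarrow> nat \<Rightarrow> sphere" where
  "gen_x p q \<theta> l = S3_a p q \<theta> [^]\<^bsub>S3 p q \<theta>\<^esub> l"

definition gen_y :: "real \<Rightarrow> real \<Rightarrow> real \<Rightarrow> nat \<Rightarrow> sphere" where
  "gen_y p q \<theta> k = S3_b p q \<theta> [^]\<^bsub>S3 p q \<theta>\<^esub> k"

definition C_plus :: "real \<Rightarrow> real \<Rightarrow> real \<Rightarrow> nat \<Rightarrow> nat \<Rightarrow> sphere" where
  "C_plus p q \<theta> k l =
     (S3_a p q \<theta> [^]\<^bsub>S3 p q \<theta>\<^esub> l) \<otimes>\<^bsub>S3 p q \<theta>\<^esub> (star (S3 p q \<theta>) (S3_b p q \<theta>) [^]\<^bsub>S3 p q \<theta>\<^esub> k)"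

definition S2 :: "real \<Rightarrow> real \<Rightarrow> real \<Rightarrow> nat \<Rightarrow> nat \<Rightarrow> sphere star_alg" where
  "S2 p q \<theta> k l =
     generated_star_subalgebra (S3 p q \<theta>) {S3_A p q \<theta>, S3_B p q \<theta>, C_plus p q \<theta> k l}"

definition alg_A :: "real \<Rightarrow> real \<Rightarrow> real \<Rightarrow> nat \<Rightarrow> nat \<Rightarrow> sphere star_alg" where
  "alg_A p q \<theta> k l =
     generated_star_subalgebra (S3 p q \<theta>)
       {gen_x p q \<theta> l, gen_y p q \<theta> k, S3_A p q \<theta>, S3_B p q \<theta>}"


subsection \<open>The coaction and the line bundles\<close>

text \<open>There is exactly one such homomorphism on the carrier of \<open>alg_A\<close>: it is the restriction of
  the coaction \<open>a \<mapsto> a \<otimes> u\<^sup>k\<close>, \<open>b \<mapsto> b \<otimes> u\<^sup>l\<close> on \<open>S3\<close>, all of whose degrees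
  on \<open>alg_A\<close> are multiples of \<open>k * l\<close>, with these degrees divided by \<open>k * l\<close>.\<close>

definition coaction :: "real \<Rightarrow> real \<Rightarrow> real \<Rightarrow> nat \<Rightarrow> nat \<Rightarrow> sphere \<Rightarrow> int \<Rightarrow> sphere" where
  "coaction p q \<theta> k l =
    (let R = alg_A p q \<theta> k l; x = gen_x p q \<theta> l; y = gen_y p q \<theta> k;
         z = S3_A p q \<theta>; w = S3_B p q \<theta>
     in SOME \<rho>. star_alg_hom R (tensor_circle R) \<rho> \<and>
          \<rho> x = tensor_u R x 1 \<and> \<rho> y = tensor_u R y 1 \<and>
          \<rho> z = tensor_u R z 0 \<and> \<rho> w = tensor_u R w 0)"

definition line_bundle ::
    "real \<Rightarrow> real \<Rightarrow> real \<Rightarrow> nat \<Rightarrow> nat \<Rightarrow> int \<Rightarrow> (sphere, sphere) module" where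
  "line_bundle p q \<theta> k l n =
    (let R = alg_A p q \<theta> k l
     in \<lparr>carrier = {c \<in> carrier R. coaction p q \<theta> k l c = tensor_u R c n},
         mult = mult R, one = one R, zero = zero R, add = add R, smult = mult R\<rparr>)"


subsection \<open>The strong connection and the idempotents\<close>

text \<open>The ordered product is taken with a list, since \<open>finprod\<close> presupposes
  commutativity.\<close>

definition poly_f :: "'b star_alg \<Rightarrow> real \<Rightarrow> nat \<Rightarrow> 'b \<Rightarrow> 'b" where
  "poly_f R p l z =
     \<one>\<^bsub>R\<^esub> \<ominus>\<^bsub>R\<^esub> foldr (mult R)
       (map (\<lambda>i. \<one>\<^bsub>R\<^esub> \<ominus>\<^bsub>R\<^esub> (complex_of_real (p ^ i) \<odot>\<^bsub>R\<^esub> z)) [1..<Suc l]) \<one>\<^bsub>R\<^esub>"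

text \<open>A list of pairs \<open>(c, d)\<close> stands for the sum of the elementary tensors \<open>c \<otimes> d\<close>.\<close>

primrec omega_pos ::
    "real \<Rightarrow> real \<Rightarrow> real \<Rightarrow> nat \<Rightarrow> nat \<Rightarrow> nat \<Rightarrow> (sphere \<times> sphere) list" where
  "omega_pos p q \<theta> k l 0 = [(\<one>\<^bsub>alg_A p q \<theta> k l\<^esub>, \<one>\<^bsub>alg_A p q \<theta> k l\<^esub>)]"
| "omega_pos p q \<theta> k l (Suc n) =
    (let R = alg_A p q \<theta> k l; x = gen_x p q \<theta> l; y = gen_y p q \<theta> k; z = S3_A p q \<theta>
     in map (\<lambda>(c, d). (star R x \<otimes>\<^bsub>R\<^esub> c, d \<otimes>\<^bsub>R\<^esub> x)) (omega_pos p q \<theta> k l n) @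
        map (\<lambda>(c, d). (poly_f R p l z \<otimes>\<^bsub>R\<^esub> star R y \<otimes>\<^bsub>R\<^esub> c, d \<otimes>\<^bsub>R\<^esub> y))
          (omega_pos p q \<theta> k l n))"

primrec omega_neg ::
    "real \<Rightarrow> real \<Rightarrow> real \<Rightarrow> nat \<Rightarrow> nat \<Rightarrow> nat \<Rightarrow> (sphere \<times> sphere) list" where
  "omega_neg p q \<theta> k l 0 = [(\<one>\<^bsub>alg_A p q \<theta> k l\<^esub>, \<one>\<^bsub>alg_A p q \<theta> k l\<^esub>)]"
| "omega_neg p q \<theta> k l (Suc n) =
    (let R = alg_A p q \<theta> k l; x = gen_x p q \<theta> l; y = gen_y p q \<theta> k; z = S3_A p q \<theta>;
         z' = complex_of_real (p powi (- int l)) \<odot>\<^bsub>R\<^esub> z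
     in map (\<lambda>(c, d). (x \<otimes>\<^bsub>R\<^esub> c, d \<otimes>\<^bsub>R\<^esub> star R x)) (omega_neg p q \<theta> k l n) @
        map (\<lambda>(c, d). (poly_f R p l z' \<otimes>\<^bsub>R\<^esub> y \<otimes>\<^bsub>R\<^esub> c, d \<otimes>\<^bsub>R\<^esub> star R y))
          (omega_neg p q \<theta> k l n))"

definition omega ::
    "real \<Rightarrow> real \<Rightarrow> real \<Rightarrow> nat \<Rightarrow> nat \<Rightarrow> int \<Rightarrow> (sphere \<times> sphere) list" where
  "omega p q \<theta> k l n =
     (if n \<ge> 0 then omega_pos p q \<theta> k l (nat n) else omega_neg p q \<theta> k l (nat (- n)))"

text \<open>The matrix entries are indexed by \<open>i, j < length (omega p q \<theta> k l n)\<close>.\<close>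

definition E_matrix ::
    "real \<Rightarrow> real \<Rightarrow> real \<Rightarrow> nat \<Rightarrow> nat \<Rightarrow> int \<Rightarrow> nat \<Rightarrow> nat \<Rightarrow> sphere" where
  "E_matrix p q \<theta> k l n i j =
     snd (omega p q \<theta> k l n ! i) \<otimes>\<^bsub>alg_A p q \<theta> k l\<^esub> fst (omega p q \<theta> k l n ! j)"

definition Tr_E :: "real \<Rightarrow> real \<Rightarrow> real \<Rightarrow> nat \<Rightarrow> nat \<Rightarrow> int \<Rightarrow> sphere" where
  "Tr_E p q \<theta> k l n =
     (\<Oplus>\<^bsub>S2 p q \<theta> k l\<^esub>i\<in>{..<length (omega p q \<theta> k l n)}. E_matrix p q \<theta> k l n i i)"


subsection \<open>The trace functional\<close>

text \<open>On the carrier of \<open>S2\<close> and on \<open>ell2\<close>, the prescribed values on the generators determine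
  each of the two representations uniquely.\<close>

definition pi_c ::
    "real \<Rightarrow> real \<Rightarrow> real \<Rightarrow> nat \<Rightarrow> nat \<Rightarrow> sphere \<Rightarrow> vec \<Rightarrow> vec" where
  "pi_c p q \<theta> k l =
    (SOME \<pi>. star_representation (S2 p q \<theta> k l) \<pi> \<and>
       (\<forall>m. \<pi> (S3_A p q \<theta>) (basis_vec m) = (\<lambda>_. 0) \<and>
            \<pi> (S3_B p q \<theta>) (basis_vec m) = (\<lambda>_. 0) \<and>
            \<pi> (C_plus p q \<theta> k l) (basis_vec m) = basis_vec (m + 1)))"

text \<open>For \<open>n = 0\<close> some of the exponents \<open>j + (n - 1) * k + t\<close> may be negative. The product is
  nevertheless \<open>0\<close> then, because the exponent vanishes for \<open>j = k - t\<close> when \<open>t < k\<close>.\<close>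

definition pi_st ::
    "real \<Rightarrow> real \<Rightarrow> real \<Rightarrow> nat \<Rightarrow> nat \<Rightarrow> nat \<Rightarrow> nat \<Rightarrow> sphere \<Rightarrow> vec \<Rightarrow> vec" where
  "pi_st p q \<theta> k l s t =
    (SOME \<pi>. star_representation (S2 p q \<theta> k l) \<pi> \<and>
       (\<forall>m\<ge>0.
          \<pi> (S3_A p q \<theta>) (basis_vec m) =
            (\<lambda>i. of_real (p powi (m * int l + int s)) * basis_vec m i) \<and>
          \<pi> (S3_B p q \<theta>) (basis_vec m) = (\<lambda>_. 0) \<and>
          \<pi> (C_plus p q \<theta> k l) (basis_vec m) =
            (\<lambda>i. of_real (\<Prod>j=1..l. sqrt (1 - p powi (int j + m * int l + int s))) *
                 basis_vec (m + 1) i)) \<and>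
       (\<forall>m<0. \<forall>n. m = - n - 1 \<longrightarrow>
          \<pi> (S3_A p q \<theta>) (basis_vec m) = (\<lambda>_. 0) \<and>
          \<pi> (S3_B p q \<theta>) (basis_vec m) =
            (\<lambda>i. of_real (q powi (n * int k + int t)) * basis_vec m i) \<and>
          \<pi> (C_plus p q \<theta> k l) (basis_vec m) =
            (\<lambda>i. of_real (\<Prod>j=1..k. sqrt (1 - q powi (int j + (n - 1) * int k + int t))) *
                 basis_vec (m + 1) i)))"

definition tau ::
    "real \<Rightarrow> real \<Rightarrow> real \<Rightarrow> nat \<Rightarrow> nat \<Rightarrow> nat \<Rightarrow> nat \<Rightarrow> sphere \<Rightarrow> complex" where
  "tau p q \<theta> k l s t c =
     operator_trace (\<lambda>v i. pi_st p q \<theta> k l s t c v i - pi_c p q \<theta> k l c v i)"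

end

theory Submission
  imports Defs
begin

text \<open>
  Why the pairing is \<open>-n\<close>. Write \<open>x = a\<^sup>l\<close>, \<open>y = b\<^sup>k\<close>, \<open>z = A\<close>, \<open>w = B\<close>. There is a polynomial \<open>h\<close>
  with \<open>x x* = h(z)\<close> and \<open>x* x = h(p\<^sup>l z)\<close>, so that \<open>f(z) = 1 - x* x\<close>. In the trace of \<open>E[n]\<close> the legs of
  the connection are multiplied in the opposite order, so the factors added by the last step of
  the recursion meet in the middle, and \<open>Tr E[n]\<close> is the \<open>n\<close>-th iterate, applied to \<open>1\<close>, of
  \<open>c \<mapsto> x c x* + y c f(z) y*\<close>. Since \<open>z w = 0\<close>, the factor \<open>f(z)\<close> absorbs \<open>y y*\<close>; so polynomials in
  \<open>z\<close> are mapped to polynomials in \<open>z\<close>, by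
  \<open>(\<Phi> g)(t) = g(t/p\<^sup>l) h(t) + g(t) (1 - h(p\<^sup>l t))\<close> (\<open>connection_trace\<close>, \<open>connection_pos_step\<close>).
  On such elements \<open>\<tau>\<close> is \<open>g \<mapsto> \<Sum>\<^sub>m (g(p\<^sup>m\<^sup>l\<^sup>+\<^sup>s) - g(0))\<close>. The difference of the series for \<open>\<Phi> g\<close> and \<open>g\<close>
  telescopes: its lower end vanishes because \<open>h(p\<^sup>s) = 0\<close> for \<open>s < l\<close>, and its upper end is \<open>g(0) = 1\<close>.
  Hence each step lowers \<open>\<tau>\<close> by one, and the recursion for negative degree raises it by one
  (\<open>unit_trace_step\<close>).

  Why the modules are not free. The strong connection gives a finite dual basis of \<open>L[n]\<close>. If
  \<open>L[n]\<close> had a basis, then rearranging the products in the trace of \<open>E[n]\<close> would turn \<open>\<tau>(Tr E[n])\<close>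
  into a sum of copies of \<open>\<tau>(1) = 0\<close> (\<open>free_module_trace_zero\<close>), which contradicts the value \<open>-n\<close>.

  Both arguments need that the objects which are introduced by choice exist and are unique. The
  relations of the sphere are homogeneous when \<open>a\<close> has degree \<open>k\<close> and \<open>b\<close> has degree \<open>l\<close>. The total
  algebra is spanned by monomials \<open>s x\<^sup>i y\<^sup>j\<close> with signed exponents and with \<open>s\<close> in the base, so it
  contains the homogeneous components of its elements; they make up the coaction, and the component of
  degree zero lies in the base (\<open>total_eq_line_part_sums\<close>, \<open>some_coaction\<close>, \<open>line_0\<close>). For
  \<open>\<pi>\<^sub>s\<^sub>,\<^sub>t\<close>, the sphere acts on sequences indexed by the integers, with \<open>a\<close> a weighted shift on one
  half line and \<open>b\<close> on the other; the base preserves a residue class on each half line, and phases in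
  the weights give \<open>C\<^sub>+\<close> the prescribed form. Up to exponentially small errors every element
  of the base then acts as a Toeplitz operator, and its symbol defines \<open>\<pi>\<^sub>c\<close>. This also shows
  that \<open>\<pi>\<^sub>s\<^sub>,\<^sub>t - \<pi>\<^sub>c\<close> has a trace and that \<open>\<tau>\<close> does not see the order of factors (\<open>base_has_symbol\<close>,
  \<open>tau_mult_commute\<close>). A representation is determined by its values on generators and basis
  vectors, since adjoints are prescribed (\<open>star_representation_unique\<close>).
\<close>


section \<open>Complex star-algebras and presentations\<close>

text \<open>The record \<open>star_alg\<close> fixes only the operations; these are the laws of a complex unital
  star-algebra.\<close>

locale star_algebra = ring R for R :: "'b star_alg" (structure) +
  assumes smult_closed [simp]: "x \<in> carrier R \<Longrightarrow> c \<odot>\<^bsub>R\<^esub> x \<in> carrier R"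
    and smult_add: "x \<in> carrier R \<Longrightarrow> y \<in> carrier R \<Longrightarrow>
          c \<odot>\<^bsub>R\<^esub> (x \<oplus> y) = c \<odot>\<^bsub>R\<^esub> x \<oplus> c \<odot>\<^bsub>R\<^esub> y"
    and add_smult: "x \<in> carrier R \<Longrightarrow> (c + d) \<odot>\<^bsub>R\<^esub> x = c \<odot>\<^bsub>R\<^esub> x \<oplus> d \<odot>\<^bsub>R\<^esub> x"
    and smult_smult: "x \<in> carrier R \<Longrightarrow> c \<odot>\<^bsub>R\<^esub> (d \<odot>\<^bsub>R\<^esub> x) = (c * d) \<odot>\<^bsub>R\<^esub> x"
    and smult_one [simp]: "x \<in> carrier R \<Longrightarrow> 1 \<odot>\<^bsub>R\<^esub> x = x"
    and smult_mult: "x \<in> carrier R \<Longrightarrow> y \<in> carrier R \<Longrightarrow>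
          (c \<odot>\<^bsub>R\<^esub> x) \<otimes> y = c \<odot>\<^bsub>R\<^esub> (x \<otimes> y)"
    and mult_smult: "x \<in> carrier R \<Longrightarrow> y \<in> carrier R \<Longrightarrow>
          x \<otimes> (c \<odot>\<^bsub>R\<^esub> y) = c \<odot>\<^bsub>R\<^esub> (x \<otimes> y)"
    and star_closed [simp]: "x \<in> carrier R \<Longrightarrow> star R x \<in> carrier R"
    and star_add: "x \<in> carrier R \<Longrightarrow> y \<in> carrier R \<Longrightarrow>
          star R (x \<oplus> y) = star R x \<oplus> star R y"
    and star_smult: "x \<in> carrier R \<Longrightarrow> star R (c \<odot>\<^bsub>R\<^esub> x) = cnj c \<odot>\<^bsub>R\<^esub> star R x"
    and star_mult: "x \<in> carrier R \<Longrightarrow> y \<in> carrier R \<Longrightarrow>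
          star R (x \<otimes> y) = star R y \<otimes> star R x"
    and star_star [simp]: "x \<in> carrier R \<Longrightarrow> star R (star R x) = x"

lemma poly_mapping_induct_single:
  assumes "\<And>w c. P (Poly_Mapping.single w c)"
    and "\<And>f g. P f \<Longrightarrow> P g \<Longrightarrow> P (f + g)"
  shows "P (f :: 'a \<Rightarrow>\<^sub>0 'b::comm_monoid_add)"
proof (induction f rule: update_induct)
  case const
  then show ?case using assms(1)[of undefined 0] by simp
next
  case (update f k v)
  have "Poly_Mapping.update k v f = f + Poly_Mapping.single k v"
    using update(1) by (intro poly_mapping_eqI)
      (auto simp: lookup_update lookup_add lookup_single when_def in_keys_iff)
  then show ?case using assms update by simp
qed

lemma adj_letter_adj_letter [simp]: "adj_letter (adj_letter x) = x"
  by (cases x) auto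

lemma adj_word_adj_word [simp]: "adj_word (adj_word w) = w"
  by (cases w) (simp add: adj_word_def rev_map comp_def)

lemma adj_word_plus: "adj_word (v + w) = adj_word w + adj_word v"
  by (simp add: adj_word_def plus_word_def)

lemma inj_adj_word: "inj adj_word"
  by (metis adj_word_adj_word injI)

text \<open>A name of its own for this operation, into which the record selector is rewritten below, lets its
  laws be rewrite rules.\<close>

definition free_star :: "('g word \<Rightarrow>\<^sub>0 complex) \<Rightarrow> 'g word \<Rightarrow>\<^sub>0 complex" where
  "free_star = star free_star_alg"

lemma lookup_free_star: "poly_mapping.lookup (free_star f) w = cnj (poly_mapping.lookup f (adj_word w))"
proof -
  have "poly_mapping.lookup (Poly_Mapping.map cnj f) v = cnj (poly_mapping.lookup f v)" for v
    by transfer (auto simp: when_def)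
  then show ?thesis
    by (simp add: free_star_def free_star_alg_def map_key.rep_eq[OF inj_adj_word])
qed

lemma free_star_add: "free_star (f + g) = free_star f + free_star g"
  by (intro poly_mapping_eqI) (simp add: lookup_free_star lookup_add)

lemma free_star_single: "free_star (Poly_Mapping.single w c) = Poly_Mapping.single (adj_word w) (cnj c)"
  by (intro poly_mapping_eqI) (auto simp: lookup_free_star lookup_single when_def)

lemma free_star_star [simp]: "free_star (free_star f) = f"
  by (intro poly_mapping_eqI) (simp add: lookup_free_star)

lemma free_star_mult: "free_star (f * g) = free_star g * free_star f"
proof (induction f rule: poly_mapping_induct_single)
  case (1 v c)
  show ?case
    by (induction g rule: poly_mapping_induct_single)
      (simp_all add: mult_single free_star_single free_star_add adj_word_plus distrib_left
        distrib_right mult.commute)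
next
  case (2 f f')
  then show ?case by (simp add: free_star_add distrib_left distrib_right)
qed

abbreviation scal :: "complex \<Rightarrow> 'g word \<Rightarrow>\<^sub>0 complex" where
  "scal \<equiv> Poly_Mapping.single 0"

lemma scal_commute: "scal c * f = f * scal c"
  by (induction f rule: poly_mapping_induct_single)
    (simp_all add: mult_single distrib_left distrib_right mult.commute)

lemma free_star_scal [simp]: "free_star (scal c) = scal (cnj c)"
  by (simp add: free_star_single zero_word_def adj_word_def)

lemma free_star_alg_simps [simp]:
  "carrier free_star_alg = UNIV" "mult free_star_alg = (*)" "one free_star_alg = 1"
  "zero free_star_alg = 0" "add free_star_alg = (+)"
  "smult free_star_alg c f = scal c * f" "star free_star_alg f = free_star f"
  by (simp_all add: free_star_alg_def mult_map_scale_conv_mult) (simp add: free_star_def free_star_alg_def)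

lemma ring_free_star_alg: "ring (free_star_alg :: ('g word \<Rightarrow>\<^sub>0 complex) star_alg)"
proof (rule ringI)
  show "abelian_group (free_star_alg :: ('g word \<Rightarrow>\<^sub>0 complex) star_alg)"
  proof (rule abelian_groupI)
    fix x :: "'g word \<Rightarrow>\<^sub>0 complex"
    show "\<exists>y\<in>carrier free_star_alg. y \<oplus>\<^bsub>free_star_alg\<^esub> x = \<zero>\<^bsub>free_star_alg\<^esub>"
      by (auto intro: exI[of _ "- x"])
  qed (simp_all add: algebra_simps)
  show "Group.monoid (free_star_alg :: ('g word \<Rightarrow>\<^sub>0 complex) star_alg)"
    by (rule monoidI) (simp_all add: algebra_simps)
qed (simp_all add: algebra_simps)

lemma a_inv_free [simp]: "\<ominus>\<^bsub>free_star_alg\<^esub> f = - f"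
proof -
  interpret ring free_star_alg by (rule ring_free_star_alg)
  show ?thesis by (rule minus_equality) simp_all
qed

lemma ideal_free_star_algI:
  assumes "0 \<in> J" "\<And>f g. f \<in> J \<Longrightarrow> g \<in> J \<Longrightarrow> f + g \<in> J"
    "\<And>f g. f \<in> J \<Longrightarrow> g * f \<in> J" "\<And>f g. f \<in> J \<Longrightarrow> f * g \<in> J"
  shows "ideal J free_star_alg"
proof (rule idealI[OF ring_free_star_alg])
  have inv: "inv\<^bsub>add_monoid free_star_alg\<^esub> f = - f" for f :: "'a word \<Rightarrow>\<^sub>0 complex"
    using a_inv_free[of f] by (simp only: a_inv_def)
  show "subgroup J (add_monoid free_star_alg)"
  proof (rule group.subgroupI)
    show "Group.group (add_monoid (free_star_alg :: ('a word \<Rightarrow>\<^sub>0 complex) star_alg))"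
      by (rule abelian_group.a_group[OF ring.is_abelian_group[OF ring_free_star_alg]])
    show "inv\<^bsub>add_monoid free_star_alg\<^esub> f \<in> J" if "f \<in> J" for f
      unfolding inv using assms(3)[OF that, of "-1"] by simp
  qed (use assms(1,2) in auto)
qed (use assms in auto)

text \<open>The carrier of the free algebra is the whole type, so ideals can be described by the operations
  of the type class. In this form the lemma is the induction principle for consequences of the
  relations.\<close>

lemma relation_ideal_minimal:
  assumes "0 \<in> J" "\<And>f g. f \<in> J \<Longrightarrow> g \<in> J \<Longrightarrow> f + g \<in> J"
    "\<And>f g. f \<in> J \<Longrightarrow> g * f \<in> J" "\<And>f g. f \<in> J \<Longrightarrow> f * g \<in> J"
    "\<And>r. r \<in> \<R> \<Longrightarrow> r \<in> J" "\<And>r. r \<in> \<R> \<Longrightarrow> free_star r \<in> J"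
  shows "relation_ideal \<R> \<subseteq> J"
  unfolding relation_ideal_def
  by (rule ring.genideal_minimal[OF ring_free_star_alg ideal_free_star_algI]) (use assms in auto)

lemma ideal_relation_ideal: "ideal (relation_ideal \<R>) free_star_alg"
  unfolding relation_ideal_def by (rule ring.genideal_ideal[OF ring_free_star_alg]) simp

lemma relation_ideal_base:
  assumes "r \<in> \<R>" shows "r \<in> relation_ideal \<R>" "free_star r \<in> relation_ideal \<R>"
  using ring.genideal_self[OF ring_free_star_alg, of "\<R> \<union> free_star ` \<R>"] assms
  by (auto simp: relation_ideal_def image_def)

lemma relation_ideal_closed:
  shows relation_ideal_zero: "0 \<in> relation_ideal \<R>"
    and relation_ideal_add: "f \<in> relation_ideal \<R> \<Longrightarrow> g \<in> relation_ideal \<R> \<Longrightarrow> f + g \<in> relation_ideal \<R>"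
    and relation_ideal_uminus: "f \<in> relation_ideal \<R> \<Longrightarrow> - f \<in> relation_ideal \<R>"
    and relation_ideal_left: "f \<in> relation_ideal \<R> \<Longrightarrow> g * f \<in> relation_ideal \<R>"
    and relation_ideal_right: "f \<in> relation_ideal \<R> \<Longrightarrow> f * g \<in> relation_ideal \<R>"
proof -
  interpret ideal "relation_ideal \<R>" free_star_alg by (rule ideal_relation_ideal)
  show "0 \<in> relation_ideal \<R>" using additive_subgroup.zero_closed[OF is_additive_subgroup] by simp
  show "f \<in> relation_ideal \<R> \<Longrightarrow> g \<in> relation_ideal \<R> \<Longrightarrow> f + g \<in> relation_ideal \<R>"
    using additive_subgroup.a_closed[OF is_additive_subgroup, of f g] by simp
  show "f \<in> relation_ideal \<R> \<Longrightarrow> - f \<in> relation_ideal \<R>" using additive_subgroup.a_inv_closed[OF is_additive_subgroup, of f] by simp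
  show "f \<in> relation_ideal \<R> \<Longrightarrow> g * f \<in> relation_ideal \<R>" using I_l_closed[of f g] by simp
  show "f \<in> relation_ideal \<R> \<Longrightarrow> f * g \<in> relation_ideal \<R>" using I_r_closed[of f g] by simp
qed

lemma relation_ideal_diff:
  "f \<in> relation_ideal \<R> \<Longrightarrow> g \<in> relation_ideal \<R> \<Longrightarrow> f - g \<in> relation_ideal \<R>"
  using relation_ideal_add[OF _ relation_ideal_uminus, of f \<R> g] by simp

text \<open>The star operation reverses products, so it maps two-sided ideals to two-sided ideals, and it
  permutes the generators of this one.\<close>

lemma relation_ideal_star:
  assumes "f \<in> relation_ideal \<R>" shows "free_star f \<in> relation_ideal \<R>"
proof -
  have z: "free_star 0 = (0 :: 'a word \<Rightarrow>\<^sub>0 complex)"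
    using free_star_single[of 0 0] by simp
  have "relation_ideal \<R> \<subseteq> {f. free_star f \<in> relation_ideal \<R>}"
    by (rule relation_ideal_minimal)
      (auto simp: z free_star_add free_star_mult
        intro: relation_ideal_zero relation_ideal_add relation_ideal_left relation_ideal_right relation_ideal_base)
  then show ?thesis using assms by auto
qed

text \<open>The coset of \<open>f\<close> as a congruence class: equality of cosets becomes membership of a difference
  in the ideal.\<close>

definition cls :: "('g word \<Rightarrow>\<^sub>0 complex) set \<Rightarrow> ('g word \<Rightarrow>\<^sub>0 complex) \<Rightarrow> ('g word \<Rightarrow>\<^sub>0 complex) set" where
  "cls \<R> f = {g. g - f \<in> relation_ideal \<R>}"

lemma coset_eq_cls: "relation_ideal \<R> +>\<^bsub>free_star_alg\<^esub> f = cls \<R> f"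
proof -
  have "relation_ideal \<R> +>\<^bsub>free_star_alg\<^esub> f = (\<lambda>h. h + f) ` relation_ideal \<R>"
    by (auto simp: a_r_coset_def')
  moreover have "g \<in> (\<lambda>h. h + f) ` relation_ideal \<R> \<longleftrightarrow> g - f \<in> relation_ideal \<R>" for g
    by (metis (no_types, lifting) add_diff_cancel diff_add_cancel image_iff)
  ultimately show ?thesis by (auto simp: cls_def)
qed

lemma cls_self [simp]: "f \<in> cls \<R> f"
  by (simp add: cls_def relation_ideal_zero)

lemma cls_eq_iff: "cls \<R> f = cls \<R> g \<longleftrightarrow> f - g \<in> relation_ideal \<R>"
proof
  assume "cls \<R> f = cls \<R> g"
  then show "f - g \<in> relation_ideal \<R>" using cls_self[of f \<R>] by (simp add: cls_def)
next
  assume d: "f - g \<in> relation_ideal \<R>"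
  have "h - f \<in> relation_ideal \<R> \<longleftrightarrow> h - g \<in> relation_ideal \<R>" for h
    using relation_ideal_add[OF _ d, of "h - f"] relation_ideal_diff[OF _ d, of "h - g"] by auto
  then show "cls \<R> f = cls \<R> g" by (simp add: cls_def)
qed

text \<open>The operations of the quotient are unions over all representatives. An operation that respects
  the congruence sends all of them to the same coset.\<close>

lemma UN_cls:
  assumes "\<And>g. g - f \<in> relation_ideal \<R> \<Longrightarrow> h g - h f \<in> relation_ideal \<R>"
  shows "(\<Union>x\<in>cls \<R> f. cls \<R> (h x)) = cls \<R> (h f)"
proof -
  have "cls \<R> (h x) = cls \<R> (h f)" if "x \<in> cls \<R> f" for x
    using assms that unfolding cls_eq_iff by (simp add: cls_def)
  then show ?thesis using cls_self[of f \<R>] by blast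
qed

lemma presented_carrier: "carrier (presented_star_alg \<R>) = range (cls \<R>)"
proof -
  have "carrier (presented_star_alg \<R>) = (\<Union>f. {relation_ideal \<R> +>\<^bsub>free_star_alg\<^esub> f})"
    by (simp add: presented_star_alg_def quot_star_alg_def FactRing_def A_RCOSETS_def RCOSETS_def a_r_coset_def)
  then show ?thesis by (auto simp: coset_eq_cls)
qed

lemma presented_ops:
  shows presented_one: "one (presented_star_alg \<R>) = cls \<R> 1"
    and presented_zero: "zero (presented_star_alg \<R>) = cls \<R> 0"
    and presented_add: "cls \<R> f \<oplus>\<^bsub>presented_star_alg \<R>\<^esub> cls \<R> g = cls \<R> (f + g)"
    and presented_mult: "cls \<R> f \<otimes>\<^bsub>presented_star_alg \<R>\<^esub> cls \<R> g = cls \<R> (f * g)"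
    and presented_smult: "c \<odot>\<^bsub>presented_star_alg \<R>\<^esub> cls \<R> f = cls \<R> (scal c * f)"
    and presented_star: "star (presented_star_alg \<R>) (cls \<R> f) = cls \<R> (free_star f)"
proof -
  interpret ideal "relation_ideal \<R>" free_star_alg by (rule ideal_relation_ideal)
  show "one (presented_star_alg \<R>) = cls \<R> 1"
    by (simp add: presented_star_alg_def quot_star_alg_def FactRing_def coset_eq_cls)
  show "zero (presented_star_alg \<R>) = cls \<R> 0"
    by (simp add: presented_star_alg_def quot_star_alg_def FactRing_def cls_def)
  show "cls \<R> f \<oplus>\<^bsub>presented_star_alg \<R>\<^esub> cls \<R> g = cls \<R> (f + g)"
    using a_rcos_sum[of f g]
    by (simp add: presented_star_alg_def quot_star_alg_def FactRing_def coset_eq_cls)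
  show "cls \<R> f \<otimes>\<^bsub>presented_star_alg \<R>\<^esub> cls \<R> g = cls \<R> (f * g)"
    using rcoset_mult_add[of f g]
    by (simp add: presented_star_alg_def quot_star_alg_def FactRing_def coset_eq_cls)
  show "c \<odot>\<^bsub>presented_star_alg \<R>\<^esub> cls \<R> f = cls \<R> (scal c * f)"
    using UN_cls[of f \<R> "\<lambda>f. scal c * f"] relation_ideal_left[of _ \<R> "scal c"]
    by (simp add: presented_star_alg_def quot_star_alg_def coset_eq_cls flip: right_diff_distrib)
  have m: "free_star g - free_star f = free_star (g - f)" for f g :: "'a word \<Rightarrow>\<^sub>0 complex"
    using free_star_add[of "g - f" f] by simp
  show "star (presented_star_alg \<R>) (cls \<R> f) = cls \<R> (free_star f)"
    using UN_cls[of f \<R> free_star] relation_ideal_star[of _ \<R>]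
    by (simp add: presented_star_alg_def quot_star_alg_def coset_eq_cls m)
qed

lemma star_algebra_presented: "star_algebra (presented_star_alg \<R>)"
proof -
  have "ring (presented_star_alg \<R>)"
  proof (rule ringI)
    show "abelian_group (presented_star_alg \<R>)"
    proof (rule abelian_groupI)
      fix x assume "x \<in> carrier (presented_star_alg \<R>)"
      then obtain f where f: "x = cls \<R> f" by (auto simp: presented_carrier)
      show "\<exists>y\<in>carrier (presented_star_alg \<R>). y \<oplus>\<^bsub>presented_star_alg \<R>\<^esub> x = \<zero>\<^bsub>presented_star_alg \<R>\<^esub>"
        by (rule bexI[of _ "cls \<R> (- f)"]) (auto simp: f presented_ops presented_carrier)
    qed (auto simp: presented_carrier presented_ops algebra_simps)
    show "Group.monoid (presented_star_alg \<R>)"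
      by (rule monoidI) (auto simp: presented_carrier presented_ops algebra_simps)
  qed (auto simp: presented_carrier presented_ops algebra_simps)
  then interpret ring "presented_star_alg \<R>" .
  have ss: "scal c * (scal d * f) = scal (c * d) * f" for c d and f :: "'a word \<Rightarrow>\<^sub>0 complex"
    by (simp add: mult.assoc[symmetric] mult_single)
  have comm: "f * (scal c * g) = scal c * (f * g)" for f g :: "'a word \<Rightarrow>\<^sub>0 complex" and c
    by (simp add: scal_commute[of c f] mult.assoc[symmetric])
  have st: "free_star (scal c * f) = scal (cnj c) * free_star f" for f :: "'a word \<Rightarrow>\<^sub>0 complex" and c
    by (simp add: free_star_mult scal_commute)
  note presented = presented_carrier presented_ops
  show ?thesis
    by unfold_locales
      ((auto simp: presented distrib_left distrib_right free_star_add single_add ss st mult.assoc; fail)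
        | (auto simp: presented comm; fail) | (auto simp: presented free_star_mult; fail))+
qed


section \<open>Calculating in star-algebras\<close>

context star_algebra
begin

lemma zero_smult [simp]:
  assumes "x \<in> carrier R" shows "0 \<odot>\<^bsub>R\<^esub> x = \<zero>"
proof -
  have "0 \<odot>\<^bsub>R\<^esub> x \<oplus> 0 \<odot>\<^bsub>R\<^esub> x = 0 \<odot>\<^bsub>R\<^esub> x" using add_smult[OF assms, of 0 0] by simp
  then show ?thesis using assms by (metis add.l_cancel_one smult_closed)
qed

lemma smult_zero [simp]: "c \<odot>\<^bsub>R\<^esub> \<zero> = \<zero>"
  using smult_smult[of \<zero> c 0] by simp

lemma minus_eq_smult: "x \<in> carrier R \<Longrightarrow> \<ominus> x = (- 1) \<odot>\<^bsub>R\<^esub> x"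
  using add_smult[of x "-1" 1] by (intro minus_equality) auto

lemma smult_minus: "x \<in> carrier R \<Longrightarrow> c \<odot>\<^bsub>R\<^esub> (\<ominus> x) = \<ominus> (c \<odot>\<^bsub>R\<^esub> x)"
  by (simp add: minus_eq_smult smult_smult)

lemma star_zero [simp]: "star R \<zero> = \<zero>"
  using star_smult[of \<zero> 0] by simp

lemma star_one [simp]: "star R \<one> = \<one>"
  using star_mult[of "star R \<one>" \<one>] by simp

lemma star_minus: "x \<in> carrier R \<Longrightarrow> star R (\<ominus> x) = \<ominus> star R x"
  by (simp add: minus_eq_smult star_smult)

lemma star_pow: "x \<in> carrier R \<Longrightarrow> star R (x [^] (n::nat)) = star R x [^] n"
  by (induction n) (simp_all add: star_mult flip: nat_pow_Suc2)

lemma minus_minus_eq: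
  "x \<in> carrier R \<Longrightarrow> y \<in> carrier R \<Longrightarrow> x \<ominus> (x \<ominus> y) = y"
  by algebra

lemma smult_diff: "x \<in> carrier R \<Longrightarrow> y \<in> carrier R \<Longrightarrow>
    c \<odot>\<^bsub>R\<^esub> (x \<ominus> y) = c \<odot>\<^bsub>R\<^esub> x \<ominus> c \<odot>\<^bsub>R\<^esub> y"
  by (simp add: a_minus_def smult_add smult_minus)


subsection \<open>Star-subalgebras\<close>

lemma star_subalgebraI:
  assumes "S \<subseteq> carrier R" "\<one> \<in> S" "\<And>x y. x \<in> S \<Longrightarrow> y \<in> S \<Longrightarrow> x \<oplus> y \<in> S"
    "\<And>x y. x \<in> S \<Longrightarrow> y \<in> S \<Longrightarrow> x \<otimes> y \<in> S" "\<And>c x. x \<in> S \<Longrightarrow> c \<odot>\<^bsub>R\<^esub> x \<in> S"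
    "\<And>x. x \<in> S \<Longrightarrow> star R x \<in> S"
  shows "star_subalgebra S R"
  unfolding star_subalgebra_def
proof (intro conjI)
  show "subring S R"
    by (rule subringI) (use assms minus_eq_smult in \<open>auto simp: subset_iff\<close>)
qed (use assms in auto)

lemma star_subalgebraD:
  assumes "star_subalgebra S R"
  shows "S \<subseteq> carrier R" "\<one> \<in> S" "\<zero> \<in> S"
    "\<And>x y. x \<in> S \<Longrightarrow> y \<in> S \<Longrightarrow> x \<oplus> y \<in> S" "\<And>x. x \<in> S \<Longrightarrow> \<ominus> x \<in> S"
    "\<And>x y. x \<in> S \<Longrightarrow> y \<in> S \<Longrightarrow> x \<ominus> y \<in> S"
    "\<And>x y. x \<in> S \<Longrightarrow> y \<in> S \<Longrightarrow> x \<otimes> y \<in> S" "\<And>c x. x \<in> S \<Longrightarrow> c \<odot>\<^bsub>R\<^esub> x \<in> S"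
    "\<And>x. x \<in> S \<Longrightarrow> star R x \<in> S"
  using assms subringE[of S R] by (auto simp: star_subalgebra_def a_minus_def)

lemma star_subalgebra_pow: "star_subalgebra S R \<Longrightarrow> x \<in> S \<Longrightarrow> x [^] (n::nat) \<in> S"
  by (induction n) (auto dest: star_subalgebraD)

lemma star_subalgebra_finsum:
  assumes S: "star_subalgebra S R" and "finite F" "f \<in> F \<rightarrow> S"
  shows "finsum R f F \<in> S"
  using assms(2,3)
proof (induction F rule: finite_induct)
  case (insert i F)
  then show ?case using star_subalgebraD[OF S]
    by (subst finsum_insert) (auto simp: Pi_def)
qed (use star_subalgebraD[OF S] in auto)

lemma star_algebra_subalgebra:
  assumes "star_subalgebra S R"
  shows "star_algebra (R\<lparr>carrier := S\<rparr>)"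
proof -
  note S = star_subalgebraD[OF assms]
  interpret S: ring "R\<lparr>carrier := S\<rparr>"
    by (rule subring_is_ring) (use assms in \<open>simp add: star_subalgebra_def\<close>)
  show ?thesis
    by unfold_locales (use S in \<open>auto simp: smult_add add_smult smult_smult smult_mult mult_smult
      star_add star_mult star_smult subset_iff\<close>)
qed

lemma carrier_star_subalgebra: "star_subalgebra (carrier R) R"
  by (rule star_subalgebraI) auto

lemma generated_star_subalgebra:
  assumes "H \<subseteq> carrier R"
  shows "star_subalgebra (carrier (generated_star_subalgebra R H)) R"
proof (rule star_subalgebraI)
  show "carrier (generated_star_subalgebra R H) \<subseteq> carrier R"
    using carrier_star_subalgebra assms by (auto simp: generated_star_subalgebra_def)
qed (auto simp: generated_star_subalgebra_def dest: star_subalgebraD)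

lemma generated_star_subalgebra_base: "h \<in> H \<Longrightarrow> h \<in> carrier (generated_star_subalgebra R H)"
  by (auto simp: generated_star_subalgebra_def)

lemma generated_star_subalgebra_least:
  "star_subalgebra S R \<Longrightarrow> H \<subseteq> S \<Longrightarrow> carrier (generated_star_subalgebra R H) \<subseteq> S"
  by (auto simp: generated_star_subalgebra_def)


subsection \<open>Commutation up to a scalar\<close>

text \<open>All commutation relations between the monomials below have this form; products, powers and
  adjoints change only the scalar.\<close>

definition scalar_comm :: "complex \<Rightarrow> 'b \<Rightarrow> 'b \<Rightarrow> bool" where
  "scalar_comm \<mu> u v \<longleftrightarrow> u \<in> carrier R \<and> v \<in> carrier R \<and> u \<otimes> v = \<mu> \<odot>\<^bsub>R\<^esub> (v \<otimes> u)"

lemma scalar_commD: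
  assumes "scalar_comm \<mu> u v"
  shows "u \<in> carrier R" "v \<in> carrier R" "u \<otimes> v = \<mu> \<odot>\<^bsub>R\<^esub> (v \<otimes> u)"
  using assms by (auto simp: scalar_comm_def)

lemma scalar_comm_mult_left:
  assumes "scalar_comm \<mu> u v" "scalar_comm \<nu> u' v"
  shows "scalar_comm (\<mu> * \<nu>) (u \<otimes> u') v"
proof -
  note c = scalar_commD[OF assms(1)] scalar_commD[OF assms(2)]
  have "u \<otimes> u' \<otimes> v = \<nu> \<odot>\<^bsub>R\<^esub> ((u \<otimes> v) \<otimes> u')"
    using c(1,2,4) by (simp add: m_assoc c(6) mult_smult)
  also have "\<dots> = (\<mu> * \<nu>) \<odot>\<^bsub>R\<^esub> (v \<otimes> (u \<otimes> u'))"
    using c(1,2,4) by (simp add: m_assoc c(3) smult_mult smult_smult mult.commute)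
  finally show ?thesis using c(1,2,4) by (simp add: scalar_comm_def)
qed

lemma scalar_comm_mult_right:
  assumes "scalar_comm \<mu> u v" "scalar_comm \<nu> u v'"
  shows "scalar_comm (\<mu> * \<nu>) u (v \<otimes> v')"
proof -
  note c = scalar_commD[OF assms(1)] scalar_commD[OF assms(2)]
  have "u \<otimes> (v \<otimes> v') = \<mu> \<odot>\<^bsub>R\<^esub> (v \<otimes> (u \<otimes> v'))"
    using c(1,2,5) by (simp add: m_assoc[symmetric] c(3) smult_mult)
  also have "\<dots> = (\<mu> * \<nu>) \<odot>\<^bsub>R\<^esub> ((v \<otimes> v') \<otimes> u)"
    using c(1,2,5) by (simp add: m_assoc c(6) mult_smult smult_smult)
  finally show ?thesis using c(1,2,5) by (simp add: scalar_comm_def)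
qed

lemma scalar_comm_one_left [simp]: "u \<in> carrier R \<Longrightarrow> scalar_comm 1 \<one> u"
  and scalar_comm_one_right [simp]: "u \<in> carrier R \<Longrightarrow> scalar_comm 1 u \<one>"
  by (simp_all add: scalar_comm_def)

lemma scalar_comm_pow_left: "scalar_comm \<mu> u v \<Longrightarrow> scalar_comm (\<mu> ^ n) (u [^] n) v"
  using scalar_comm_mult_left[of "\<mu> ^ m" "u [^] m" v \<mu> u for m]
  by (induction n) (auto simp: mult.commute dest: scalar_commD)

lemma scalar_comm_pow_right: "scalar_comm \<mu> u v \<Longrightarrow> scalar_comm (\<mu> ^ n) u (v [^] n)"
  using scalar_comm_mult_right[of "\<mu> ^ m" u "v [^] m" \<mu> v for m]
  by (induction n) (auto simp: mult.commute dest: scalar_commD)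

lemma scalar_comm_star:
  assumes "scalar_comm \<mu> u v" shows "scalar_comm (cnj \<mu>) (star R v) (star R u)"
  using scalar_commD[OF assms] by (simp add: scalar_comm_def star_smult flip: star_mult)

lemma scalar_comm_sym:
  assumes "scalar_comm \<mu> u v" "\<mu> * \<nu> = 1" shows "scalar_comm \<nu> v u"
  using scalar_commD[OF assms(1)] assms(2)
  by (simp add: scalar_comm_def smult_smult mult.commute[of \<nu>])


subsection \<open>Polynomials in one element\<close>

text \<open>Reads: \<open>c = g(z)\<close> with a polynomial function \<open>g\<close>. Carrying the function along, instead of a
  formal polynomial, makes rescaling of the argument and evaluation at eigenvalues immediate.\<close>

inductive poly_in :: "'b \<Rightarrow> 'b \<Rightarrow> (complex \<Rightarrow> complex) \<Rightarrow> bool" for z where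
  const: "poly_in z (c \<odot>\<^bsub>R\<^esub> \<one>) (\<lambda>_. c)"
| var: "poly_in z z (\<lambda>t. t)"
| add: "poly_in z c g \<Longrightarrow> poly_in z d h \<Longrightarrow> poly_in z (c \<oplus> d) (\<lambda>t. g t + h t)"
| mult: "poly_in z c g \<Longrightarrow> poly_in z d h \<Longrightarrow> poly_in z (c \<otimes> d) (\<lambda>t. g t * h t)"

lemma poly_in_subalgebra:
  assumes "star_subalgebra S R" "z \<in> S" "poly_in z c g" shows "c \<in> S"
  using assms(3) by induction (use star_subalgebraD[OF assms(1)] assms(2) in auto)

lemma poly_in_closed: "z \<in> carrier R \<Longrightarrow> poly_in z c g \<Longrightarrow> c \<in> carrier R"
  using poly_in_subalgebra[OF carrier_star_subalgebra] .

lemma poly_in_one: "poly_in z \<one> (\<lambda>_. 1)"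
  using poly_in.const[of z 1] by simp

lemma poly_in_smult:
  assumes "z \<in> carrier R" "poly_in z c g" shows "poly_in z (e \<odot>\<^bsub>R\<^esub> c) (\<lambda>t. e * g t)"
  using poly_in.mult[OF poly_in.const[of z e] assms(2)] poly_in_closed[OF assms]
  by (simp add: smult_mult)

lemma poly_in_diff:
  assumes "z \<in> carrier R" "poly_in z c g" "poly_in z d h"
  shows "poly_in z (c \<ominus> d) (\<lambda>t. g t - h t)"
  using poly_in.add[OF assms(2) poly_in_smult[OF assms(1,3), of "-1"]]
    poly_in_closed[OF assms(1,3)] by (simp add: a_minus_def minus_eq_smult)

text \<open>Moving \<open>u\<close> past \<open>z\<close> rescales \<open>z\<close>, so moving it past a polynomial rescales the argument.\<close>

lemma poly_in_intertwine:
  assumes "scalar_comm \<mu> u z" "poly_in z c g"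
  shows "\<exists>c'. poly_in z c' (\<lambda>t. g (\<mu> * t)) \<and> u \<otimes> c = c' \<otimes> u"
  using assms(2)
proof induction
  case (const e)
  then show ?case using scalar_commD[OF assms(1)]
    by (intro exI[of _ "e \<odot>\<^bsub>R\<^esub> \<one>"]) (auto intro: poly_in.const simp: smult_mult mult_smult)
next
  case var
  then show ?case using scalar_commD[OF assms(1)] poly_in_smult[OF _ poly_in.var, of z \<mu>]
    by (intro exI[of _ "\<mu> \<odot>\<^bsub>R\<^esub> z"]) (auto simp: smult_mult)
next
  case (add c g d h)
  note z = scalar_commD[OF assms(1)]
  obtain c' d' where *: "poly_in z c' (\<lambda>t. g (\<mu> * t))" "u \<otimes> c = c' \<otimes> u"
    "poly_in z d' (\<lambda>t. h (\<mu> * t))" "u \<otimes> d = d' \<otimes> u" using add by blast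
  show ?case
    using z * poly_in.add[OF *(1,3)] add poly_in_closed[OF z(2)]
    by (intro exI[of _ "c' \<oplus> d'"]) (auto simp: l_distr r_distr)
next
  case (mult c g d h)
  note z = scalar_commD[OF assms(1)]
  obtain c' d' where *: "poly_in z c' (\<lambda>t. g (\<mu> * t))" "u \<otimes> c = c' \<otimes> u"
    "poly_in z d' (\<lambda>t. h (\<mu> * t))" "u \<otimes> d = d' \<otimes> u" using mult by blast
  have cl: "c \<in> carrier R" "d \<in> carrier R" "c' \<in> carrier R" "d' \<in> carrier R"
    using mult * poly_in_closed[OF z(2)] by auto
  have "u \<otimes> (c \<otimes> d) = c' \<otimes> (u \<otimes> d)"
    using z cl by (simp add: m_assoc[symmetric] *(2))
  also have "\<dots> = c' \<otimes> d' \<otimes> u" using z cl by (simp add: *(4) m_assoc)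
  finally show ?case using poly_in.mult[OF *(1,3)] by blast
qed

lemma poly_in_commute:
  assumes "u \<in> carrier R" "z \<in> carrier R" "u \<otimes> z = z \<otimes> u" "poly_in z c g"
  shows "u \<otimes> c = c \<otimes> u"
  using assms(4)
proof induction
  case (add c g d h)
  then show ?case using assms(1) poly_in_closed[OF assms(2)] by (simp add: l_distr r_distr)
next
  case (mult c g d h)
  then have cl: "c \<in> carrier R" "d \<in> carrier R" using poly_in_closed[OF assms(2)] by auto
  have "u \<otimes> (c \<otimes> d) = c \<otimes> (u \<otimes> d)" using assms(1) cl by (metis mult.IH(1) m_assoc)
  also have "\<dots> = c \<otimes> d \<otimes> u" using assms(1) cl by (metis mult.IH(2) m_assoc)
  finally show ?case .
qed (use assms in \<open>auto simp: smult_mult mult_smult\<close>)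

text \<open>The constant term is split off. The cofactor commutes with \<open>z\<close>, so that \<open>z\<close> may be put on
  either side of it.\<close>

lemma poly_in_split:
  assumes z: "z \<in> carrier R" and "poly_in z c g"
  shows "\<exists>c'\<in>carrier R. c' \<otimes> z = z \<otimes> c' \<and> c = g 0 \<odot>\<^bsub>R\<^esub> \<one> \<oplus> c' \<otimes> z"
  using assms(2)
proof induction
  case (const e)
  then show ?case using z by (intro bexI[of _ \<zero>]) auto
next
  case var
  then show ?case using z by (intro bexI[of _ \<one>]) auto
next
  case (add c g d h)
  then obtain c' d' where *: "c' \<in> carrier R" "d' \<in> carrier R" "c' \<otimes> z = z \<otimes> c'" "d' \<otimes> z = z \<otimes> d'"
    "c = g 0 \<odot>\<^bsub>R\<^esub> \<one> \<oplus> c' \<otimes> z" "d = h 0 \<odot>\<^bsub>R\<^esub> \<one> \<oplus> d' \<otimes> z" by blast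
  have "c \<oplus> d = (g 0 + h 0) \<odot>\<^bsub>R\<^esub> \<one> \<oplus> (c' \<oplus> d') \<otimes> z"
    unfolding *(5,6) using *(1,2) z by (simp add: add_smult l_distr a_ac)
  then show ?case using * z by (intro bexI[of _ "c' \<oplus> d'"]) (auto simp: l_distr r_distr)
next
  case (mult c g d h)
  then obtain c' d' where *: "c' \<in> carrier R" "d' \<in> carrier R" "c' \<otimes> z = z \<otimes> c'" "d' \<otimes> z = z \<otimes> d'"
    "c = g 0 \<odot>\<^bsub>R\<^esub> \<one> \<oplus> c' \<otimes> z" "d = h 0 \<odot>\<^bsub>R\<^esub> \<one> \<oplus> d' \<otimes> z" by blast
  have d: "d \<in> carrier R" using poly_in_closed[OF z mult(2)] .
  have dz: "d \<otimes> z = z \<otimes> d" using poly_in_commute[OF z z refl mult(2)] by simp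
  let ?e = "g 0 \<odot>\<^bsub>R\<^esub> d' \<oplus> c' \<otimes> d"
  have "c \<otimes> d = g 0 \<odot>\<^bsub>R\<^esub> d \<oplus> c' \<otimes> (z \<otimes> d)"
    unfolding *(5) using *(1) z d by (simp add: l_distr smult_mult m_assoc)
  also have "g 0 \<odot>\<^bsub>R\<^esub> d = (g 0 * h 0) \<odot>\<^bsub>R\<^esub> \<one> \<oplus> (g 0 \<odot>\<^bsub>R\<^esub> d') \<otimes> z"
    using * z by (simp add: *(6) smult_add smult_smult smult_mult)
  also have "c' \<otimes> (z \<otimes> d) = (c' \<otimes> d) \<otimes> z"
    using *(1) z d by (simp add: dz m_assoc)
  finally have "c \<otimes> d = (g 0 * h 0) \<odot>\<^bsub>R\<^esub> \<one> \<oplus> ?e \<otimes> z"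
    using * z d by (simp add: l_distr a_assoc)
  moreover have "?e \<otimes> z = z \<otimes> ?e"
  proof -
    have "c' \<otimes> d \<otimes> z = z \<otimes> (c' \<otimes> d)"
      using *(1,3) z d by (metis dz m_assoc)
    then show ?thesis using * z d by (simp add: l_distr r_distr smult_mult mult_smult)
  qed
  moreover have "?e \<in> carrier R" using *(1,2) d by simp
  ultimately show ?case by blast
qed

definition poly_eval :: "'b \<Rightarrow> complex poly \<Rightarrow> 'b" where
  "poly_eval z P = fold_coeffs (\<lambda>c e. c \<odot>\<^bsub>R\<^esub> \<one> \<oplus> z \<otimes> e) P \<zero>"

lemma poly_eval_zero [simp]: "poly_eval z 0 = \<zero>"
  by (simp add: poly_eval_def)

lemma poly_eval_pCons [simp]:
  "z \<in> carrier R \<Longrightarrow> poly_eval z (pCons c P) = c \<odot>\<^bsub>R\<^esub> \<one> \<oplus> z \<otimes> poly_eval z P"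
  by (cases "P = 0 \<and> c = 0") (auto simp: poly_eval_def)

lemma poly_eval_closed [simp]: "z \<in> carrier R \<Longrightarrow> poly_eval z P \<in> carrier R"
  by (induction P) auto

lemma poly_eval_add:
  "z \<in> carrier R \<Longrightarrow> poly_eval z (P + Q) = poly_eval z P \<oplus> poly_eval z Q"
  by (induction P Q rule: poly_induct2) (auto simp: add_smult r_distr a_ac)

lemma poly_eval_smult: "z \<in> carrier R \<Longrightarrow> poly_eval z (Polynomial.smult c P) = c \<odot>\<^bsub>R\<^esub> poly_eval z P"
  by (induction P) (auto simp: smult_add smult_smult mult_smult)

lemma poly_eval_mult:
  assumes "z \<in> carrier R" shows "poly_eval z (P * Q) = poly_eval z P \<otimes> poly_eval z Q"
  using assms
  by (induction P) (auto simp: poly_eval_add poly_eval_smult l_distr smult_mult m_assoc)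

text \<open>A complex polynomial is determined by its values, and \<open>poly_eval z\<close> is a homomorphism; so equal
  functions come from equal elements.\<close>

lemma poly_in_unique:
  assumes z: "z \<in> carrier R" and "poly_in z c g" "poly_in z d g"
  shows "c = d"
proof -
  have *: "\<exists>P. g = poly P \<and> c = poly_eval z P" if "poly_in z c g" for c g
    using that
  proof induction
    case (const e)
    then show ?case using z by (intro exI[of _ "[:e:]"]) (auto simp: fun_eq_iff)
  next
    case var
    have "1 \<odot>\<^bsub>R\<^esub> \<one> = \<one>" by (rule smult_one) simp
    then show ?case using z by (intro exI[of _ "[:0, 1:]"]) (auto simp: fun_eq_iff)
  next
    case (add c g d h)
    then show ?case using poly_eval_add[OF z] by (auto simp: fun_eq_iff) (metis poly_add)
  next
    case (mult c g d h)
    then show ?case using poly_eval_mult[OF z] by (auto simp: fun_eq_iff) (metis poly_mult)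
  qed
  show ?thesis using *[OF assms(2)] *[OF assms(3)] by (auto simp: poly_eq_poly_eq_iff)
qed

lemma isCont_poly_in: "poly_in z c g \<Longrightarrow> isCont g t"
  by (induction rule: poly_in.induct) auto

end


section \<open>The \<open>q\<close>-oscillator relation\<close>

text \<open>The relation for one of the two generators. It is equivalent to \<open>a* a = 1 - p A\<close> with
  \<open>A = 1 - a a*\<close>: one factor \<open>p\<close> appears whenever \<open>a\<close> moves past \<open>A\<close>. In a representation, \<open>a\<close>
  is a raising operator between eigenvectors of \<open>A\<close> with eigenvalues \<open>\<lambda>\<close> and \<open>p \<lambda>\<close>.\<close>

locale q_oscillator = star_algebra R for R :: "'b star_alg" (structure) +
  fixes a :: 'b and p :: real
  assumes a_closed [simp]: "a \<in> carrier R" and p_pos: "p > 0"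
    and oscillator: "star R a \<otimes> a = of_real p \<odot>\<^bsub>R\<^esub> (a \<otimes> star R a) \<oplus> of_real (1 - p) \<odot>\<^bsub>R\<^esub> \<one>"
begin

definition A where "A = \<one> \<ominus> a \<otimes> star R a"

lemma A_closed [simp]: "A \<in> carrier R" by (simp add: A_def)

lemma star_A [simp]: "star R A = A"
  by (simp add: A_def a_minus_def star_add star_minus star_mult)

lemma a_star_a: "a \<otimes> star R a = \<one> \<ominus> A"
  by (simp add: A_def minus_minus_eq)

lemma star_a_a: "star R a \<otimes> a = \<one> \<ominus> of_real p \<odot>\<^bsub>R\<^esub> A"
proof -
  have "star R a \<otimes> a = of_real p \<odot>\<^bsub>R\<^esub> \<one> \<oplus> of_real (1 - p) \<odot>\<^bsub>R\<^esub> \<one> \<ominus> of_real p \<odot>\<^bsub>R\<^esub> A"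
    by (simp add: oscillator a_star_a smult_diff) (simp add: a_minus_def a_ac)
  also have "of_real p \<odot>\<^bsub>R\<^esub> \<one> \<oplus> of_real (1 - p) \<odot>\<^bsub>R\<^esub> \<one> = \<one>"
    by (simp flip: add_smult)
  finally show ?thesis .
qed

lemma A_a: "scalar_comm (of_real p) A a"
proof -
  have "A \<otimes> a = a \<ominus> a \<otimes> (star R a \<otimes> a)"
    by (simp add: A_def a_minus_def l_distr l_minus m_assoc)
  also have "\<dots> = of_real p \<odot>\<^bsub>R\<^esub> (a \<otimes> A)"
    unfolding star_a_a
    by (simp add: a_minus_def r_distr r_minus minus_add mult_smult a_assoc[symmetric] r_neg)
  finally show ?thesis by (simp add: scalar_comm_def)
qed

lemma a_A: "scalar_comm (of_real (inverse p)) a A"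
  using scalar_comm_sym[OF A_a] p_pos by (simp flip: of_real_mult)

lemma star_a_A: "scalar_comm (of_real p) (star R a) A"
  using scalar_comm_star[OF A_a] by simp

lemma pow_A:
  shows "scalar_comm (of_real (inverse p ^ n)) (a [^] n) A"
    and "scalar_comm (of_real (p ^ n)) (star R (a [^] n)) A"
  using scalar_comm_pow_left[OF a_A, of n] scalar_comm_pow_left[OF star_a_A, of n]
  by (simp_all add: star_pow)

text \<open>The outermost factors are peeled off: \<open>a c(A) a*\<close> is \<open>c(A/p) a a*\<close>.\<close>

lemma pow_star_pow:
  "poly_in A (a [^] n \<otimes> star R (a [^] n)) (\<lambda>t. \<Prod>i<n. 1 - of_real (inverse p ^ i) * t)"
proof (induction n)
  case 0
  then show ?case by (simp add: poly_in_one)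
next
  case (Suc n)
  obtain c where c: "poly_in A c (\<lambda>t. \<Prod>i<n. 1 - of_real (inverse p ^ i) * (of_real (inverse p) * t))"
    "a \<otimes> (a [^] n \<otimes> star R (a [^] n)) = c \<otimes> a"
    using poly_in_intertwine[OF a_A Suc.IH] by blast
  have [simp]: "c \<in> carrier R" using poly_in_closed[OF A_closed c(1)] .
  have "a [^] Suc n \<otimes> star R (a [^] Suc n) = a \<otimes> (a [^] n \<otimes> star R (a [^] n)) \<otimes> star R a"
    unfolding nat_pow_Suc2[OF a_closed] by (simp add: star_mult m_assoc)
  also have "\<dots> = c \<otimes> (\<one> \<ominus> A)" by (simp add: c(2) m_assoc a_star_a)
  finally have "poly_in A (a [^] Suc n \<otimes> star R (a [^] Suc n))
      (\<lambda>t. (\<Prod>i<n. 1 - of_real (inverse p ^ i) * (of_real (inverse p) * t)) * (1 - t))"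
    using poly_in.mult[OF c(1) poly_in_diff[OF A_closed poly_in_one poly_in.var]] by simp
  also have "(\<lambda>t. (\<Prod>i<n. 1 - of_real (inverse p ^ i) * (of_real (inverse p) * t)) * (1 - t))
      = (\<lambda>t::complex. \<Prod>i<Suc n. 1 - of_real (inverse p ^ i) * t)"
    unfolding prod.lessThan_Suc_shift by (simp add: mult_ac)
  finally show ?case .
qed

lemma star_pow_pow:
  "poly_in A (star R (a [^] n) \<otimes> a [^] n) (\<lambda>t. \<Prod>i=1..n. 1 - of_real (p ^ i) * t)"
proof (induction n)
  case 0
  then show ?case by (simp add: poly_in_one)
next
  case (Suc n)
  obtain c where c: "poly_in A c (\<lambda>t. \<Prod>i=1..n. 1 - of_real (p ^ i) * (of_real p * t))"
    "star R a \<otimes> (star R (a [^] n) \<otimes> a [^] n) = c \<otimes> star R a"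
    using poly_in_intertwine[OF star_a_A Suc.IH] by blast
  have [simp]: "c \<in> carrier R" using poly_in_closed[OF A_closed c(1)] .
  have "star R (a [^] Suc n) \<otimes> a [^] Suc n = star R a \<otimes> (star R (a [^] n) \<otimes> a [^] n) \<otimes> a"
    by (simp add: star_mult m_assoc)
  also have "\<dots> = c \<otimes> (\<one> \<ominus> of_real p \<odot>\<^bsub>R\<^esub> A)" by (simp add: c(2) m_assoc star_a_a)
  finally have "poly_in A (star R (a [^] Suc n) \<otimes> a [^] Suc n)
      (\<lambda>t. (\<Prod>i=1..n. 1 - of_real (p ^ i) * (of_real p * t)) * (1 - of_real p * t))"
    using poly_in.mult[OF c(1) poly_in_diff[OF A_closed poly_in_one
        poly_in_smult[OF A_closed poly_in.var, of "of_real p"]]] by simp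
  also have "(\<lambda>t. (\<Prod>i=1..n. 1 - of_real (p ^ i) * (of_real p * t)) * (1 - of_real p * t))
      = (\<lambda>t::complex. \<Prod>i=1..Suc n. 1 - of_real (p ^ i) * t)"
    unfolding One_nat_def prod.atLeast1_atMost_eq prod.lessThan_Suc_shift[of _ n] by (simp add: mult_ac)
  finally show ?case .
qed

end


subsection \<open>Signed powers\<close>

context star_algebra
begin

(* The rule pow_nat would turn the natural exponents below into integer ones, which presuppose inverses. *)
declare pow_nat [simp del]

definition spow :: "'b \<Rightarrow> int \<Rightarrow> 'b" where
  "spow u i = (if i \<ge> 0 then u [^] nat i else star R u [^] nat (- i))"

lemma spow_closed [simp]: "u \<in> carrier R \<Longrightarrow> spow u i \<in> carrier R"
  by (simp add: spow_def)

lemma spow_zero [simp]: "spow u 0 = \<one>"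
  by (simp add: spow_def)

lemma spow_star: "u \<in> carrier R \<Longrightarrow> spow (star R u) i = spow u (- i)"
  by (auto simp: spow_def)

lemma spow_subalgebra: "star_subalgebra S R \<Longrightarrow> u \<in> S \<Longrightarrow> spow u i \<in> S"
  by (auto simp: spow_def intro!: star_subalgebra_pow dest: star_subalgebraD)

lemma spow_scalar_comm:
  assumes "scalar_comm \<mu> u v" "scalar_comm \<nu> (star R u) v"
  shows "\<exists>\<mu>'. scalar_comm \<mu>' (spow u i) v"
  using scalar_comm_pow_left[OF assms(1), of "nat i"] scalar_comm_pow_left[OF assms(2), of "nat (- i)"]
  by (auto simp: spow_def)

text \<open>A product \<open>u* u\<close> that appears at the end of a word is a polynomial in \<open>z\<close>, and it moves to the
  left through the remaining factors \<open>u*\<close>.\<close>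

lemma spow_mult:
  assumes z: "z \<in> carrier R" and u: "scalar_comm \<nu> (star R u) z" "u \<in> carrier R"
    and h: "poly_in z (star R u \<otimes> u) h"
  shows "\<exists>c g. poly_in z c g \<and> spow u i \<otimes> u = c \<otimes> spow u (i + 1)"
proof (cases "i \<ge> 0")
  case True
  then show ?thesis using u poly_in_one[of z]
    by (intro exI[of _ \<one>] exI[of _ "\<lambda>_. 1"]) (simp add: spow_def nat_add_distrib)
next
  case False
  then have "i = - int (Suc (nat (- i - 1)))" by simp
  then obtain n where n: "i = - int (Suc n)" by blast
  obtain c where c: "poly_in z c (\<lambda>t. h (\<nu> ^ n * t))"
    "star R u [^] n \<otimes> (star R u \<otimes> u) = c \<otimes> star R u [^] n"
    using poly_in_intertwine[OF scalar_comm_pow_left[OF u(1)] h] by blast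
  have e: "i + 1 = - int n" "nat (- i) = Suc n" using n by auto
  have "spow u i \<otimes> u = star R u [^] n \<otimes> (star R u \<otimes> u)"
    using False u by (simp add: spow_def e m_assoc)
  also have "\<dots> = c \<otimes> spow u (i + 1)" unfolding c(2) e(1) by (simp add: spow_def)
  finally show ?thesis using c(1) by blast
qed

lemma spow_mult_star:
  assumes z: "z \<in> carrier R" and u: "scalar_comm \<nu> u z" and h: "poly_in z (u \<otimes> star R u) h"
  shows "\<exists>c g. poly_in z c g \<and> spow u i \<otimes> star R u = c \<otimes> spow u (i - 1)"
  using spow_mult[OF z, of \<nu> "star R u" h "- i"] u h scalar_commD(1)[OF u] by (auto simp: spow_star)

lemma pow_mult_pow:
  assumes "scalar_comm \<mu> u v"
  shows "\<exists>\<nu>. u [^] (n::nat) \<otimes> v [^] n = \<nu> \<odot>\<^bsub>R\<^esub> ((u \<otimes> v) [^] n)"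
proof (induction n)
  case 0
  then show ?case by (intro exI[of _ 1]) simp
next
  case (Suc n)
  then obtain \<nu> where IH: "u [^] n \<otimes> v [^] n = \<nu> \<odot>\<^bsub>R\<^esub> ((u \<otimes> v) [^] n)" by blast
  note uv = scalar_commD[OF assms]
  note c = scalar_commD(3)[OF scalar_comm_pow_right[OF assms, of n]]
  have "u [^] Suc n \<otimes> v [^] Suc n = u [^] n \<otimes> (u \<otimes> v [^] n) \<otimes> v"
    using uv by (simp add: m_assoc)
  also have "\<dots> = \<mu> ^ n \<odot>\<^bsub>R\<^esub> (u [^] n \<otimes> v [^] n \<otimes> (u \<otimes> v))"
    unfolding c using uv(1,2) by (simp add: mult_smult smult_mult m_assoc)
  also have "\<dots> = (\<mu> ^ n * \<nu>) \<odot>\<^bsub>R\<^esub> ((u \<otimes> v) [^] Suc n)"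
    unfolding IH using uv(1,2) by (simp add: mult_smult smult_mult m_assoc smult_smult)
  finally show ?case by blast
qed

lemma scalar_comm_one_minus:
  assumes "scalar_comm 1 u v" shows "scalar_comm 1 (\<one> \<ominus> u) v"
  using scalar_commD[OF assms]
  by (simp add: scalar_comm_def a_minus_def l_distr r_distr l_minus r_minus)

end


section \<open>The quantum sphere\<close>

text \<open>The relations of the sphere for elements of an arbitrary star-algebra, with \<open>\<mu>\<close> in the place of
  the number \<open>exp (2 \<pi> i \<theta>)\<close>.\<close>

locale quantum_sphere = star_algebra R for R :: "'b star_alg" (structure) +
  fixes a b :: 'b and p q :: real and \<mu> :: complex and k l :: nat
  assumes ab: "scalar_comm \<mu> a b" and ab': "scalar_comm (cnj \<mu>) a (star R b)"
    and \<mu>: "\<mu> * cnj \<mu> = 1"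
    and pq: "p > 0" "q > 0"
    and osc_a: "star R a \<otimes> a = of_real p \<odot>\<^bsub>R\<^esub> (a \<otimes> star R a) \<oplus> of_real (1 - p) \<odot>\<^bsub>R\<^esub> \<one>"
    and osc_b: "star R b \<otimes> b = of_real q \<odot>\<^bsub>R\<^esub> (b \<otimes> star R b) \<oplus> of_real (1 - q) \<odot>\<^bsub>R\<^esub> \<one>"
    and AB: "(\<one> \<ominus> a \<otimes> star R a) \<otimes> (\<one> \<ominus> b \<otimes> star R b) = \<zero>"
begin

sublocale osc_a: q_oscillator R a p
  by unfold_locales (use osc_a pq scalar_commD[OF ab] in auto)

sublocale osc_b: q_oscillator R b q
  by unfold_locales (use osc_b pq scalar_commD[OF ab] in auto)

definition "x = a [^] l"
definition "y = b [^] k"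
definition "z = \<one> \<ominus> a \<otimes> star R a"
definition "w = \<one> \<ominus> b \<otimes> star R b"

lemma z_eq: "z = osc_a.A" and w_eq: "w = osc_b.A"
  by (simp_all add: z_def w_def osc_a.A_def osc_b.A_def)

lemma xyzw_closed [simp]: "x \<in> carrier R" "y \<in> carrier R" "z \<in> carrier R" "w \<in> carrier R"
  by (simp_all add: x_def y_def z_def w_def)

lemma star_z [simp]: "star R z = z" and star_w [simp]: "star R w = w"
  by (simp_all add: z_eq w_eq)

lemma zw: "z \<otimes> w = \<zero>"
  using AB by (simp add: z_def w_def)

lemma x_z: "scalar_comm (of_real (inverse p ^ l)) x z"
  and star_x_z: "scalar_comm (of_real (p ^ l)) (star R x) z"
  and y_w: "scalar_comm (of_real (inverse q ^ k)) y w"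
  and star_y_w: "scalar_comm (of_real (q ^ k)) (star R y) w"
  unfolding x_def y_def z_eq w_eq by (rule osc_a.pow_A osc_b.pow_A)+

lemma star_a_b: "scalar_comm (cnj \<mu>) (star R a) b"
  using scalar_comm_sym[OF scalar_comm_star[OF ab'], of "cnj \<mu>"] \<mu> by simp

lemma star_a_star_b: "scalar_comm \<mu> (star R a) (star R b)"
  using scalar_comm_sym[OF scalar_comm_star[OF ab], of \<mu>] \<mu> by (simp add: mult.commute)

lemma z_b: "scalar_comm 1 z b"
  using scalar_comm_one_minus[of "a \<otimes> star R a" b] scalar_comm_mult_left[OF ab star_a_b] \<mu>
  by (simp add: z_def)

lemma w_a: "scalar_comm 1 w a"
proof -
  have "scalar_comm 1 a (b \<otimes> star R b)" using scalar_comm_mult_right[OF ab ab'] \<mu> by simp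
  from scalar_comm_sym[OF this, of 1] show ?thesis
    using scalar_comm_one_minus[of "b \<otimes> star R b" a] by (simp add: w_def)
qed

lemma y_z: "scalar_comm 1 y z" and star_y_z: "scalar_comm 1 (star R y) z"
  and x_w: "scalar_comm 1 x w" and star_x_w: "scalar_comm 1 (star R x) w"
proof -
  show "scalar_comm 1 y z"
    using scalar_comm_pow_left[OF scalar_comm_sym[OF z_b, of 1], of k] by (simp add: y_def)
  show "scalar_comm 1 x w"
    using scalar_comm_pow_left[OF scalar_comm_sym[OF w_a, of 1], of l] by (simp add: x_def)
  show "scalar_comm 1 (star R y) z"
    using scalar_comm_star[OF scalar_comm_pow_right[OF z_b, of k]] by (simp add: y_def)
  show "scalar_comm 1 (star R x) w"
    using scalar_comm_star[OF scalar_comm_pow_right[OF w_a, of l]] by (simp add: x_def)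
qed

lemma scalar_comm_pow_pow:
  "scalar_comm m u v \<Longrightarrow> scalar_comm ((m ^ i) ^ j) (u [^] i) (v [^] j)"
  by (intro scalar_comm_pow_left scalar_comm_pow_right)

lemma scalar_comm_xy:
  shows "\<exists>m. scalar_comm m y x" "\<exists>m. scalar_comm m (star R y) x"
    "\<exists>m. scalar_comm m y (star R x)" "\<exists>m. scalar_comm m (star R y) (star R x)"
    "\<exists>m. scalar_comm m x (star R y)" "\<exists>m. scalar_comm m (star R x) y"
proof -
  have \<mu>': "cnj \<mu> * \<mu> = 1" using \<mu> by (simp add: mult.commute)
  note s = scalar_comm_sym[OF ab \<mu>] scalar_comm_sym[OF ab' \<mu>'] scalar_comm_sym[OF star_a_b \<mu>']
    scalar_comm_sym[OF star_a_star_b \<mu>] ab' star_a_b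
  note s[THEN scalar_comm_pow_pow]
  show "\<exists>m. scalar_comm m y x" using s(1)[THEN scalar_comm_pow_pow] by (auto simp: x_def y_def)
  show "\<exists>m. scalar_comm m (star R y) x" using s(2)[THEN scalar_comm_pow_pow] by (auto simp: x_def y_def star_pow)
  show "\<exists>m. scalar_comm m y (star R x)" using s(3)[THEN scalar_comm_pow_pow] by (auto simp: x_def y_def star_pow)
  show "\<exists>m. scalar_comm m (star R y) (star R x)" using s(4)[THEN scalar_comm_pow_pow] by (auto simp: x_def y_def star_pow)
  show "\<exists>m. scalar_comm m x (star R y)" using s(5)[THEN scalar_comm_pow_pow] by (auto simp: x_def y_def star_pow)
  show "\<exists>m. scalar_comm m (star R x) y" using s(6)[THEN scalar_comm_pow_pow] by (auto simp: x_def y_def star_pow)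
qed

text \<open>The polynomial with \<open>x x* = h(z)\<close> and \<open>x* x = h(p\<^sup>l z)\<close>. Its zeros \<open>1, p, \<dots>, p\<^sup>l\<^sup>-\<^sup>1\<close> are the
  eigenvalues of \<open>z\<close> on vectors that \<open>x*\<close> annihilates.\<close>

definition h :: "complex \<Rightarrow> complex" where
  "h t = (\<Prod>i<l. 1 - of_real (inverse p ^ i) * t)"

lemma h_zero [simp]: "h 0 = 1" by (simp add: h_def)

lemma h_shift: "h (of_real (p ^ l) * t) = (\<Prod>i=1..l. 1 - of_real (p ^ i) * t)"
proof -
  have "h (of_real (p ^ l) * t) = (\<Prod>i<l. 1 - of_real (p ^ (l - i)) * t)"
    unfolding h_def using pq by (intro prod.cong) (auto simp: power_diff field_simps)
  also have "\<dots> = (\<Prod>i=1..l. 1 - of_real (p ^ i) * t)"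
    by (rule prod.reindex_bij_witness[of _ "\<lambda>i. l - i" "\<lambda>i. l - i"]) auto
  finally show ?thesis .
qed

lemma x_star_x: "poly_in z (x \<otimes> star R x) h"
  using osc_a.pow_star_pow[of l] by (simp add: x_def z_eq h_def[abs_def])

lemma star_x_x: "poly_in z (star R x \<otimes> x) (\<lambda>t. h (of_real (p ^ l) * t))"
  using osc_a.star_pow_pow[of l] unfolding x_def z_eq h_shift .

lemma y_star_y: "poly_in w (y \<otimes> star R y) (\<lambda>t. \<Prod>i<k. 1 - of_real (inverse q ^ i) * t)"
  using osc_b.pow_star_pow[of k] by (simp add: y_def w_eq)

lemma star_y_y: "poly_in w (star R y \<otimes> y) (\<lambda>t. \<Prod>i=1..k. 1 - of_real (q ^ i) * t)"
  using osc_b.star_pow_pow[of k] by (simp add: y_def w_eq)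


subsection \<open>The two subalgebras and the homogeneous subspaces\<close>

definition "C = x \<otimes> star R y"

text \<open>The coordinate algebras of the base and of the total space of the circle bundle.\<close>

definition base :: "'b set" where
  "base = carrier (generated_star_subalgebra R {z, w, C})"

definition total :: "'b set" where
  "total = carrier (generated_star_subalgebra R {x, y, z, w})"

lemma base_subalgebra: "star_subalgebra base R"
  unfolding base_def by (rule generated_star_subalgebra) (auto simp: C_def)

lemma total_subalgebra: "star_subalgebra total R"
  unfolding total_def by (rule generated_star_subalgebra) auto

lemmas base_closed = star_subalgebraD[OF base_subalgebra]
lemmas total_closed = star_subalgebraD[OF total_subalgebra]

lemma zwC_base: "z \<in> base" "w \<in> base" "C \<in> base"
  unfolding base_def by (auto intro: generated_star_subalgebra_base)

lemma xyzw_total: "x \<in> total" "y \<in> total" "z \<in> total" "w \<in> total"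
  unfolding total_def by (auto intro: generated_star_subalgebra_base)

lemma base_carrier: "s \<in> base \<Longrightarrow> s \<in> carrier R" using base_closed(1) by blast

lemma base_subset_total: "base \<subseteq> total"
  unfolding base_def
  by (rule generated_star_subalgebra_least[OF total_subalgebra])
    (use xyzw_total total_closed in \<open>auto simp: C_def\<close>)

text \<open>Combinations of normally ordered monomials of degree \<open>n\<close> with coefficients in the base. This
  will turn out to be the space of sections of the line bundle of degree \<open>n\<close>.\<close>

inductive_set line_part :: "int \<Rightarrow> 'b set" for n where
  monomial: "s \<in> base \<Longrightarrow> i + j = n \<Longrightarrow> s \<otimes> spow x i \<otimes> spow y j \<in> line_part n"
| add: "c \<in> line_part n \<Longrightarrow> d \<in> line_part n \<Longrightarrow> c \<oplus> d \<in> line_part n"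

lemma line_part_carrier: "c \<in> line_part n \<Longrightarrow> c \<in> carrier R"
  by (induction rule: line_part.induct) (auto simp: base_carrier)

lemma line_part_subset_total: "c \<in> line_part n \<Longrightarrow> c \<in> total"
  by (induction rule: line_part.induct)
    (use base_subset_total total_closed spow_subalgebra[OF total_subalgebra] xyzw_total in auto)

lemma base_line_part_0: "s \<in> base \<Longrightarrow> s \<in> line_part 0"
  using line_part.monomial[of s 0 0 0] by (simp add: base_carrier)

text \<open>In degree zero the two signed powers have opposite exponents, and \<open>x\<^sup>i y*\<^sup>i\<close> is a scalar multiple
  of \<open>C\<^sup>i\<close>.\<close>

lemma line_part_0_base:
  assumes "c \<in> line_part 0" shows "c \<in> base"
  using assms
proof induction
  case (monomial s i j)
  then have j: "j = - i" by simp
  have "spow x i \<otimes> spow y j \<in> base"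
  proof (cases "i \<ge> 0")
    case True
    obtain m where "scalar_comm m x (star R y)" using scalar_comm_xy by blast
    from pow_mult_pow[OF this, of "nat i"] show ?thesis
      using True base_closed(2,8) star_subalgebra_pow[OF base_subalgebra zwC_base(3)]
      by (auto simp: spow_def j C_def)
  next
    case False
    obtain m where m: "scalar_comm m (star R x) y" using scalar_comm_xy by blast
    have "star R x \<otimes> y = m \<odot>\<^bsub>R\<^esub> star R C"
      using scalar_commD(3)[OF m] by (simp add: C_def star_mult)
    then have "star R x \<otimes> y \<in> base" using base_closed zwC_base by simp
    then show ?thesis
      using pow_mult_pow[OF m, of "nat (- i)"] False base_closed(2,8) star_subalgebra_pow[OF base_subalgebra]
      by (auto simp: spow_def j)
  qed
  then show ?case using monomial base_closed(7) by (simp add: m_assoc base_carrier)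
next
  case (add c d)
  then show ?case using base_closed(4) by simp
qed

text \<open>The generators shift the degree: the defining relations move every generator that is
  multiplied from the right to its place in the monomial, at the cost of a factor in the base.\<close>

lemma line_part_mult:
  assumes "c \<in> line_part n"
  shows "c \<otimes> x \<in> line_part (n + 1)" "c \<otimes> star R x \<in> line_part (n - 1)"
    "c \<otimes> y \<in> line_part (n + 1)" "c \<otimes> star R y \<in> line_part (n - 1)"
    "c \<otimes> z \<in> line_part n" "c \<otimes> w \<in> line_part n"
proof -
  have right_x: "s \<otimes> spow x i \<otimes> spow y j \<otimes> u \<in> line_part (i' + j)"
    if s: "s \<in> base" and u: "u \<in> carrier R" and c: "scalar_comm m1 y u" "scalar_comm m2 (star R y) u"
      and e: "poly_in z e g" "spow x i \<otimes> u = e \<otimes> spow x i'" for s i j u i' m1 m2 e g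
  proof -
    obtain m where m: "scalar_comm m (spow y j) u" using spow_scalar_comm[OF c] by blast
    have eb: "e \<in> base" using poly_in_subalgebra[OF base_subalgebra zwC_base(1) e(1)] .
    note cl = s[THEN base_carrier] u eb[THEN base_carrier]
    have "s \<otimes> spow x i \<otimes> spow y j \<otimes> u = m \<odot>\<^bsub>R\<^esub> (s \<otimes> (spow x i \<otimes> u) \<otimes> spow y j)"
      using cl by (simp add: m_assoc scalar_commD(3)[OF m] mult_smult)
    also have "\<dots> = (m \<odot>\<^bsub>R\<^esub> (s \<otimes> e)) \<otimes> spow x i' \<otimes> spow y j"
      unfolding e(2) using cl by (simp add: m_assoc smult_mult)
    also have "\<dots> \<in> line_part (i' + j)"
      by (rule line_part.monomial) (use s eb base_closed in auto)
    finally show ?thesis .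
  qed
  have right_y: "s \<otimes> spow x i \<otimes> spow y j \<otimes> u \<in> line_part (i + j')"
    if s: "s \<in> base" and u: "u \<in> carrier R"
      and e: "poly_in w e g" "spow y j \<otimes> u = e \<otimes> spow y j'" for s i j u j' e g
  proof -
    have eb: "e \<in> base" using poly_in_subalgebra[OF base_subalgebra zwC_base(2) e(1)] .
    note cl = s[THEN base_carrier] u eb[THEN base_carrier]
    have "scalar_comm 1 (spow x i) w"
      using scalar_comm_pow_left[OF x_w, of "nat i"] scalar_comm_pow_left[OF star_x_w, of "nat (-i)"]
      by (auto simp: spow_def)
    from scalar_commD[OF this] have xe: "spow x i \<otimes> e = e \<otimes> spow x i"
      by (intro poly_in_commute[OF _ _ _ e(1)]) auto
    have "s \<otimes> spow x i \<otimes> spow y j \<otimes> u = s \<otimes> (spow x i \<otimes> e) \<otimes> spow y j'"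
      using cl by (simp add: m_assoc e(2))
    also have "\<dots> = (s \<otimes> e) \<otimes> spow x i \<otimes> spow y j'"
      unfolding xe using cl by (simp add: m_assoc)
    also have "\<dots> \<in> line_part (i + j')"
      by (rule line_part.monomial) (use s eb base_closed in auto)
    finally show ?thesis .
  qed
  have right_z: "s \<otimes> spow x i \<otimes> spow y j \<otimes> u \<in> line_part (i + j)"
    if s: "s \<in> base" and u: "u \<in> base" and c: "scalar_comm m1 x u" "scalar_comm m2 (star R x) u"
      "scalar_comm m3 y u" "scalar_comm m4 (star R y) u" for s i j u m1 m2 m3 m4
  proof -
    obtain m m' where m: "scalar_comm m (spow x i) u" "scalar_comm m' (spow y j) u"
      using spow_scalar_comm[OF c(1,2)] spow_scalar_comm[OF c(3,4)] by blast
    note cl = s[THEN base_carrier] u[THEN base_carrier]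
    have "scalar_comm (m * m') (spow x i \<otimes> spow y j) u" by (rule scalar_comm_mult_left[OF m])
    from scalar_commD(3)[OF this]
    have "s \<otimes> spow x i \<otimes> spow y j \<otimes> u = ((m * m') \<odot>\<^bsub>R\<^esub> (s \<otimes> u)) \<otimes> spow x i \<otimes> spow y j"
      using cl by (simp add: m_assoc smult_mult mult_smult)
    also have "\<dots> \<in> line_part (i + j)" by (rule line_part.monomial) (use s u base_closed in auto)
    finally show ?thesis .
  qed
  have *: "c \<otimes> u \<in> line_part (n + d)"
    if u: "u \<in> carrier R" and m: "\<And>s i j. s \<in> base \<Longrightarrow> s \<otimes> spow x i \<otimes> spow y j \<otimes> u \<in> line_part (i + j + d)"
    for u d
    using assms
  proof induction
    case (monomial s i j)
    then show ?case using m[of s i j] by simp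
  next
    case (add c d)
    then show ?case using u by (simp add: l_distr line_part_carrier line_part.add)
  qed
  show "c \<otimes> x \<in> line_part (n + 1)"
  proof (rule *)
    fix s i j assume s: "s \<in> base"
    obtain m1 m2 where m: "scalar_comm m1 y x" "scalar_comm m2 (star R y) x" using scalar_comm_xy by blast
    obtain e g where "poly_in z e g" "spow x i \<otimes> x = e \<otimes> spow x (i + 1)"
      using spow_mult[OF xyzw_closed(3) star_x_z xyzw_closed(1) star_x_x, of i] by blast
    from right_x[OF s _ m this, of j] show "s \<otimes> spow x i \<otimes> spow y j \<otimes> x \<in> line_part (i + j + 1)"
      by (simp add: ac_simps)
  qed simp
  show "c \<otimes> y \<in> line_part (n + 1)"
  proof (rule *)
    fix s i j assume s: "s \<in> base"
    obtain e g where "poly_in w e g" "spow y j \<otimes> y = e \<otimes> spow y (j + 1)"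
      using spow_mult[OF xyzw_closed(4) star_y_w xyzw_closed(2) star_y_y, of j] by blast
    from right_y[OF s _ this, of i] show "s \<otimes> spow x i \<otimes> spow y j \<otimes> y \<in> line_part (i + j + 1)"
      by (simp add: ac_simps)
  qed simp
  have "c \<otimes> star R x \<in> line_part (n + (- 1))"
  proof (rule *)
    fix s i j assume s: "s \<in> base"
    obtain m1 m2 where m: "scalar_comm m1 y (star R x)" "scalar_comm m2 (star R y) (star R x)"
      using scalar_comm_xy by blast
    obtain e g where "poly_in z e g" "spow x i \<otimes> star R x = e \<otimes> spow x (i - 1)"
      using spow_mult_star[OF xyzw_closed(3) x_z x_star_x, of i] by blast
    from right_x[OF s _ m this, of j] show "s \<otimes> spow x i \<otimes> spow y j \<otimes> star R x \<in> line_part (i + j + (- 1))"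
      by (simp add: algebra_simps)
  qed simp
  then show "c \<otimes> star R x \<in> line_part (n - 1)" by simp
  have "c \<otimes> star R y \<in> line_part (n + (- 1))"
  proof (rule *)
    fix s i j assume s: "s \<in> base"
    obtain e g where "poly_in w e g" "spow y j \<otimes> star R y = e \<otimes> spow y (j - 1)"
      using spow_mult_star[OF xyzw_closed(4) y_w y_star_y, of j] by blast
    from right_y[OF s _ this, of i] show "s \<otimes> spow x i \<otimes> spow y j \<otimes> star R y \<in> line_part (i + j + (- 1))"
      by (simp add: algebra_simps)
  qed simp
  then show "c \<otimes> star R y \<in> line_part (n - 1)" by simp
  have "c \<otimes> z \<in> line_part (n + 0)"
    by (rule *) (use right_z[OF _ zwC_base(1) x_z star_x_z y_z star_y_z] in simp_all)
  moreover have "c \<otimes> w \<in> line_part (n + 0)"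
    by (rule *) (use right_z[OF _ zwC_base(2) x_w star_x_w y_w star_y_w] in simp_all)
  ultimately show "c \<otimes> z \<in> line_part n" "c \<otimes> w \<in> line_part n" by simp_all
qed

inductive_set line_part_sums :: "'b set" where
  line_part: "c \<in> line_part n \<Longrightarrow> c \<in> line_part_sums"
| add: "c \<in> line_part_sums \<Longrightarrow> d \<in> line_part_sums \<Longrightarrow> c \<oplus> d \<in> line_part_sums"

lemma line_part_sums_carrier: "c \<in> line_part_sums \<Longrightarrow> c \<in> carrier R"
  by (induction rule: line_part_sums.induct) (auto simp: line_part_carrier)

lemma base_mult_line_part:
  assumes "c \<in> line_part n" "s \<in> base" shows "s \<otimes> c \<in> line_part n"
  using assms(1)
proof induction
  case (monomial s' i j)
  then show ?case using line_part.monomial[of "s \<otimes> s'" i j n] base_closed(7) assms(2)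
    by (simp add: m_assoc base_carrier)
next
  case (add c d)
  then show ?case using assms(2) by (simp add: r_distr base_carrier line_part_carrier line_part.add)
qed

lemma smult_line_part: "c \<in> line_part n \<Longrightarrow> e \<odot>\<^bsub>R\<^esub> c \<in> line_part n"
  using base_mult_line_part[of c n "e \<odot>\<^bsub>R\<^esub> \<one>"] base_closed by (simp add: smult_mult line_part_carrier)

text \<open>The elements that, like their adjoints, preserve the right-hand side under multiplication from the
  right form a star-subalgebra, and it contains the generators. Applied to \<open>1\<close>, this shows the
  nontrivial inclusion.\<close>

lemma total_eq_line_part_sums: "total = line_part_sums"
proof
  define S where "S = {u \<in> carrier R. \<forall>c\<in>line_part_sums. c \<otimes> u \<in> line_part_sums \<and> c \<otimes> star R u \<in> line_part_sums}"
  have sm: "e \<odot>\<^bsub>R\<^esub> c \<in> line_part_sums" if "c \<in> line_part_sums" for e c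
    using that
  proof induction
    case (add c d)
    then show ?case by (simp add: smult_add line_part_sums_carrier line_part_sums.add)
  qed (auto intro: line_part_sums.line_part smult_line_part)
  have "star_subalgebra S R"
  proof (rule star_subalgebraI)
    fix u v assume "u \<in> S" "v \<in> S"
    then show "u \<oplus> v \<in> S" by (auto simp: S_def star_add r_distr line_part_sums_carrier intro: line_part_sums.add)
    have "c \<otimes> (u \<otimes> v) \<in> line_part_sums \<and> c \<otimes> (star R v \<otimes> star R u) \<in> line_part_sums"
      if "c \<in> line_part_sums" for c
      using that \<open>u \<in> S\<close> \<open>v \<in> S\<close> by (simp add: S_def line_part_sums_carrier flip: m_assoc)
    then show "u \<otimes> v \<in> S" using \<open>u \<in> S\<close> \<open>v \<in> S\<close> by (auto simp: S_def star_mult)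
  qed (auto simp: S_def mult_smult sm star_smult line_part_sums_carrier)
  moreover have "u \<in> S" if u: "u \<in> carrier R" "\<And>n c. c \<in> line_part n \<Longrightarrow> c \<otimes> u \<in> line_part_sums \<and> c \<otimes> star R u \<in> line_part_sums" for u
  proof -
    have "c \<otimes> u \<in> line_part_sums \<and> c \<otimes> star R u \<in> line_part_sums" if "c \<in> line_part_sums" for c
      using that
    proof induction
      case (add c d)
      then show ?case using u(1) by (simp add: l_distr line_part_sums_carrier line_part_sums.add)
    qed (use u(2) in blast)
    then show ?thesis using u by (simp add: S_def)
  qed
  then have "{x, y, z, w} \<subseteq> S"
    using line_part_mult[THEN line_part_sums.line_part] by simp
  ultimately have "total \<subseteq> S" unfolding total_def by (rule generated_star_subalgebra_least)
  moreover have "\<one> \<in> line_part_sums" using base_line_part_0[OF base_closed(2)] by (rule line_part_sums.line_part)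
  ultimately show "total \<subseteq> line_part_sums" using total_closed(1) by (force simp: S_def)
  show "line_part_sums \<subseteq> total"
  proof
    fix c assume "c \<in> line_part_sums"
    then show "c \<in> total" by induction (auto simp: line_part_subset_total total_closed)
  qed
qed

end


section \<open>The strong connection\<close>

context abelian_monoid
begin

text \<open>The connection is a list of elementary tensors in which repetitions count, so sums over it follow
  the list.\<close>

definition list_sum :: "('c \<Rightarrow> 'a) \<Rightarrow> 'c list \<Rightarrow> 'a" where
  "list_sum F L = foldr (\<lambda>e s. F e \<oplus> s) L \<zero>"

lemma list_sum_Nil [simp]: "list_sum F [] = \<zero>"
  and list_sum_Cons [simp]: "list_sum F (e # L) = F e \<oplus> list_sum F L"
  by (simp_all add: list_sum_def)

lemma list_sum_closed [simp]: "(\<And>e. e \<in> set L \<Longrightarrow> F e \<in> carrier G) \<Longrightarrow> list_sum F L \<in> carrier G"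
  by (induction L) auto

lemma list_sum_append:
  "(\<And>e. e \<in> set L \<union> set L' \<Longrightarrow> F e \<in> carrier G) \<Longrightarrow> list_sum F (L @ L') = list_sum F L \<oplus> list_sum F L'"
  by (induction L) (auto simp: a_assoc)

lemma list_sum_map: "list_sum F (map h L) = list_sum (\<lambda>e. F (h e)) L"
  by (induction L) auto

lemma list_sum_cong: "(\<And>e. e \<in> set L \<Longrightarrow> F e = H e) \<Longrightarrow> list_sum F L = list_sum H L"
  by (induction L) auto

lemma list_sum_add:
  "(\<And>e. e \<in> set L \<Longrightarrow> F e \<in> carrier G \<and> H e \<in> carrier G) \<Longrightarrow>
    list_sum F L \<oplus> list_sum H L = list_sum (\<lambda>e. F e \<oplus> H e) L"
  by (induction L) (auto simp: a_ac)

lemma finsum_list_sum: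
  "(\<And>e. e \<in> set L \<Longrightarrow> F e \<in> carrier G) \<Longrightarrow> (\<Oplus>i\<in>{..<length L}. F (L ! i)) = list_sum F L"
proof (induction L rule: rev_induct)
  case (snoc e L)
  have "(\<Oplus>i\<in>{..<length (L @ [e])}. F ((L @ [e]) ! i))
      = F e \<oplus> (\<Oplus>i\<in>{..<length L}. F ((L @ [e]) ! i))"
    using snoc.prems by (simp add: lessThan_Suc finsum_insert nth_append Pi_def)
  also have "(\<Oplus>i\<in>{..<length L}. F ((L @ [e]) ! i)) = (\<Oplus>i\<in>{..<length L}. F (L ! i))"
    using snoc.prems by (intro finsum_cong') (auto simp: nth_append)
  also have "\<dots> = list_sum F L" using snoc by simp
  finally show ?case using snoc.prems by (subst list_sum_append) (auto simp: a_comm)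
qed simp

end

context star_algebra
begin

lemma list_sum_mult:
  "u \<in> carrier R \<Longrightarrow> v \<in> carrier R \<Longrightarrow> (\<And>e. e \<in> set L \<Longrightarrow> F e \<in> carrier R) \<Longrightarrow>
    u \<otimes> list_sum F L \<otimes> v = list_sum (\<lambda>e. u \<otimes> F e \<otimes> v) L"
  by (induction L) (simp_all add: l_distr r_distr)

text \<open>The common form of the two recursions for \<open>\<omega>(u\<^sup>n)\<close>: each step multiplies the first legs from the
  left and the second legs from the right, in two ways.\<close>

primrec connection :: "'b \<Rightarrow> 'b \<Rightarrow> 'b \<Rightarrow> 'b \<Rightarrow> nat \<Rightarrow> ('b \<times> 'b) list" where
  "connection u u' v v' 0 = [(\<one>, \<one>)]"
| "connection u u' v v' (Suc n) =
     map (\<lambda>(c, d). (u \<otimes> c, d \<otimes> u')) (connection u u' v v' n) @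
     map (\<lambda>(c, d). (v \<otimes> c, d \<otimes> v')) (connection u u' v v' n)"

context
  fixes u u' v v'
  assumes uv [simp]: "u \<in> carrier R" "u' \<in> carrier R" "v \<in> carrier R" "v' \<in> carrier R"
begin

lemma connection_closed:
  "(c, d) \<in> set (connection u u' v v' n) \<Longrightarrow> c \<in> carrier R \<and> d \<in> carrier R"
  by (induction n arbitrary: c d) auto

text \<open>When the legs are multiplied in their order, the new factors stand outside, around the value of
  the previous step.\<close>

lemma connection_counit:
  assumes "u \<otimes> u' \<oplus> v \<otimes> v' = \<one>"
  shows "list_sum (\<lambda>(c, d). c \<otimes> d) (connection u u' v v' n) = \<one>"
proof (induction n)
  case (Suc n)
  let ?L = "connection u u' v v' n"
  note cl = connection_closed[of _ _ n]
  have *: "list_sum (\<lambda>(c, d). c \<otimes> d) (map (\<lambda>(c, d). (r \<otimes> c, d \<otimes> r')) ?L) = r \<otimes> r'"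
    if "r \<in> carrier R" "r' \<in> carrier R" for r r'
  proof -
    have "list_sum (\<lambda>(c, d). c \<otimes> d) (map (\<lambda>(c, d). (r \<otimes> c, d \<otimes> r')) ?L)
        = list_sum (\<lambda>e. r \<otimes> (\<lambda>(c, d). c \<otimes> d) e \<otimes> r') ?L"
      unfolding list_sum_map using that cl by (intro list_sum_cong) (auto simp: m_assoc)
    also have "\<dots> = r \<otimes> list_sum (\<lambda>(c, d). c \<otimes> d) ?L \<otimes> r'"
      using that cl by (intro list_sum_mult[symmetric]) auto
    finally show ?thesis using that Suc.IH by simp
  qed
  have "list_sum (\<lambda>(c, d). c \<otimes> d) (connection u u' v v' (Suc n)) = u \<otimes> u' \<oplus> v \<otimes> v'"
    unfolding connection.simps using cl by (subst list_sum_append) (auto simp: *)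
  then show ?case using assms by simp
qed simp

text \<open>When the legs are multiplied in the opposite order, the new factors meet in the middle. So they
  act on the element \<open>e\<close> first, and the remaining steps see only the result.\<close>

lemma connection_trace_Suc:
  assumes e: "e \<in> carrier R"
  shows "list_sum (\<lambda>(c, d). d \<otimes> e \<otimes> c) (connection u u' v v' (Suc n)) =
    list_sum (\<lambda>(c, d). d \<otimes> (u' \<otimes> e \<otimes> u \<oplus> v' \<otimes> e \<otimes> v) \<otimes> c) (connection u u' v v' n)"
proof -
  let ?L = "connection u u' v v' n"
  note cl = connection_closed[of _ _ n]
  have "list_sum (\<lambda>(c, d). d \<otimes> e \<otimes> c) (connection u u' v v' (Suc n)) =
      list_sum (\<lambda>(c, d). (d \<otimes> u') \<otimes> e \<otimes> (u \<otimes> c)) ?L \<oplus> list_sum (\<lambda>(c, d). (d \<otimes> v') \<otimes> e \<otimes> (v \<otimes> c)) ?L"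
    unfolding connection.simps using cl e
    by (subst list_sum_append) (auto simp: list_sum_map split_def)
  also have "\<dots> = list_sum (\<lambda>e'. (\<lambda>(c, d). (d \<otimes> u') \<otimes> e \<otimes> (u \<otimes> c)) e' \<oplus> (\<lambda>(c, d). (d \<otimes> v') \<otimes> e \<otimes> (v \<otimes> c)) e') ?L"
    using cl e by (intro list_sum_add) auto
  also have "\<dots> = list_sum (\<lambda>(c, d). d \<otimes> (u' \<otimes> e \<otimes> u \<oplus> v' \<otimes> e \<otimes> v) \<otimes> c) ?L"
    using cl e by (intro list_sum_cong) (auto simp: l_distr r_distr m_assoc)
  finally show ?thesis .
qed

lemma connection_trace:
  assumes z: "z \<in> carrier R"
    and step: "\<And>e g. poly_in z e g \<Longrightarrow> poly_in z (u' \<otimes> e \<otimes> u \<oplus> v' \<otimes> e \<otimes> v) (\<Phi> g)"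
    and "poly_in z e g"
  shows "poly_in z (list_sum (\<lambda>(c, d). d \<otimes> e \<otimes> c) (connection u u' v v' n)) ((\<Phi> ^^ n) g)"
  using assms(3)
proof (induction n arbitrary: e g)
  case 0
  then show ?case using poly_in_closed[OF z] by simp
next
  case (Suc n)
  show ?case
    using Suc.IH[OF step[OF Suc.prems]] connection_trace_Suc[OF poly_in_closed[OF z Suc.prems]]
    by (simp add: funpow_swap1)
qed

end

lemma poly_in_poly_f:
  assumes z: "z \<in> carrier R" and z': "poly_in z z' (\<lambda>t. m * t)"
  shows "poly_in z (poly_f R p l z') (\<lambda>t. 1 - (\<Prod>i=1..l. 1 - of_real (p ^ i) * (m * t)))"
proof -
  have "poly_in z (foldr (mult R) (map (\<lambda>i. \<one> \<ominus> (complex_of_real (p ^ i) \<odot>\<^bsub>R\<^esub> z')) is) \<one>)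
      (\<lambda>t. \<Prod>i\<leftarrow>is. 1 - of_real (p ^ i) * (m * t))" for "is"
    by (induction "is") (auto intro!: poly_in_one poly_in.mult poly_in_diff[OF z] poly_in_smult[OF z] z'
        simp del: of_real_power)
  from poly_in_diff[OF z poly_in_one this[of "[1..<Suc l]"]] show ?thesis
    by (simp add: poly_f_def prod.distinct_set_conv_list[symmetric] atLeastLessThanSuc_atLeastAtMost del: upt_Suc)
qed

end

context quantum_sphere
begin

definition "f = poly_f R p l z"
definition "f' = poly_f R p l (of_real (inverse p ^ l) \<odot>\<^bsub>R\<^esub> z)"

text \<open>Thus \<open>f = 1 - x* x\<close> and \<open>f' = 1 - x x*\<close>, written as polynomials in \<open>z\<close>.\<close>

lemma poly_f: "poly_in z f (\<lambda>t. 1 - h (of_real (p ^ l) * t))"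
  using poly_in_poly_f[of z z 1 p l] poly_in.var[of z] unfolding f_def h_shift by simp

lemma poly_f': "poly_in z f' (\<lambda>t. 1 - h t)"
proof -
  have "poly_in z f' (\<lambda>t. 1 - h (of_real (p ^ l) * (of_real (inverse p ^ l) * t)))"
    using poly_in_poly_f[of z _ "of_real (inverse p ^ l)" p l] poly_in_smult[OF _ poly_in.var]
    unfolding f'_def h_shift by simp
  also have "(\<lambda>t. 1 - h (of_real (p ^ l) * (of_real (inverse p ^ l) * t))) = (\<lambda>t. 1 - h t)"
    using pq by (simp add: field_simps)
  finally show ?thesis .
qed

lemma f_closed [simp]: "f \<in> carrier R" "f' \<in> carrier R"
  using poly_in_closed[OF xyzw_closed(3)] poly_f poly_f' by blast+

text \<open>Since \<open>z w = 0\<close>, next to a polynomial in \<open>z\<close> without constant term only the constant term of a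
  polynomial in \<open>w\<close> survives.\<close>

lemma absorb:
  assumes "poly_in z c g" "g 0 = 0" "poly_in w d g'"
  shows "c \<otimes> d = g' 0 \<odot>\<^bsub>R\<^esub> c"
proof -
  obtain c' where c': "c' \<in> carrier R" "c = c' \<otimes> z"
    using poly_in_split[OF _ assms(1)] assms(2) by auto
  obtain d' where d': "d' \<in> carrier R" "d = g' 0 \<odot>\<^bsub>R\<^esub> \<one> \<oplus> w \<otimes> d'"
    using poly_in_split[OF _ assms(3)] by auto
  have "c' \<otimes> z \<otimes> (w \<otimes> d') = c' \<otimes> (z \<otimes> w) \<otimes> d'" using c'(1) d'(1) by (simp add: m_assoc)
  then have "c' \<otimes> z \<otimes> (w \<otimes> d') = \<zero>" using c'(1) d'(1) by (simp add: zw)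
  then show ?thesis using c' d' by (simp add: r_distr mult_smult)
qed

lemma poly_z_y:
  assumes "poly_in z c g"
  shows "y \<otimes> c = c \<otimes> y" "star R y \<otimes> c = c \<otimes> star R y"
  using assms scalar_commD[OF y_z] scalar_commD[OF star_y_z] by (auto intro!: poly_in_commute[of _ z])

lemma connection_pos_counit: "star R x \<otimes> x \<oplus> (f \<otimes> star R y) \<otimes> y = \<one>"
  and connection_neg_counit: "x \<otimes> star R x \<oplus> (f' \<otimes> y) \<otimes> star R y = \<one>"
proof -
  have 1: "(f \<otimes> star R y) \<otimes> y = f" using absorb[OF poly_f _ star_y_y] by (simp add: m_assoc)
  have 2: "(f' \<otimes> y) \<otimes> star R y = f'" using absorb[OF poly_f' _ y_star_y] by (simp add: m_assoc)
  have "f = \<one> \<ominus> star R x \<otimes> x"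
    by (rule poly_in_unique[OF _ poly_f poly_in_diff[OF _ poly_in_one star_x_x]]) simp_all
  then show "star R x \<otimes> x \<oplus> (f \<otimes> star R y) \<otimes> y = \<one>"
    unfolding 1 by (simp add: a_minus_def a_lcomm r_neg)
  have "f' = \<one> \<ominus> x \<otimes> star R x"
    by (rule poly_in_unique[OF _ poly_f' poly_in_diff[OF _ poly_in_one x_star_x]]) simp_all
  then show "x \<otimes> star R x \<oplus> (f' \<otimes> y) \<otimes> star R y = \<one>"
    unfolding 2 by (simp add: a_minus_def a_lcomm r_neg)
qed

text \<open>The effect of one step on an element \<open>g(z)\<close> in the middle, for positive and for negative degree: in the
  \<open>x\<close>-term the argument is rescaled, and in the \<open>y\<close>-term the factor \<open>y y*\<close> or \<open>y* y\<close> is absorbed.\<close>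

definition "\<Phi> g t = g (of_real (inverse p ^ l) * t) * h t + g t * (1 - h (of_real (p ^ l) * t))"
definition "\<Phi>' g t = g (of_real (p ^ l) * t) * h (of_real (p ^ l) * t) + g t * (1 - h t)"

lemma connection_pos_step:
  assumes e: "poly_in z e g"
  shows "poly_in z (x \<otimes> e \<otimes> star R x \<oplus> y \<otimes> e \<otimes> (f \<otimes> star R y)) (\<Phi> g)"
proof -
  have cl [simp]: "e \<in> carrier R" using poly_in_closed[OF _ e] by simp
  obtain c where c: "poly_in z c (\<lambda>t. g (of_real (inverse p ^ l) * t))" "x \<otimes> e = c \<otimes> x"
    using poly_in_intertwine[OF x_z e] by blast
  have [simp]: "c \<in> carrier R" using poly_in_closed[OF _ c(1)] by simp
  have ef: "poly_in z (e \<otimes> f) (\<lambda>t. g t * (1 - h (of_real (p ^ l) * t)))" by (rule poly_in.mult[OF e poly_f])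
  have "y \<otimes> e \<otimes> (f \<otimes> star R y) = e \<otimes> f \<otimes> (y \<otimes> star R y)"
    using poly_z_y(1)[OF ef] by (simp add: m_assoc[symmetric])
  then have "y \<otimes> e \<otimes> (f \<otimes> star R y) = e \<otimes> f"
    using absorb[OF ef _ y_star_y] by simp
  moreover have "x \<otimes> e \<otimes> star R x = c \<otimes> (x \<otimes> star R x)" by (simp add: c(2) m_assoc)
  ultimately show ?thesis
    using poly_in.add[OF poly_in.mult[OF c(1) x_star_x] ef] by (simp add: \<Phi>_def[abs_def])
qed

lemma connection_neg_step:
  assumes e: "poly_in z e g"
  shows "poly_in z (star R x \<otimes> e \<otimes> x \<oplus> star R y \<otimes> e \<otimes> (f' \<otimes> y)) (\<Phi>' g)"
proof -
  have cl [simp]: "e \<in> carrier R" using poly_in_closed[OF _ e] by simp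
  obtain c where c: "poly_in z c (\<lambda>t. g (of_real (p ^ l) * t))" "star R x \<otimes> e = c \<otimes> star R x"
    using poly_in_intertwine[OF star_x_z e] by blast
  have [simp]: "c \<in> carrier R" using poly_in_closed[OF _ c(1)] by simp
  have ef: "poly_in z (e \<otimes> f') (\<lambda>t. g t * (1 - h t))" by (rule poly_in.mult[OF e poly_f'])
  have "star R y \<otimes> e \<otimes> (f' \<otimes> y) = e \<otimes> f' \<otimes> (star R y \<otimes> y)"
    using poly_z_y(2)[OF ef] by (simp add: m_assoc[symmetric])
  then have "star R y \<otimes> e \<otimes> (f' \<otimes> y) = e \<otimes> f'"
    using absorb[OF ef _ star_y_y] by simp
  moreover have "star R x \<otimes> e \<otimes> x = c \<otimes> (star R x \<otimes> x)" by (simp add: c(2) m_assoc)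
  ultimately show ?thesis
    using poly_in.add[OF poly_in.mult[OF c(1) star_x_x] ef] by (simp add: \<Phi>'_def[abs_def])
qed

end


section \<open>Gradings and the coaction\<close>

context star_algebra
begin

lemma finsum_subalgebra:
  assumes S: "star_subalgebra S R" and f: "f \<in> F \<rightarrow> S"
  shows "finsum (R\<lparr>carrier := S\<rparr>) f F = finsum R f F"
proof (cases "finite F")
  case True
  interpret S: star_algebra "R\<lparr>carrier := S\<rparr>" by (rule star_algebra_subalgebra[OF S])
  show ?thesis using True f
  proof (induction F rule: finite_induct)
    case (insert i F)
    then show ?case using star_subalgebraD(1)[OF S]
      by (subst finsum_insert, simp, simp, force, force, subst S.finsum_insert) (auto simp: Pi_def)
  qed simp
next
  case False
  then show ?thesis using S by (simp add: finsum_def finprod_def)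
qed

lemma finsum_swap:
  assumes "finite I" "finite J" "\<And>i j. i \<in> I \<Longrightarrow> j \<in> J \<Longrightarrow> f i j \<in> carrier R"
  shows "(\<Oplus>i\<in>I. \<Oplus>j\<in>J. f i j) = (\<Oplus>j\<in>J. \<Oplus>i\<in>I. f i j)"
  using assms(1,3)
proof (induction I rule: finite_induct)
  case empty
  then show ?case by (simp add: finsum_zero)
next
  case (insert i I)
  have "(\<Oplus>i\<in>insert i I. \<Oplus>j\<in>J. f i j) = (\<Oplus>j\<in>J. f i j) \<oplus> (\<Oplus>j\<in>J. \<Oplus>i\<in>I. f i j)"
    using insert by (subst finsum_insert) (auto intro!: finsum_closed)
  also have "\<dots> = (\<Oplus>j\<in>J. f i j \<oplus> (\<Oplus>i\<in>I. f i j))"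
    using insert by (intro finsum_addf[symmetric]) (auto intro!: finsum_closed)
  also have "\<dots> = (\<Oplus>j\<in>J. \<Oplus>i\<in>insert i I. f i j)"
    using insert by (intro finsum_cong') (auto intro!: finsum_closed simp: finsum_insert Pi_def)
  finally show ?case .
qed

end

text \<open>A grading by the integers in terms of the projections \<open>P d\<close> to the homogeneous components.\<close>

locale graded_star_algebra = star_algebra R for R :: "'b star_alg" (structure) +
  fixes P :: "int \<Rightarrow> 'b \<Rightarrow> 'b"
  assumes P_closed [simp]: "c \<in> carrier R \<Longrightarrow> P d c \<in> carrier R"
    and P_add: "c \<in> carrier R \<Longrightarrow> c' \<in> carrier R \<Longrightarrow> P d (c \<oplus> c') = P d c \<oplus> P d c'"
    and P_smult: "c \<in> carrier R \<Longrightarrow> P d (r \<odot>\<^bsub>R\<^esub> c) = r \<odot>\<^bsub>R\<^esub> P d c"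
    and P_P: "c \<in> carrier R \<Longrightarrow> P d (P e c) = (if d = e then P d c else \<zero>)"
    and P_mult: "c \<in> carrier R \<Longrightarrow> c' \<in> carrier R \<Longrightarrow> P d (P e c \<otimes> c') = P e c \<otimes> P (d - e) c'"
    and P_star: "c \<in> carrier R \<Longrightarrow> P d (star R c) = star R (P (- d) c)"
    and P_one: "P 0 \<one> = \<one>"
begin

definition homogeneous :: "int \<Rightarrow> 'b set" where
  "homogeneous d = {c \<in> carrier R. P d c = c}"

lemma homogeneous_carrier: "c \<in> homogeneous d \<Longrightarrow> c \<in> carrier R"
  by (simp add: homogeneous_def)

lemma P_zero [simp]: "P d \<zero> = \<zero>"
  using P_smult[of \<zero> d 0] by simp

lemma P_homogeneous: "c \<in> homogeneous d \<Longrightarrow> P e c = (if d = e then c else \<zero>)"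
  using P_P[of c e d] by (auto simp: homogeneous_def)

lemma homogeneous_add: "c \<in> homogeneous d \<Longrightarrow> c' \<in> homogeneous d \<Longrightarrow> c \<oplus> c' \<in> homogeneous d"
  by (simp add: homogeneous_def P_add)

lemma homogeneous_smult: "c \<in> homogeneous d \<Longrightarrow> r \<odot>\<^bsub>R\<^esub> c \<in> homogeneous d"
  by (simp add: homogeneous_def P_smult)

lemma homogeneous_one: "\<one> \<in> homogeneous 0"
  by (simp add: homogeneous_def P_one)

lemma homogeneous_minus: "c \<in> homogeneous d \<Longrightarrow> c' \<in> homogeneous d \<Longrightarrow> c \<ominus> c' \<in> homogeneous d"
  by (simp add: a_minus_def minus_eq_smult homogeneous_carrier homogeneous_add homogeneous_smult)

lemma homogeneous_mult:
  assumes "c \<in> homogeneous d" "c' \<in> homogeneous e" shows "c \<otimes> c' \<in> homogeneous (d + e)"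
  using assms P_mult[of c c' "d + e" d] by (simp add: homogeneous_def)

lemma homogeneous_star: "c \<in> homogeneous d \<Longrightarrow> star R c \<in> homogeneous (- d)"
  by (simp add: homogeneous_def P_star)

lemma homogeneous_pow: "c \<in> homogeneous d \<Longrightarrow> c [^] (n::nat) \<in> homogeneous (int n * d)"
  using homogeneous_mult[of "c [^] m" "int m * d" c d for m]
  by (induction n) (auto simp: homogeneous_one algebra_simps)

lemma homogeneous_0_subalgebra: "star_subalgebra (homogeneous 0) R"
  by (rule star_subalgebraI)
    (use homogeneous_mult[of _ 0 _ 0] homogeneous_star[of _ 0] in \<open>auto simp: homogeneous_carrier
      homogeneous_one homogeneous_add homogeneous_smult\<close>)

lemma P_finsum: "finite F \<Longrightarrow> f \<in> F \<rightarrow> carrier R \<Longrightarrow> P d (finsum R f F) = (\<Oplus>i\<in>F. P d (f i))"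
  by (induction F rule: finite_induct) (auto simp: P_add Pi_def)

end

locale graded_quantum_sphere = quantum_sphere R a b p q \<mu> k l + graded_star_algebra R P
  for R :: "'b star_alg" (structure) and a b p q \<mu> k l P +
  assumes a_homogeneous: "a \<in> homogeneous (int k)" and b_homogeneous: "b \<in> homogeneous (int l)"
    and kl_pos: "k > 0" "l > 0"
begin

text \<open>Since \<open>a\<close> has degree \<open>k\<close> and \<open>b\<close> has degree \<open>l\<close>, both \<open>x\<close> and \<open>y\<close> have degree \<open>k l\<close>, which
  corresponds to the first power of \<open>u\<close>.\<close>

definition "udeg n = n * int (k * l)"

lemma udeg_inj: "udeg m = udeg n \<longleftrightarrow> m = n"
  using kl_pos by (simp add: udeg_def)

lemma udeg_diff: "udeg (m - n) = udeg m - udeg n" and udeg_add: "udeg (m + n) = udeg m + udeg n"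
  and udeg_minus: "udeg (- n) = - udeg n" and udeg_0 [simp]: "udeg 0 = 0"
  by (simp_all add: udeg_def algebra_simps)

lemma xyzw_homogeneous:
  "x \<in> homogeneous (udeg 1)" "y \<in> homogeneous (udeg 1)" "z \<in> homogeneous 0" "w \<in> homogeneous 0"
proof -
  show "x \<in> homogeneous (udeg 1)" using homogeneous_pow[OF a_homogeneous, of l]
    by (simp add: x_def udeg_def mult.commute)
  show "y \<in> homogeneous (udeg 1)" using homogeneous_pow[OF b_homogeneous, of k]
    by (simp add: y_def udeg_def)
  show "z \<in> homogeneous 0"
    using homogeneous_mult[OF a_homogeneous homogeneous_star[OF a_homogeneous]]
    unfolding z_def by (intro homogeneous_minus homogeneous_one) simp
  show "w \<in> homogeneous 0"
    using homogeneous_mult[OF b_homogeneous homogeneous_star[OF b_homogeneous]]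
    unfolding w_def by (intro homogeneous_minus homogeneous_one) simp
qed

lemma base_homogeneous: "base \<subseteq> homogeneous 0"
  unfolding base_def
  using xyzw_homogeneous homogeneous_mult[OF xyzw_homogeneous(1) homogeneous_star[OF xyzw_homogeneous(2)]]
  by (intro generated_star_subalgebra_least[OF homogeneous_0_subalgebra]) (auto simp: C_def)

lemma spow_homogeneous:
  assumes "u \<in> homogeneous (udeg 1)" shows "spow u i \<in> homogeneous (udeg i)"
  using homogeneous_pow[OF assms, of "nat i"] homogeneous_pow[OF homogeneous_star[OF assms], of "nat (- i)"]
  by (auto simp: spow_def udeg_def)

lemma line_part_homogeneous: "c \<in> line_part n \<Longrightarrow> c \<in> homogeneous (udeg n)"
proof (induction rule: line_part.induct)
  case (monomial s i j)
  then have "s \<in> homogeneous 0" using base_homogeneous by blast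
  from homogeneous_mult[OF homogeneous_mult[OF this spow_homogeneous[OF xyzw_homogeneous(1), of i]]
      spow_homogeneous[OF xyzw_homogeneous(2), of j]]
  show ?case using monomial(2) by (simp flip: udeg_add)
qed (rule homogeneous_add)

lemma line_part_zero: "\<zero> \<in> line_part n"
  using smult_line_part[OF line_part.monomial[OF base_closed(2), of 0 n n], of 0] by simp

definition \<rho> :: "'b \<Rightarrow> int \<Rightarrow> 'b" where
  "\<rho> c n = P (udeg n) c"

text \<open>The sum is taken over every sufficiently large index set, so that the decompositions of two
  summands can be compared over a common one.\<close>

lemma total_decomposition_aux:
  assumes "c \<in> total"
  shows "(\<forall>n. \<rho> c n \<in> line_part n) \<and> (\<exists>M. finite M \<and> (\<forall>n. n \<notin> M \<longrightarrow> \<rho> c n = \<zero>) \<and>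
    (\<forall>M'. finite M' \<longrightarrow> M \<subseteq> M' \<longrightarrow> c = finsum R (\<rho> c) M'))"
  using assms unfolding total_eq_line_part_sums
proof induction
  case (line_part c m)
  then have r: "\<rho> c = (\<lambda>n. if m = n then c else \<zero>)"
    using P_homogeneous[OF line_part_homogeneous, of c m] by (auto simp: \<rho>_def udeg_inj)
  have "c = finsum R (\<rho> c) M'" if "finite M'" "{m} \<subseteq> M'" for M'
    using that line_part_carrier[OF line_part] finsum_singleton[of m M' "\<lambda>_. c"] by (simp add: r)
  moreover have "\<rho> c n \<in> line_part n" for n using line_part by (cases "m = n") (simp_all add: r line_part_zero)
  moreover have "\<forall>n. n \<notin> {m} \<longrightarrow> \<rho> c n = \<zero>" by (simp add: r)
  ultimately show ?case by (meson finite.emptyI finite.insertI)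
next
  case (add c d)
  obtain M where M: "finite M" "\<forall>n. n \<notin> M \<longrightarrow> \<rho> c n = \<zero>"
    "\<forall>M'. finite M' \<longrightarrow> M \<subseteq> M' \<longrightarrow> c = finsum R (\<rho> c) M'"
    using add.IH(1) by (elim conjE exE)
  obtain N where N: "finite N" "\<forall>n. n \<notin> N \<longrightarrow> \<rho> d n = \<zero>"
    "\<forall>M'. finite M' \<longrightarrow> N \<subseteq> M' \<longrightarrow> d = finsum R (\<rho> d) M'"
    using add.IH(2) by (elim conjE exE)
  note cl = add(1,2)[THEN line_part_sums_carrier]
  have r: "\<rho> (c \<oplus> d) n = \<rho> c n \<oplus> \<rho> d n" for n using cl by (simp add: \<rho>_def P_add)
  have "c \<oplus> d = finsum R (\<rho> (c \<oplus> d)) M'" if "finite M'" "M \<union> N \<subseteq> M'" for M'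
  proof -
    have "c \<oplus> d = finsum R (\<rho> c) M' \<oplus> finsum R (\<rho> d) M'" using M(3)[rule_format, of M'] N(3)[rule_format, of M'] that by simp
    also have "\<dots> = finsum R (\<rho> (c \<oplus> d)) M'"
      unfolding r[abs_def] using cl by (intro finsum_addf[symmetric]) (auto simp: \<rho>_def)
    finally show ?thesis .
  qed
  moreover have "\<rho> (c \<oplus> d) n \<in> line_part n" for n using add by (simp add: r line_part.add)
  moreover have "finite (M \<union> N)" "\<forall>n. n \<notin> M \<union> N \<longrightarrow> \<rho> (c \<oplus> d) n = \<zero>"
    using M(1,2) N(1,2) by (simp_all add: r)
  ultimately show ?case by (intro conjI allI exI[of _ "M \<union> N"] impI) simp_all
qed

lemma \<rho>_line_part: "c \<in> total \<Longrightarrow> \<rho> c n \<in> line_part n"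
  using total_decomposition_aux by blast

lemma \<rho>_finite: "c \<in> total \<Longrightarrow> finite {n. \<rho> c n \<noteq> \<zero>}"
proof -
  assume "c \<in> total"
  then obtain M where M: "finite M" "\<forall>n. n \<notin> M \<longrightarrow> \<rho> c n = \<zero>"
    using total_decomposition_aux[of c] by (auto simp only: simp_thms)
  show ?thesis by (rule finite_subset[OF _ M(1)]) (use M(2) in blast)
qed

lemma total_decomposition:
  assumes "c \<in> total" shows "c = (\<Oplus>n\<in>{n. \<rho> c n \<noteq> \<zero>}. \<rho> c n)"
proof -
  obtain M where M: "finite M" "\<forall>n. n \<notin> M \<longrightarrow> \<rho> c n = \<zero>" "c = finsum R (\<rho> c) M"
    using total_decomposition_aux[OF assms] by (elim conjE exE) blast
  have "c \<in> carrier R" using assms total_closed by blast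
  then have "finsum R (\<rho> c) M = finsum R (\<rho> c) {n. \<rho> c n \<noteq> \<zero>}"
    using M(1,2) by (intro add.finprod_mono_neutral_cong_right) (auto simp: \<rho>_def)
  with M(3) show ?thesis by simp
qed

lemma total_carrier: "c \<in> total \<Longrightarrow> c \<in> carrier R" using total_closed(1) by blast

abbreviation "Tot \<equiv> generated_star_subalgebra R {x, y, z, w}"

lemma Tot_eq: "Tot = R\<lparr>carrier := total\<rparr>"
  by (simp add: total_def generated_star_subalgebra_def)

lemma tensor_u_Tot: "tensor_u Tot c n = (\<lambda>i. if i = n then c else \<zero>)"
  by (auto simp: tensor_u_def Tot_eq fun_eq_iff)

lemma \<rho>_homogeneous: "c \<in> homogeneous (udeg n) \<Longrightarrow> \<rho> c = tensor_u Tot c n"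
  using P_homogeneous[of c "udeg n"] by (auto simp: tensor_u_Tot \<rho>_def udeg_inj)

lemma \<rho>_mult:
  assumes c: "c \<in> total" "d \<in> total"
  shows "\<rho> (c \<otimes> d) n = (\<Oplus>i\<in>{i. \<rho> c i \<noteq> \<zero>}. \<rho> c i \<otimes> \<rho> d (n - i))"
proof -
  let ?M = "{i. \<rho> c i \<noteq> \<zero>}"
  note cl = c[THEN total_carrier]
  have [simp]: "\<rho> c i \<in> carrier R" for i using cl by (simp add: \<rho>_def)
  have "\<rho> (c \<otimes> d) n = P (udeg n) ((\<Oplus>i\<in>?M. \<rho> c i) \<otimes> d)"
    using total_decomposition[OF c(1)] by (simp add: \<rho>_def)
  also have "\<dots> = (\<Oplus>i\<in>?M. P (udeg n) (\<rho> c i \<otimes> d))"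
    using \<rho>_finite[OF c(1)] cl by (simp add: finsum_ldistr P_finsum)
  also have "\<dots> = (\<Oplus>i\<in>?M. \<rho> c i \<otimes> \<rho> d (n - i))"
    using cl by (intro finsum_cong') (auto simp: \<rho>_def P_mult udeg_diff)
  finally show ?thesis .
qed

text \<open>The family of components is the coaction: \<open>\<rho> c n\<close> is the coefficient of \<open>u\<^sup>n\<close>.\<close>

lemma \<rho>_star_alg_hom: "star_alg_hom Tot (tensor_circle Tot) \<rho>"
  unfolding star_alg_hom_def
proof (intro conjI ballI allI)
  show "\<rho> \<in> ring_hom Tot (tensor_circle Tot)"
  proof (rule ring_hom_memI)
    fix c assume c: "c \<in> carrier Tot"
    then show "\<rho> c \<in> carrier (tensor_circle Tot)"
      using \<rho>_finite[of c] line_part_subset_total[OF \<rho>_line_part] by (auto simp: Tot_eq tensor_circle_def)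
    fix d assume d: "d \<in> carrier Tot"
    show "\<rho> (c \<oplus>\<^bsub>Tot\<^esub> d) = \<rho> c \<oplus>\<^bsub>tensor_circle Tot\<^esub> \<rho> d"
      using c d by (auto simp: Tot_eq tensor_circle_def \<rho>_def P_add total_carrier)
    have "(\<Oplus>\<^bsub>Tot\<^esub>i\<in>{i. \<rho> c i \<noteq> \<zero>}. \<rho> c i \<otimes> \<rho> d (n - i)) = (\<Oplus>i\<in>{i. \<rho> c i \<noteq> \<zero>}. \<rho> c i \<otimes> \<rho> d (n - i))" for n
      unfolding Tot_eq using c d line_part_subset_total[OF \<rho>_line_part] total_closed(7)
      by (intro finsum_subalgebra[OF total_subalgebra]) (auto simp: Tot_eq)
    then show "\<rho> (c \<otimes>\<^bsub>Tot\<^esub> d) = \<rho> c \<otimes>\<^bsub>tensor_circle Tot\<^esub> \<rho> d"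
      using c d by (auto simp: tensor_circle_def \<rho>_mult Tot_eq)
  next
    show "\<rho> \<one>\<^bsub>Tot\<^esub> = \<one>\<^bsub>tensor_circle Tot\<^esub>"
      using \<rho>_homogeneous[of \<one> 0] homogeneous_one unfolding tensor_u_Tot
      by (auto simp: tensor_circle_def Tot_eq fun_eq_iff)
  qed
qed (auto simp: Tot_eq tensor_circle_def \<rho>_def P_smult P_star udeg_minus total_carrier)

text \<open>Two homomorphisms agree on a star-subalgebra, so it suffices that they agree on the generators.
  Together with the previous lemma this identifies the coaction, which is given only by a choice.\<close>

lemma coaction_unique:
  assumes \<sigma>: "star_alg_hom Tot (tensor_circle Tot) \<sigma>"
    and gens: "\<sigma> x = tensor_u Tot x 1" "\<sigma> y = tensor_u Tot y 1"
      "\<sigma> z = tensor_u Tot z 0" "\<sigma> w = tensor_u Tot w 0"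
    and c: "c \<in> total"
  shows "\<sigma> c = \<rho> c"
proof -
  let ?S = "{c \<in> total. \<sigma> c = \<rho> c}"
  note h = \<sigma>[unfolded star_alg_hom_def] \<rho>_star_alg_hom[unfolded star_alg_hom_def]
  have s: "\<sigma> (e \<odot>\<^bsub>Tot\<^esub> c) = e \<odot>\<^bsub>tensor_circle Tot\<^esub> \<sigma> c" "\<rho> (e \<odot>\<^bsub>Tot\<^esub> c) = e \<odot>\<^bsub>tensor_circle Tot\<^esub> \<rho> c"
    "\<sigma> (star Tot c) = star (tensor_circle Tot) (\<sigma> c)" "\<rho> (star Tot c) = star (tensor_circle Tot) (\<rho> c)"
    if "c \<in> total" for c e using h that by (auto simp: Tot_eq)
  have m: "\<sigma> (c \<otimes>\<^bsub>Tot\<^esub> d) = \<sigma> c \<otimes>\<^bsub>tensor_circle Tot\<^esub> \<sigma> d"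
    "\<rho> (c \<otimes>\<^bsub>Tot\<^esub> d) = \<rho> c \<otimes>\<^bsub>tensor_circle Tot\<^esub> \<rho> d"
    "\<sigma> (c \<oplus>\<^bsub>Tot\<^esub> d) = \<sigma> c \<oplus>\<^bsub>tensor_circle Tot\<^esub> \<sigma> d"
    "\<rho> (c \<oplus>\<^bsub>Tot\<^esub> d) = \<rho> c \<oplus>\<^bsub>tensor_circle Tot\<^esub> \<rho> d"
    if "c \<in> total" "d \<in> total" for c d
    using h that ring_hom_mult[of _ Tot "tensor_circle Tot"] ring_hom_add[of _ Tot "tensor_circle Tot"]
    by (auto simp: Tot_eq)
  have o: "\<sigma> \<one>\<^bsub>Tot\<^esub> = \<rho> \<one>\<^bsub>Tot\<^esub>"
    using h ring_hom_one[of _ Tot "tensor_circle Tot"] by auto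
  have "star_subalgebra ?S R"
    by (rule star_subalgebraI) (use s m o total_closed in \<open>auto simp: Tot_eq\<close>)
  moreover have "{x, y, z, w} \<subseteq> ?S"
    using xyzw_total gens xyzw_homogeneous \<rho>_homogeneous[of x 1] \<rho>_homogeneous[of y 1]
      \<rho>_homogeneous[of z 0] \<rho>_homogeneous[of w 0] by auto
  ultimately have "total \<subseteq> ?S" unfolding total_def by (rule generated_star_subalgebra_least)
  with c show ?thesis by blast
qed

lemma some_coaction:
  assumes c: "c \<in> total"
  shows "(SOME \<sigma>. star_alg_hom Tot (tensor_circle Tot) \<sigma> \<and> \<sigma> x = tensor_u Tot x 1 \<and>
      \<sigma> y = tensor_u Tot y 1 \<and> \<sigma> z = tensor_u Tot z 0 \<and> \<sigma> w = tensor_u Tot w 0) c = \<rho> c"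
proof (rule someI2[of _ \<rho>])
  show "star_alg_hom Tot (tensor_circle Tot) \<rho> \<and> \<rho> x = tensor_u Tot x 1 \<and>
      \<rho> y = tensor_u Tot y 1 \<and> \<rho> z = tensor_u Tot z 0 \<and> \<rho> w = tensor_u Tot w 0"
    using \<rho>_star_alg_hom xyzw_homogeneous \<rho>_homogeneous[of _ 1] \<rho>_homogeneous[of _ 0] by auto
qed (use coaction_unique c in blast)

definition line :: "int \<Rightarrow> 'b set" where
  "line n = {c \<in> total. \<rho> c = tensor_u Tot c n}"

lemma line_eq: "line n = total \<inter> homogeneous (udeg n)"
proof -
  have "c \<in> homogeneous (udeg n)" if "c \<in> total" "\<rho> c = tensor_u Tot c n" for c
    using fun_cong[OF that(2), of n] total_carrier[OF that(1)]
    by (simp add: homogeneous_def tensor_u_Tot \<rho>_def)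
  then show ?thesis by (auto simp: line_def \<rho>_homogeneous)
qed

text \<open>A coinvariant is its own component of degree zero, and that component lies in the base.\<close>

lemma line_0: "line 0 = base"
proof
  show "line 0 \<subseteq> base"
  proof
    fix c assume c: "c \<in> line 0"
    then have "c \<in> total" "\<rho> c 0 = c" unfolding line_def tensor_u_Tot by auto
    then show "c \<in> base" using line_part_0_base[OF \<rho>_line_part, of c] by simp
  qed
  show "base \<subseteq> line 0"
    using base_subset_total base_homogeneous by (auto simp: line_eq)
qed

lemma line_mult: "c \<in> line m \<Longrightarrow> d \<in> line n \<Longrightarrow> c \<otimes> d \<in> line (m + n)"
  by (auto simp: line_eq udeg_add total_closed intro: homogeneous_mult)

lemma line_add: "c \<in> line n \<Longrightarrow> d \<in> line n \<Longrightarrow> c \<oplus> d \<in> line n"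
  by (auto simp: line_eq total_closed intro: homogeneous_add)

lemma line_zero: "\<zero> \<in> line n" by (simp add: line_eq total_closed homogeneous_def)

lemma line_minus: "c \<in> line n \<Longrightarrow> \<ominus> c \<in> line n"
  by (auto simp: line_eq total_closed minus_eq_smult homogeneous_carrier intro: homogeneous_smult)

lemma xy_line: "x \<in> line 1" "y \<in> line 1" "star R x \<in> line (- 1)" "star R y \<in> line (- 1)"
  using xyzw_homogeneous xyzw_total homogeneous_star[OF xyzw_homogeneous(1)]
    homogeneous_star[OF xyzw_homogeneous(2)] total_closed(9)
  by (auto simp: line_eq udeg_minus)

lemma f_line: "f \<in> line 0" "f' \<in> line 0"
  using poly_in_subalgebra[OF base_subalgebra zwC_base(1)] poly_f poly_f' by (auto simp: line_0)

lemma connection_line: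
  assumes "u \<in> line (- m)" "u' \<in> line m" "v \<in> line (- m)" "v' \<in> line m"
    "(c, d) \<in> set (connection u u' v v' n)"
  shows "c \<in> line (- (int n * m)) \<and> d \<in> line (int n * m)"
  using assms(5)
proof (induction n arbitrary: c d)
  case 0
  then show ?case using base_closed(2) by (simp add: line_0)
next
  case (Suc n)
  then obtain c' d' where e: "(c', d') \<in> set (connection u u' v v' n)"
    "c = u \<otimes> c' \<and> d = d' \<otimes> u' \<or> c = v \<otimes> c' \<and> d = d' \<otimes> v'" by auto
  then show ?case
    using Suc.IH[OF e(1)] line_mult[of _ "- m" c' "- (int n * m)"] line_mult[of d' "int n * m" _ m] assms(1-4)
    by (auto simp: algebra_simps)
qed

end


section \<open>Traces and free modules\<close>

context star_algebra
begin

text \<open>The elements \<open>d i\<close> with the functionals \<open>v \<mapsto> v c\<^sub>i\<close> form a dual basis of \<open>L\<close>, and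
  \<open>\<Sum> d\<^sub>i c\<^sub>i\<close> is the trace of the corresponding idempotent. Let \<open>d\<^sub>i = \<Sum> r\<^sub>i\<^sub>e e\<close> in a basis of the
  module. Expanding \<open>e = \<Sum> e c\<^sub>i d\<^sub>i\<close> in this basis gives \<open>\<Sum> e c\<^sub>i r\<^sub>i\<^sub>e = 1\<close> for every basis element
  \<open>e\<close>, while \<open>\<Sum> d\<^sub>i c\<^sub>i = \<Sum> r\<^sub>i\<^sub>e e c\<^sub>i\<close>. A trace does not see the order of the factors, so
  the trace of the idempotent is a finite sum of copies of \<open>\<tau> 1 = 0\<close>.\<close>

lemma free_module_trace_zero:
  fixes c d :: "'i \<Rightarrow> 'b" and \<tau> :: "'b \<Rightarrow> complex"
  defines "M \<equiv> \<lambda>L. \<lparr>carrier = L, mult = mult R, one = one R, zero = zero R, add = add R, smult = mult R\<rparr>"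
  assumes S: "star_subalgebra S R" and L: "L \<subseteq> carrier R" "\<zero> \<in> L" "\<And>u v. u \<in> L \<Longrightarrow> v \<in> L \<Longrightarrow> u \<oplus> v \<in> L"
      "\<And>u. u \<in> L \<Longrightarrow> \<ominus> u \<in> L" "\<And>s v. s \<in> S \<Longrightarrow> v \<in> L \<Longrightarrow> s \<otimes> v \<in> L"
    and I: "finite I" "\<And>i. i \<in> I \<Longrightarrow> c i \<in> carrier R" "\<And>i. i \<in> I \<Longrightarrow> d i \<in> L"
      "\<And>i v. i \<in> I \<Longrightarrow> v \<in> L \<Longrightarrow> v \<otimes> c i \<in> S"
      "(\<Oplus>i\<in>I. c i \<otimes> d i) = \<one>"
    and \<tau>: "\<And>s t. s \<in> S \<Longrightarrow> t \<in> S \<Longrightarrow> \<tau> (s \<oplus> t) = \<tau> s + \<tau> t"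
      "\<And>s t. s \<in> S \<Longrightarrow> t \<in> S \<Longrightarrow> \<tau> (s \<otimes> t) = \<tau> (t \<otimes> s)" "\<tau> \<one> = 0"
    and free: "free_left_module (R\<lparr>carrier := S\<rparr>) (M L)"
  shows "\<tau> (\<Oplus>i\<in>I. d i \<otimes> c i) = 0"
proof -
  note Scl = star_subalgebraD[OF S]
  have M_simps: "carrier (M L) = L" "smult (M L) = mult R" "zero (M L) = \<zero>" "add (M L) = add R"
    by (simp_all add: M_def)
  interpret M: abelian_group "M L"
  proof (rule abelian_groupI)
    fix u assume u: "u \<in> carrier (M L)"
    show "\<exists>v\<in>carrier (M L). v \<oplus>\<^bsub>M L\<^esub> u = \<zero>\<^bsub>M L\<^esub>"
      using u L by (intro bexI[of _ "\<ominus> u"]) (auto simp: M_simps l_neg subset_iff)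
  qed (use L in \<open>auto simp: M_simps a_ac subset_iff\<close>)
  have finsum_M: "finsum (M L) g F = finsum R g F" if "finite F" "g \<in> F \<rightarrow> L" for g and F :: "'b set"
    using that
  proof (induction F rule: finite_induct)
    case empty
    then show ?case by (simp add: M_simps)
  next
    case (insert e F)
    then have "finsum (M L) g (insert e F) = g e \<oplus> finsum R g F"
      by (subst M.finsum_insert) (auto simp: M_simps Pi_def)
    also have "\<dots> = finsum R g (insert e F)"
      using insert L(1) by (subst finsum_insert) (auto simp: Pi_def)
    finally show ?case .
  qed
  obtain X where X: "X \<subseteq> L"
    "\<And>F r. finite F \<Longrightarrow> F \<subseteq> X \<Longrightarrow> r \<in> F \<rightarrow> S \<Longrightarrow> (\<Oplus>\<^bsub>M L\<^esub>e\<in>F. r e \<otimes> e) = \<zero> \<Longrightarrow> \<forall>e\<in>F. r e = \<zero>"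
    "\<And>v. v \<in> L \<Longrightarrow> \<exists>F r. finite F \<and> F \<subseteq> X \<and> r \<in> F \<rightarrow> S \<and> v = (\<Oplus>\<^bsub>M L\<^esub>e\<in>F. r e \<otimes> e)"
    using free unfolding free_left_module_def by (auto simp: M_simps)
  have "\<forall>i\<in>I. \<exists>F r. finite F \<and> F \<subseteq> X \<and> r \<in> F \<rightarrow> S \<and> d i = (\<Oplus>\<^bsub>M L\<^esub>e\<in>F. r e \<otimes> e)"
    using X(3) I(3) by blast
  from bchoice[OF this] obtain F' where
    "\<forall>i\<in>I. \<exists>r. finite (F' i) \<and> F' i \<subseteq> X \<and> r \<in> F' i \<rightarrow> S \<and> d i = (\<Oplus>\<^bsub>M L\<^esub>e\<in>F' i. r e \<otimes> e)" ..
  from bchoice[OF this] obtain r' where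
    "\<forall>i\<in>I. finite (F' i) \<and> F' i \<subseteq> X \<and> r' i \<in> F' i \<rightarrow> S \<and> d i = (\<Oplus>\<^bsub>M L\<^esub>e\<in>F' i. r' i e \<otimes> e)" ..
  then have F': "\<And>i. i \<in> I \<Longrightarrow> finite (F' i)" "\<And>i. i \<in> I \<Longrightarrow> F' i \<subseteq> X"
    "\<And>i. i \<in> I \<Longrightarrow> r' i \<in> F' i \<rightarrow> S" "\<And>i. i \<in> I \<Longrightarrow> d i = (\<Oplus>\<^bsub>M L\<^esub>e\<in>F' i. r' i e \<otimes> e)"
    by (auto simp only:)
  \<comment> \<open>The basis may be infinite, but only the elements of \<open>F\<close> occur in the expansions.\<close>
  define F where "F = (\<Union>i\<in>I. F' i)"
  define r where "r i e = (if e \<in> F' i then r' i e else \<zero>)" for i e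
  have F: "finite F" "F \<subseteq> X" using F' I(1) by (auto simp: F_def)
  have FL: "e \<in> L" "e \<in> carrier R" if "e \<in> F" for e using that F(2) X(1) L(1) by auto
  have r: "r i e \<in> S" "r i e \<in> carrier R" if "i \<in> I" for i e
  proof -
    show "r i e \<in> S" using F'(3)[OF that] Scl(3) by (auto simp: r_def)
    then show "r i e \<in> carrier R" using Scl(1) by blast
  qed
  have d: "d i = (\<Oplus>e\<in>F. r i e \<otimes> e)" if i: "i \<in> I" for i
  proof -
    have "d i = (\<Oplus>e\<in>F' i. r' i e \<otimes> e)"
      using F'[OF i] X(1) L(5) by (subst F'(4)[OF i], intro finsum_M) (auto simp: subset_iff Pi_def)
    also have "\<dots> = (\<Oplus>e\<in>F. r i e \<otimes> e)"
      using F(1) i F'(3)[OF i] Scl(1) FL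
      by (intro add.finprod_mono_neutral_cong_left) (auto simp: F_def r_def Pi_def subset_iff)
    finally show ?thesis .
  qed
  define s where "s e g = (\<Oplus>i\<in>I. (e \<otimes> c i) \<otimes> r i g)" for e g
  have ec: "e \<otimes> c i \<in> S" "e \<otimes> c i \<in> carrier R" if "e \<in> F" "i \<in> I" for e i
    using I(4) FL(1) that Scl(1) by blast+
  have sS: "s e g \<in> S" "s e g \<in> carrier R" if "e \<in> F" for e g
  proof -
    show "s e g \<in> S" unfolding s_def
      using ec[OF that] r Scl(7) by (intro star_subalgebra_finsum[OF S I(1)]) auto
    then show "s e g \<in> carrier R" using Scl(1) by blast
  qed
  have see: "s e e = \<one>" if e: "e \<in> F" for e
  proof -
    have dc: "d i \<in> carrier R" if "i \<in> I" for i using I(3)[OF that] L(1) by blast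
    have "e = e \<otimes> (\<Oplus>i\<in>I. c i \<otimes> d i)" using FL(2)[OF e] by (simp add: I(5))
    also have "\<dots> = (\<Oplus>i\<in>I. e \<otimes> (c i \<otimes> d i))"
      using I dc FL(2)[OF e] by (intro finsum_rdistr) auto
    also have "\<dots> = (\<Oplus>i\<in>I. \<Oplus>g\<in>F. (e \<otimes> c i) \<otimes> r i g \<otimes> g)"
    proof (intro finsum_cong')
      fix i assume i: "i \<in> I"
      have "e \<otimes> (c i \<otimes> d i) = (e \<otimes> c i) \<otimes> (\<Oplus>g\<in>F. r i g \<otimes> g)"
        using I(2)[OF i] FL(2)[OF e] dc[OF i] by (simp add: m_assoc flip: d[OF i])
      also have "\<dots> = (\<Oplus>g\<in>F. (e \<otimes> c i) \<otimes> (r i g \<otimes> g))"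
        using F(1) ec[OF e i] r(2)[OF i] FL(2) by (intro finsum_rdistr) auto
      also have "\<dots> = (\<Oplus>g\<in>F. (e \<otimes> c i) \<otimes> r i g \<otimes> g)"
        using ec[OF e i] r(2)[OF i] FL(2) by (intro finsum_cong') (auto simp: m_assoc)
      finally show "e \<otimes> (c i \<otimes> d i) = (\<Oplus>g\<in>F. (e \<otimes> c i) \<otimes> r i g \<otimes> g)" .
    qed (use ec[OF e] r(2) FL(2) in \<open>auto intro!: finsum_closed\<close>)
    also have "\<dots> = (\<Oplus>g\<in>F. \<Oplus>i\<in>I. (e \<otimes> c i) \<otimes> r i g \<otimes> g)"
      using I(1) F(1) ec[OF e] r(2) FL(2) by (intro finsum_swap) auto
    also have "\<dots> = (\<Oplus>g\<in>F. s e g \<otimes> g)"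
      unfolding s_def using I(1) ec[OF e] r(2) FL(2)
      by (intro finsum_cong') (auto intro!: finsum_ldistr[symmetric] finsum_closed)
    finally have e1: "e = (\<Oplus>g\<in>F. s e g \<otimes> g)" .
    define \<delta> where "\<delta> g = (if e = g then \<one> else \<zero>)" for g
    have e2: "e = (\<Oplus>g\<in>F. \<delta> g \<otimes> g)"
    proof -
      have "(\<Oplus>g\<in>F. \<delta> g \<otimes> g) = (\<Oplus>g\<in>F. if e = g then e else \<zero>)"
        using FL(2) by (intro finsum_cong') (auto simp: \<delta>_def)
      then show ?thesis using finsum_singleton[of e F "\<lambda>_. e"] e F(1) FL(2) by simp
    qed
    have \<delta>: "\<delta> g \<in> S" "\<delta> g \<in> carrier R" for g using Scl(2,3) by (auto simp: \<delta>_def)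
    have "s e g \<otimes> g = (s e g \<ominus> \<delta> g) \<otimes> g \<oplus> \<delta> g \<otimes> g" if "g \<in> F" for g
      using sS[OF e] \<delta>(2) FL(2)[OF that] by (simp add: a_minus_def a_assoc l_neg flip: l_distr)
    then have "(\<Oplus>g\<in>F. s e g \<otimes> g) = (\<Oplus>g\<in>F. (s e g \<ominus> \<delta> g) \<otimes> g \<oplus> \<delta> g \<otimes> g)"
      using sS(2)[OF e] \<delta>(2) FL(2) by (intro finsum_cong') auto
    also have "\<dots> = (\<Oplus>g\<in>F. (s e g \<ominus> \<delta> g) \<otimes> g) \<oplus> (\<Oplus>g\<in>F. \<delta> g \<otimes> g)"
      using sS(2)[OF e] \<delta>(2) FL(2) by (intro finsum_addf) auto
    finally have "(\<Oplus>g\<in>F. (s e g \<ominus> \<delta> g) \<otimes> g) \<oplus> (\<Oplus>g\<in>F. \<delta> g \<otimes> g) = (\<Oplus>g\<in>F. s e g \<otimes> g)" ..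
    then have "(\<Oplus>g\<in>F. (s e g \<ominus> \<delta> g) \<otimes> g) \<oplus> e = e" by (simp flip: e1 e2)
    moreover have cl: "(\<Oplus>g\<in>F. (s e g \<ominus> \<delta> g) \<otimes> g) \<in> carrier R"
      using sS[OF e] \<delta> FL(2) by (intro finsum_closed) auto
    ultimately have "(\<Oplus>g\<in>F. (s e g \<ominus> \<delta> g) \<otimes> g) = \<zero>" using FL(2)[OF e] by (metis add.r_cancel_one)
    moreover have "(\<Oplus>\<^bsub>M L\<^esub>g\<in>F. (s e g \<ominus> \<delta> g) \<otimes> g) = (\<Oplus>g\<in>F. (s e g \<ominus> \<delta> g) \<otimes> g)"
      using F(1) sS[OF e] \<delta> Scl(6) L(5) FL(1) by (intro finsum_M) auto
    ultimately have "(\<Oplus>\<^bsub>M L\<^esub>g\<in>F. (s e g \<ominus> \<delta> g) \<otimes> g) = \<zero>" by simp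
    moreover have "(\<lambda>g. s e g \<ominus> \<delta> g) \<in> F \<rightarrow> S" using sS(1)[OF e] \<delta>(1) Scl(6) by blast
    ultimately have "\<forall>g\<in>F. s e g \<ominus> \<delta> g = \<zero>" by (intro X(2)[OF F])
    then have "s e e \<ominus> \<delta> e = \<zero>" using e by (rule bspec)
    then have "s e e \<ominus> \<one> = \<zero>" by (simp add: \<delta>_def)
    then show ?thesis using sS(2)[OF e] by simp
  qed
  have \<tau>_zero: "\<tau> \<zero> = 0" using \<tau>(1)[of \<zero> \<zero>] Scl(3) by simp
  have \<tau>_sum: "\<tau> (finsum R g J) = (\<Sum>j\<in>J. \<tau> (g j))" if "finite J" "g \<in> J \<rightarrow> S" for g and J :: "'j set"
    using that
  proof (induction J rule: finite_induct)
    case (insert j J)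
    then have "finsum R g (insert j J) = g j \<oplus> finsum R g J"
      using Scl(1) by (intro finsum_insert) (auto simp: Pi_def subset_iff)
    then show ?case
      using insert \<tau>(1)[of "g j" "finsum R g J"] star_subalgebra_finsum[OF S, of J g] by (simp add: Pi_def)
  qed (simp add: \<tau>_zero)
  have dc: "d i \<otimes> c i = (\<Oplus>e\<in>F. r i e \<otimes> (e \<otimes> c i))" if i: "i \<in> I" for i
    unfolding d[OF i] using F(1) I(2)[OF i] r(2)[OF i] FL(2) 
    by (subst finsum_ldistr) (auto intro!: finsum_cong' simp: m_assoc)
  have "\<tau> (\<Oplus>i\<in>I. d i \<otimes> c i) = (\<Sum>i\<in>I. \<tau> (d i \<otimes> c i))"
    using I by (intro \<tau>_sum) auto
  also have "\<dots> = (\<Sum>i\<in>I. \<Sum>e\<in>F. \<tau> (r i e \<otimes> (e \<otimes> c i)))"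
    using r(1) ec(1) Scl(7) by (intro sum.cong refl) (auto simp: dc intro!: \<tau>_sum F(1))
  also have "\<dots> = (\<Sum>i\<in>I. \<Sum>e\<in>F. \<tau> ((e \<otimes> c i) \<otimes> r i e))"
    using r(1) ec(1) by (intro sum.cong refl \<tau>(2)) auto
  also have "\<dots> = (\<Sum>e\<in>F. \<Sum>i\<in>I. \<tau> ((e \<otimes> c i) \<otimes> r i e))" by (rule sum.swap)
  also have "\<dots> = (\<Sum>e\<in>F. \<tau> (s e e))"
    unfolding s_def using r(1) ec(1) Scl(7) by (intro sum.cong refl \<tau>_sum[symmetric] I(1)) auto
  also have "\<dots> = 0" using see \<tau>(3) by simp
  finally show ?thesis .
qed

end


context graded_quantum_sphere
begin

lemma free_line_trace_zero:
  assumes L: "\<And>c d. (c, d) \<in> set L \<Longrightarrow> c \<in> line (- n) \<and> d \<in> line n"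
    and counit: "list_sum (\<lambda>(c, d). c \<otimes> d) L = \<one>"
    and \<tau>: "\<And>s t. s \<in> base \<Longrightarrow> t \<in> base \<Longrightarrow> \<tau> (s \<oplus> t) = \<tau> s + \<tau> t"
      "\<And>s t. s \<in> base \<Longrightarrow> t \<in> base \<Longrightarrow> \<tau> (s \<otimes> t) = \<tau> (t \<otimes> s)" "\<tau> \<one> = 0"
    and free: "free_left_module (R\<lparr>carrier := base\<rparr>)
      \<lparr>carrier = line n, mult = mult R, one = one R, zero = zero R, add = add R, smult = mult R\<rparr>"
  shows "\<tau> (list_sum (\<lambda>(c, d). d \<otimes> c) L) = (0 :: complex)"
proof -
  have cl: "c \<in> carrier R \<and> d \<in> carrier R" if "(c, d) \<in> set L" for c d
    using L[OF that] by (auto simp: line_eq homogeneous_carrier)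
  have nth: "fst (L ! i) \<in> line (- n)" "snd (L ! i) \<in> line n" if "i < length L" for i
    using L[of "fst (L ! i)" "snd (L ! i)"] that by auto
  have sum: "list_sum (\<lambda>(c, d). g c d) L = (\<Oplus>i\<in>{..<length L}. g (fst (L ! i)) (snd (L ! i)))"
    if "\<And>c d. (c, d) \<in> set L \<Longrightarrow> g c d \<in> carrier R" for g
    using that finsum_list_sum[of L "\<lambda>(c, d). g c d"] by (auto simp: split_def)
  have "\<tau> (\<Oplus>i\<in>{..<length L}. snd (L ! i) \<otimes> fst (L ! i)) = 0"
  proof (rule free_module_trace_zero[OF base_subalgebra])
    show "line n \<subseteq> carrier R" by (auto simp: line_eq homogeneous_carrier)
    show "(\<Oplus>i\<in>{..<length L}. fst (L ! i) \<otimes> snd (L ! i)) = \<one>"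
      using sum[of "(\<otimes>)"] counit cl by auto
    show "s \<otimes> v \<in> line n" if "s \<in> base" "v \<in> line n" for s v
      using line_mult[of s 0 v n] that by (simp add: line_0)
    show "v \<otimes> fst (L ! i) \<in> base" if "i \<in> {..<length L}" "v \<in> line n" for i v
      using line_mult[OF that(2) nth(1)[of i]] that(1) by (simp add: line_0)
    show "fst (L ! i) \<in> carrier R" if "i \<in> {..<length L}" for i
      using nth(1)[of i] that by (auto simp: line_eq homogeneous_carrier)
  qed (use nth line_add line_zero line_minus \<tau> free in auto)
  then show ?thesis using sum[of "\<lambda>c d. d \<otimes> c"] cl by auto
qed

end


section \<open>The grading of a presented star-algebra\<close>

fun letter_degree :: "('g \<Rightarrow> int) \<Rightarrow> 'g letter \<Rightarrow> int" where
  "letter_degree \<gamma> (Gen g) = \<gamma> g"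
| "letter_degree \<gamma> (Adj g) = - \<gamma> g"

definition word_degree :: "('g \<Rightarrow> int) \<Rightarrow> 'g word \<Rightarrow> int" where
  "word_degree \<gamma> w = sum_list (map (letter_degree \<gamma>) (letters w))"

lemma word_degree_plus: "word_degree \<gamma> (v + w) = word_degree \<gamma> v + word_degree \<gamma> w"
  by (simp add: word_degree_def plus_word_def)

lemma word_degree_zero [simp]: "word_degree \<gamma> 0 = 0"
  by (simp add: word_degree_def zero_word_def)

lemma word_degree_adj: "word_degree \<gamma> (adj_word w) = - word_degree \<gamma> w"
proof -
  have *: "letter_degree \<gamma> (adj_letter x) = - letter_degree \<gamma> x" for x by (cases x) auto
  have "sum_list (map (letter_degree \<gamma>) (map adj_letter xs)) = - sum_list (map (letter_degree \<gamma>) xs)" for xs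
    by (induction xs) (simp_all add: *)
  then show ?thesis by (simp add: word_degree_def adj_word_def rev_map[symmetric])
qed

definition component :: "('g \<Rightarrow> int) \<Rightarrow> int \<Rightarrow> ('g word \<Rightarrow>\<^sub>0 complex) \<Rightarrow> 'g word \<Rightarrow>\<^sub>0 complex" where
  "component \<gamma> d f = Poly_Mapping.mapp (\<lambda>w c. c when word_degree \<gamma> w = d) f"

lemma lookup_component:
  "poly_mapping.lookup (component \<gamma> d f) w = (poly_mapping.lookup f w when word_degree \<gamma> w = d)"
  by (auto simp: component_def lookup_mapp when_def in_keys_iff)

lemma component_add: "component \<gamma> d (f + g) = component \<gamma> d f + component \<gamma> d g"
  by (intro poly_mapping_eqI) (simp add: lookup_component lookup_add when_add_distrib)

lemma component_diff: "component \<gamma> d (f - g) = component \<gamma> d f - component \<gamma> d g"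
  by (intro poly_mapping_eqI) (simp add: lookup_component lookup_minus when_diff_distrib)

lemma component_zero [simp]: "component \<gamma> d 0 = 0"
  by (intro poly_mapping_eqI) (simp add: lookup_component)

lemma component_single:
  "component \<gamma> d (Poly_Mapping.single w c) = (if word_degree \<gamma> w = d then Poly_Mapping.single w c else 0)"
  by (intro poly_mapping_eqI) (auto simp: lookup_component lookup_single when_def)

lemma component_component: "component \<gamma> d (component \<gamma> e f) = (if d = e then component \<gamma> d f else 0)"
  by (intro poly_mapping_eqI) (auto simp: lookup_component when_def)

lemma component_single_mult:
  "component \<gamma> d (Poly_Mapping.single w c * f) =
    Poly_Mapping.single w c * component \<gamma> (d - word_degree \<gamma> w) f"
  by (induction f rule: poly_mapping_induct_single)
    (auto simp: mult_single component_single word_degree_plus component_add distrib_left)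

lemma component_mult_single:
  "component \<gamma> d (f * Poly_Mapping.single w c) =
    component \<gamma> (d - word_degree \<gamma> w) f * Poly_Mapping.single w c"
  by (induction f rule: poly_mapping_induct_single)
    (auto simp: mult_single component_single word_degree_plus component_add distrib_right)

lemma component_mult: "component \<gamma> d (component \<gamma> e f * g) = component \<gamma> e f * component \<gamma> (d - e) g"
proof (induction f rule: poly_mapping_induct_single)
  case (1 w c)
  then show ?case by (auto simp: component_single component_single_mult)
qed (simp add: component_add distrib_right)

lemma component_scal: "component \<gamma> d (scal c * f) = scal c * component \<gamma> d f"
  by (simp add: component_single_mult)

lemma component_star: "component \<gamma> d (free_star f) = free_star (component \<gamma> (- d) f)"
  by (intro poly_mapping_eqI) (auto simp: lookup_component lookup_free_star word_degree_adj when_def)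

definition free_homogeneous :: "('g \<Rightarrow> int) \<Rightarrow> int \<Rightarrow> ('g word \<Rightarrow>\<^sub>0 complex) \<Rightarrow> bool" where
  "free_homogeneous \<gamma> d f \<longleftrightarrow> component \<gamma> d f = f"

lemma free_homogeneous_intros:
  "free_homogeneous \<gamma> d f \<Longrightarrow> free_homogeneous \<gamma> d g \<Longrightarrow> free_homogeneous \<gamma> d (f - g)"
  "free_homogeneous \<gamma> d f \<Longrightarrow> free_homogeneous \<gamma> e g \<Longrightarrow> d' = d + e \<Longrightarrow> free_homogeneous \<gamma> d' (f * g)"
  "free_homogeneous \<gamma> 0 (scal c)" "free_homogeneous \<gamma> 0 1"
  "free_homogeneous \<gamma> (\<gamma> v) (free_gen v)"
  "free_homogeneous \<gamma> d f \<Longrightarrow> d' = - d \<Longrightarrow> free_homogeneous \<gamma> d' (free_star f)"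
  using component_mult[of \<gamma> "d + e" d f g]
  by (auto simp: free_homogeneous_def component_diff component_single free_gen_def word_degree_def
      component_star single_one[symmetric] zero_word_def simp del: single_one)

text \<open>The elements all of whose components lie in the ideal of relations form an ideal, and homogeneous
  relations belong to it.\<close>

lemma component_relation_ideal:
  assumes hom: "\<And>r. r \<in> \<R> \<Longrightarrow> \<exists>d. free_homogeneous \<gamma> d r" and f: "f \<in> relation_ideal \<R>"
  shows "component \<gamma> d f \<in> relation_ideal \<R>"
proof -
  let ?J = "{f. \<forall>d. component \<gamma> d f \<in> relation_ideal \<R>}"
  have r: "component \<gamma> d r \<in> relation_ideal \<R>" if r: "r \<in> \<R>" for d r
  proof -
    obtain e where "component \<gamma> e r = r" using hom[OF r] by (auto simp: free_homogeneous_def)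
    then have "component \<gamma> d r = (if d = e then r else 0)" using component_component[of \<gamma> d e r] by auto
    then show ?thesis using relation_ideal_base(1)[OF r] relation_ideal_zero by auto
  qed
  have "relation_ideal \<R> \<subseteq> ?J"
  proof (rule relation_ideal_minimal)
    fix f g :: "'a word \<Rightarrow>\<^sub>0 complex" assume f: "f \<in> ?J"
    show "g * f \<in> ?J"
      by (induction g rule: poly_mapping_induct_single)
        (use f in \<open>auto simp: component_single_mult component_add distrib_right
          intro: relation_ideal_left relation_ideal_add\<close>)
    show "f * g \<in> ?J"
      by (induction g rule: poly_mapping_induct_single)
        (use f in \<open>auto simp: component_mult_single component_add distrib_left
          intro: relation_ideal_right relation_ideal_add\<close>)
  qed (auto simp: component_add component_star r relation_ideal_zero
      intro: relation_ideal_add relation_ideal_star)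
  then show ?thesis using f by blast
qed

text \<open>A union over all representatives, in the same way as the operations of the quotient.\<close>

definition presented_component ::
    "('g word \<Rightarrow>\<^sub>0 complex) set \<Rightarrow> ('g \<Rightarrow> int) \<Rightarrow> int \<Rightarrow> ('g word \<Rightarrow>\<^sub>0 complex) set \<Rightarrow> ('g word \<Rightarrow>\<^sub>0 complex) set" where
  "presented_component \<R> \<gamma> d X = (\<Union>x\<in>X. cls \<R> (component \<gamma> d x))"

lemma presented_component_cls:
  assumes "\<And>r. r \<in> \<R> \<Longrightarrow> \<exists>d. free_homogeneous \<gamma> d r"
  shows "presented_component \<R> \<gamma> d (cls \<R> f) = cls \<R> (component \<gamma> d f)"
  unfolding presented_component_def
  by (rule UN_cls) (use component_relation_ideal[OF assms] in \<open>simp flip: component_diff\<close>)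

lemma graded_presented:
  assumes hom: "\<And>r. r \<in> \<R> \<Longrightarrow> \<exists>d. free_homogeneous \<gamma> d r"
  shows "graded_star_algebra (presented_star_alg \<R>) (presented_component \<R> \<gamma>)"
proof -
  interpret star_algebra "presented_star_alg \<R>" by (rule star_algebra_presented)
  note P = presented_component_cls[OF hom]
  have one: "component \<gamma> 0 1 = 1"
    using free_homogeneous_intros(4)[of \<gamma>] by (simp add: free_homogeneous_def)
  show ?thesis
    by unfold_locales
      (auto simp: presented_carrier presented_ops P component_add component_scal component_component
        component_mult component_star one)
qed


section \<open>The sphere as a presented star-algebra\<close>

text \<open>Subtraction in a ring record refers to its carrier, so passing to the smaller carrier needs an
  argument.\<close>

lemma (in star_algebra) poly_f_subalgebra:
  assumes S: "star_subalgebra S R" and z: "z \<in> S"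
  shows "poly_f (R\<lparr>carrier := S\<rparr>) p l z = poly_f R p l z"
proof -
  interpret S: star_algebra "R\<lparr>carrier := S\<rparr>" by (rule star_algebra_subalgebra[OF S])
  note Scl = star_subalgebraD[OF S]
  have minus: "c \<ominus>\<^bsub>R\<lparr>carrier := S\<rparr>\<^esub> d = c \<ominus> d" if "c \<in> S" "d \<in> S" for c d
  proof -
    have "\<ominus>\<^bsub>R\<lparr>carrier := S\<rparr>\<^esub> d = \<ominus> d"
      using that Scl(1,5) by (intro S.minus_equality) (auto simp: l_neg subset_iff)
    then show ?thesis by (simp add: a_minus_def)
  qed
  have "foldr (mult R) (map (\<lambda>i. \<one> \<ominus> (complex_of_real (p ^ i) \<odot>\<^bsub>R\<^esub> z)) is) \<one> \<in> S" for "is"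
    by (induction "is") (use Scl z in auto)
  then show ?thesis
    unfolding poly_f_def using minus z Scl by (simp del: of_real_power cong: map_cong)
qed

definition sphere_degree :: "nat \<Rightarrow> nat \<Rightarrow> gen \<Rightarrow> int" where
  "sphere_degree k l g = (case g of gen_a \<Rightarrow> int k | gen_b \<Rightarrow> int l)"

lemma sphere_relations_homogeneous:
  assumes "r \<in> sphere_relations p q \<theta>"
  shows "\<exists>d. free_homogeneous (sphere_degree k l) d r"
proof -
  let ?\<gamma> = "sphere_degree k l"
  have g: "free_homogeneous ?\<gamma> (int k) (free_gen gen_a)" "free_homogeneous ?\<gamma> (int l) (free_gen gen_b)"
    using free_homogeneous_intros(5)[of ?\<gamma> gen_a] free_homogeneous_intros(5)[of ?\<gamma> gen_b]
    by (simp_all add: sphere_degree_def)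
  note s = g[THEN free_homogeneous_intros(6), OF refl]
  note i = free_homogeneous_intros(1-4)
  have 1: "free_homogeneous ?\<gamma> (int k + int l) (free_gen gen_a * free_gen gen_b - scal c * (free_gen gen_b * free_gen gen_a))" for c
    by (rule i g | simp)+
  have 2: "free_homogeneous ?\<gamma> (int k - int l) (free_gen gen_a * free_star (free_gen gen_b) - scal c * (free_star (free_gen gen_b) * free_gen gen_a))" for c
    by (rule i g s | simp)+
  have 3: "free_homogeneous ?\<gamma> 0 (free_star (free_gen v) * free_gen v - scal c * (free_gen v * free_star (free_gen v)) - scal c')" for c c' v
    by (cases v) (rule i g s | simp)+
  have 4: "free_homogeneous ?\<gamma> 0 ((1 - free_gen gen_a * free_star (free_gen gen_a)) * (1 - free_gen gen_b * free_star (free_gen gen_b)))"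
    by (rule i g s | simp)+
  from assms show ?thesis unfolding sphere_relations_def Let_def free_star_alg_simps
    using 1 2 3 4 by blast
qed

lemma graded_quantum_sphere_S3:
  assumes pq: "0 < p" "0 < q" and kl: "0 < k" "0 < l"
  shows "graded_quantum_sphere (S3 p q \<theta>) (S3_a p q \<theta>) (S3_b p q \<theta>) p q (exp (2 * pi * \<i> * \<theta>)) k l
    (presented_component (sphere_relations p q \<theta>) (sphere_degree k l))"
proof -
  let ?\<R> = "sphere_relations p q \<theta>"
  note S3 = S3_def[of p q \<theta>]
  interpret graded_star_algebra "S3 p q \<theta>" "presented_component ?\<R> (sphere_degree k l)"
    unfolding S3 by (rule graded_presented[OF sphere_relations_homogeneous])
  have gens: "S3_a p q \<theta> = cls ?\<R> (free_gen gen_a)" "S3_b p q \<theta> = cls ?\<R> (free_gen gen_b)"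
    by (simp_all add: S3_a_def S3_b_def presented_gen_def coset_eq_cls)
  have cl: "cls ?\<R> f \<in> carrier (S3 p q \<theta>)" for f by (simp add: S3 presented_carrier)
  note ops = presented_ops[of ?\<R>, folded S3]
  have minus: "cls ?\<R> f \<ominus>\<^bsub>S3 p q \<theta>\<^esub> cls ?\<R> g = cls ?\<R> (f - g)" for f g
  proof -
    have "\<ominus>\<^bsub>S3 p q \<theta>\<^esub> cls ?\<R> g = cls ?\<R> (- g)" by (rule minus_equality) (simp_all add: ops cl)
    then show ?thesis by (simp add: a_minus_def ops)
  qed
  have rel: "r \<in> ?\<R> \<Longrightarrow> cls ?\<R> r = cls ?\<R> 0" for r
    using relation_ideal_base(1) by (simp add: cls_eq_iff)
  have eqI: "cls ?\<R> f = cls ?\<R> g" if "f - g \<in> ?\<R>" for f g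
    using relation_ideal_base(1)[OF that] by (simp add: cls_eq_iff)
  have cnj: "cnj (exp (2 * pi * \<i> * \<theta>)) = exp (- (2 * pi * \<i> * \<theta>))" by (simp add: exp_cnj)
  note R = sphere_relations_def[of p q \<theta>, unfolded Let_def free_star_alg_simps]
  note P = presented_component_cls[OF sphere_relations_homogeneous]
  have "quantum_sphere (S3 p q \<theta>) (S3_a p q \<theta>) (S3_b p q \<theta>) p q (exp (2 * pi * \<i> * \<theta>))"
  proof unfold_locales
    show "scalar_comm (exp (2 * pi * \<i> * \<theta>)) (S3_a p q \<theta>) (S3_b p q \<theta>)"
      unfolding scalar_comm_def gens ops by (intro conjI cl eqI) (simp add: R)
    show "scalar_comm (cnj (exp (2 * pi * \<i> * \<theta>))) (S3_a p q \<theta>) (star (S3 p q \<theta>) (S3_b p q \<theta>))"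
      unfolding scalar_comm_def gens ops cnj by (intro conjI cl eqI) (simp add: R)
    show "exp (2 * pi * \<i> * \<theta>) * cnj (exp (2 * pi * \<i> * \<theta>)) = 1"
      unfolding cnj by (simp flip: exp_add)
    show "star (S3 p q \<theta>) (S3_a p q \<theta>) \<otimes>\<^bsub>S3 p q \<theta>\<^esub> S3_a p q \<theta> =
        of_real p \<odot>\<^bsub>S3 p q \<theta>\<^esub> (S3_a p q \<theta> \<otimes>\<^bsub>S3 p q \<theta>\<^esub> star (S3 p q \<theta>) (S3_a p q \<theta>)) \<oplus>\<^bsub>S3 p q \<theta>\<^esub>
        of_real (1 - p) \<odot>\<^bsub>S3 p q \<theta>\<^esub> \<one>\<^bsub>S3 p q \<theta>\<^esub>"
      unfolding gens ops by (rule eqI) (simp add: R diff_diff_eq)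
    show "star (S3 p q \<theta>) (S3_b p q \<theta>) \<otimes>\<^bsub>S3 p q \<theta>\<^esub> S3_b p q \<theta> =
        of_real q \<odot>\<^bsub>S3 p q \<theta>\<^esub> (S3_b p q \<theta> \<otimes>\<^bsub>S3 p q \<theta>\<^esub> star (S3 p q \<theta>) (S3_b p q \<theta>)) \<oplus>\<^bsub>S3 p q \<theta>\<^esub>
        of_real (1 - q) \<odot>\<^bsub>S3 p q \<theta>\<^esub> \<one>\<^bsub>S3 p q \<theta>\<^esub>"
      unfolding gens ops by (rule eqI) (simp add: R diff_diff_eq)
    show "(\<one>\<^bsub>S3 p q \<theta>\<^esub> \<ominus>\<^bsub>S3 p q \<theta>\<^esub> S3_a p q \<theta> \<otimes>\<^bsub>S3 p q \<theta>\<^esub> star (S3 p q \<theta>) (S3_a p q \<theta>)) \<otimes>\<^bsub>S3 p q \<theta>\<^esub>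
        (\<one>\<^bsub>S3 p q \<theta>\<^esub> \<ominus>\<^bsub>S3 p q \<theta>\<^esub> S3_b p q \<theta> \<otimes>\<^bsub>S3 p q \<theta>\<^esub> star (S3 p q \<theta>) (S3_b p q \<theta>)) = \<zero>\<^bsub>S3 p q \<theta>\<^esub>"
      unfolding gens ops minus by (rule rel) (simp add: R)
  qed (use pq in auto)
  moreover have "S3_a p q \<theta> \<in> homogeneous (int k)" "S3_b p q \<theta> \<in> homogeneous (int l)"
    using free_homogeneous_intros(5)[of "sphere_degree k l" gen_a]
      free_homogeneous_intros(5)[of "sphere_degree k l" gen_b]
    by (simp_all add: gens homogeneous_def P cl free_homogeneous_def sphere_degree_def)
  ultimately show ?thesis
    by (intro graded_quantum_sphere.intro graded_quantum_sphere_axioms.intro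
        graded_star_algebra_axioms kl)
qed

context
  fixes p q \<theta> :: real and k l :: nat
  assumes pq: "0 < p" "0 < q" and kl: "0 < k" "0 < l"
begin

interpretation S: graded_quantum_sphere "S3 p q \<theta>" "S3_a p q \<theta>" "S3_b p q \<theta>" p q
    "exp (2 * pi * \<i> * \<theta>)" k l "presented_component (sphere_relations p q \<theta>) (sphere_degree k l)"
  by (rule graded_quantum_sphere_S3[OF pq kl])

lemma sphere_gens:
  "gen_x p q \<theta> l = S.x" "gen_y p q \<theta> k = S.y" "S3_A p q \<theta> = S.z" "S3_B p q \<theta> = S.w"
  "C_plus p q \<theta> k l = S.C"
  by (simp_all add: gen_x_def S.x_def gen_y_def S.y_def S3_A_def S.z_def S3_B_def S.w_def Let_def
      C_plus_def S.C_def S.star_pow)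

lemma S2_eq: "S2 p q \<theta> k l = (S3 p q \<theta>)\<lparr>carrier := S.base\<rparr>"
  by (simp add: S2_def sphere_gens S.base_def generated_star_subalgebra_def)

lemma alg_A_eq: "alg_A p q \<theta> k l = S.Tot"
  by (simp add: alg_A_def sphere_gens)

lemma alg_A_simps:
  "mult (alg_A p q \<theta> k l) = mult (S3 p q \<theta>)" "one (alg_A p q \<theta> k l) = one (S3 p q \<theta>)"
  "zero (alg_A p q \<theta> k l) = zero (S3 p q \<theta>)" "add (alg_A p q \<theta> k l) = add (S3 p q \<theta>)"
  "star (alg_A p q \<theta> k l) = star (S3 p q \<theta>)" "smult (alg_A p q \<theta> k l) = smult (S3 p q \<theta>)"
  "carrier (alg_A p q \<theta> k l) = S.total"
  by (simp_all add: alg_A_eq S.Tot_eq)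

lemma line_bundle_eq:
  "line_bundle p q \<theta> k l n = \<lparr>carrier = S.line n, mult = mult (S3 p q \<theta>), one = one (S3 p q \<theta>),
     zero = zero (S3 p q \<theta>), add = add (S3 p q \<theta>), smult = mult (S3 p q \<theta>)\<rparr>"
proof -
  have "coaction p q \<theta> k l c = S.\<rho> c" if "c \<in> S.total" for c
    unfolding coaction_def Let_def sphere_gens alg_A_eq by (rule S.some_coaction[OF that])
  then show ?thesis
    unfolding line_bundle_def Let_def alg_A_simps S.line_def by (auto simp: alg_A_eq)
qed

lemma omega_eq:
  "omega p q \<theta> k l n = (if n \<ge> 0
     then S.connection (star (S3 p q \<theta>) S.x) S.x (S.f \<otimes>\<^bsub>S3 p q \<theta>\<^esub> star (S3 p q \<theta>) S.y) S.y (nat n)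
     else S.connection S.x (star (S3 p q \<theta>) S.x) (S.f' \<otimes>\<^bsub>S3 p q \<theta>\<^esub> S.y) (star (S3 p q \<theta>) S.y) (nat (- n)))"
proof -
  have f: "poly_f (alg_A p q \<theta> k l) p l c = poly_f (S3 p q \<theta>) p l c" if "c \<in> S.total" for c
    unfolding alg_A_eq S.Tot_eq by (rule S.poly_f_subalgebra[OF S.total_subalgebra that])
  \<comment> \<open>The rescaled argument of \<open>f'\<close> is written with an integer power in the recursion.\<close>
  have pow: "complex_of_real (p powi (- int l)) = of_real (inverse p ^ l)"
    by (simp add: power_int_minus power_inverse)
  have "omega_pos p q \<theta> k l m =
      S.connection (star (S3 p q \<theta>) S.x) S.x (S.f \<otimes>\<^bsub>S3 p q \<theta>\<^esub> star (S3 p q \<theta>) S.y) S.y m" for m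
    by (induction m) (simp_all add: Let_def alg_A_simps sphere_gens f S.xyzw_total S.f_def)
  moreover have "omega_neg p q \<theta> k l m =
      S.connection S.x (star (S3 p q \<theta>) S.x) (S.f' \<otimes>\<^bsub>S3 p q \<theta>\<^esub> S.y) (star (S3 p q \<theta>) S.y) m" for m
    by (induction m) (simp_all only: omega_neg.simps S.connection.simps Let_def alg_A_simps
      sphere_gens pow f[OF S.total_closed(8)[OF S.xyzw_total(3)]] S.f'_def)
  ultimately show ?thesis by (simp add: omega_def)
qed

lemma omega_line:
  assumes "(c, d) \<in> set (omega p q \<theta> k l n)" shows "c \<in> S.line (- n)" "d \<in> S.line n"
proof -
  have 1: "S.f \<otimes>\<^bsub>S3 p q \<theta>\<^esub> star (S3 p q \<theta>) S.y \<in> S.line (- 1)" "S.f' \<otimes>\<^bsub>S3 p q \<theta>\<^esub> S.y \<in> S.line 1"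
    using S.line_mult[OF S.f_line(1) S.xy_line(4)] S.line_mult[OF S.f_line(2) S.xy_line(2)] by auto
  have "c \<in> S.line (- n) \<and> d \<in> S.line n"
  proof (cases "n \<ge> 0")
    case True
    show ?thesis using assms True S.connection_line[of _ 1 _ _ _ c d "nat n"] S.xy_line 1
      by (auto simp: omega_eq)
  next
    case False
    show ?thesis using assms False S.connection_line[of _ "- 1" _ _ _ c d "nat (- n)"] S.xy_line 1
      by (auto simp: omega_eq)
  qed
  then show "c \<in> S.line (- n)" "d \<in> S.line n" by auto
qed

lemma line_carrier: "c \<in> S.line n \<Longrightarrow> c \<in> carrier (S3 p q \<theta>)"
  by (auto simp: S.line_eq intro: S.homogeneous_carrier)

lemma omega_counit: "S.list_sum (\<lambda>(c, d). c \<otimes>\<^bsub>S3 p q \<theta>\<^esub> d) (omega p q \<theta> k l n) = \<one>\<^bsub>S3 p q \<theta>\<^esub>"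
  using S.connection_counit[OF _ _ _ _ S.connection_pos_counit]
    S.connection_counit[OF _ _ _ _ S.connection_neg_counit] by (simp add: omega_eq)

lemma Tr_E_list_sum:
  "Tr_E p q \<theta> k l n = S.list_sum (\<lambda>(c, d). d \<otimes>\<^bsub>S3 p q \<theta>\<^esub> c) (omega p q \<theta> k l n)"
proof -
  let ?L = "omega p q \<theta> k l n"
  have nth: "snd (?L ! i) \<otimes>\<^bsub>S3 p q \<theta>\<^esub> fst (?L ! i) \<in> S.base" if "i < length ?L" for i
    using omega_line[of "fst (?L ! i)" "snd (?L ! i)" n] that
      S.line_mult[of "snd (?L ! i)" n "fst (?L ! i)" "- n"] by (simp add: S.line_0)
  have "Tr_E p q \<theta> k l n = (\<Oplus>\<^bsub>S3 p q \<theta>\<^esub>i\<in>{..<length ?L}. snd (?L ! i) \<otimes>\<^bsub>S3 p q \<theta>\<^esub> fst (?L ! i))"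
    unfolding Tr_E_def S2_eq E_matrix_def alg_A_simps
    by (rule S.finsum_subalgebra[OF S.base_subalgebra]) (use nth in auto)
  also have "\<dots> = S.list_sum (\<lambda>(c, d). d \<otimes>\<^bsub>S3 p q \<theta>\<^esub> c) ?L"
    using S.finsum_list_sum[of ?L "\<lambda>(c, d). d \<otimes>\<^bsub>S3 p q \<theta>\<^esub> c"] line_carrier[OF omega_line(1)]
      line_carrier[OF omega_line(2)] by (auto simp: split_def)
  finally show ?thesis .
qed

lemma Tr_E_poly:
  "S.poly_in S.z (Tr_E p q \<theta> k l n)
     (if n \<ge> 0 then (S.\<Phi> ^^ nat n) (\<lambda>_. 1) else (S.\<Phi>' ^^ nat (- n)) (\<lambda>_. 1))"
proof -
  let ?L = "omega p q \<theta> k l n"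
  have "Tr_E p q \<theta> k l n = S.list_sum (\<lambda>(c, d). d \<otimes>\<^bsub>S3 p q \<theta>\<^esub> \<one>\<^bsub>S3 p q \<theta>\<^esub> \<otimes>\<^bsub>S3 p q \<theta>\<^esub> c) ?L"
    unfolding Tr_E_list_sum using line_carrier[OF omega_line(2)[of _ _ n]]
    by (intro S.list_sum_cong) auto
  then show ?thesis
    using S.connection_trace[where n = "nat n", OF _ _ _ _ _ S.connection_pos_step S.poly_in_one]
      S.connection_trace[where n = "nat (- n)", OF _ _ _ _ _ S.connection_neg_step S.poly_in_one]
    by (simp add: omega_eq)
qed

lemma line_bundle_free_trace:
  assumes \<tau>: "\<And>s t. s \<in> S.base \<Longrightarrow> t \<in> S.base \<Longrightarrow> \<tau> (s \<oplus>\<^bsub>S3 p q \<theta>\<^esub> t) = \<tau> s + \<tau> t"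
      "\<And>s t. s \<in> S.base \<Longrightarrow> t \<in> S.base \<Longrightarrow> \<tau> (s \<otimes>\<^bsub>S3 p q \<theta>\<^esub> t) = \<tau> (t \<otimes>\<^bsub>S3 p q \<theta>\<^esub> s)"
      "\<tau> \<one>\<^bsub>S3 p q \<theta>\<^esub> = (0 :: complex)"
    and free: "free_left_module (S2 p q \<theta> k l) (line_bundle p q \<theta> k l n)"
  shows "\<tau> (Tr_E p q \<theta> k l n) = 0"
  unfolding Tr_E_list_sum
  by (rule S.free_line_trace_zero[of _ n]) (use omega_line omega_counit \<tau> free in \<open>auto simp: S2_eq line_bundle_eq\<close>)

end


section \<open>Operators on square-summable sequences\<close>

text \<open>The estimate \<open>(s + t)\<^sup>2 \<le> 2 s\<^sup>2 + 2 t\<^sup>2\<close> yields boundedness of sums of operators without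
  Minkowski's inequality.\<close>

lemma ell2_add:
  assumes "v \<in> ell2" "w \<in> ell2"
  shows "(\<lambda>i. v i + w i) \<in> ell2"
    and ell2_add_bound: "(\<Sum>\<^sub>\<infinity>i. (cmod (v i + w i))\<^sup>2) \<le> 2 * (\<Sum>\<^sub>\<infinity>i. (cmod (v i))\<^sup>2) + 2 * (\<Sum>\<^sub>\<infinity>i. (cmod (w i))\<^sup>2)"
proof -
  have b: "(cmod (v i + w i))\<^sup>2 \<le> 2 * (cmod (v i))\<^sup>2 + 2 * (cmod (w i))\<^sup>2" for i
  proof -
    have "(cmod (v i + w i))\<^sup>2 \<le> (cmod (v i) + cmod (w i))\<^sup>2"
      by (intro power_mono norm_triangle_ineq) simp
    also have "\<dots> \<le> 2 * (cmod (v i))\<^sup>2 + 2 * (cmod (w i))\<^sup>2"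
      using sum_squares_bound[of "cmod (v i)" "cmod (w i)"] by (simp add: power2_sum)
    finally show ?thesis .
  qed
  have s: "(\<lambda>i. 2 * (cmod (v i))\<^sup>2) summable_on UNIV" "(\<lambda>i. 2 * (cmod (w i))\<^sup>2) summable_on UNIV"
    using assms by (auto simp: ell2_def intro!: summable_on_cmult_right)
  have s': "(\<lambda>i. (cmod (v i + w i))\<^sup>2) summable_on UNIV"
    by (rule summable_on_comparison_test[OF summable_on_add[OF s]]) (use b in auto)
  then show "(\<lambda>i. v i + w i) \<in> ell2" by (simp add: ell2_def)
  have "(\<Sum>\<^sub>\<infinity>i. (cmod (v i + w i))\<^sup>2) \<le> (\<Sum>\<^sub>\<infinity>i. 2 * (cmod (v i))\<^sup>2 + 2 * (cmod (w i))\<^sup>2)"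
    by (rule infsum_mono[OF s' summable_on_add[OF s]]) (use b in auto)
  then show "(\<Sum>\<^sub>\<infinity>i. (cmod (v i + w i))\<^sup>2) \<le> 2 * (\<Sum>\<^sub>\<infinity>i. (cmod (v i))\<^sup>2) + 2 * (\<Sum>\<^sub>\<infinity>i. (cmod (w i))\<^sup>2)"
    using infsum_add[OF s] by (simp add: infsum_cmult_right')
qed

lemma ell2_scale: "v \<in> ell2 \<Longrightarrow> (\<lambda>i. c * v i) \<in> ell2"
  by (auto simp: ell2_def norm_mult power_mult_distrib intro!: summable_on_cmult_right)

lemma ell2_norm_scale: "ell2_norm (\<lambda>i. c * v i) = cmod c * ell2_norm v"
  by (simp add: ell2_norm_def norm_mult power_mult_distrib infsum_cmult_right' real_sqrt_mult)

lemma ell2_norm_nonneg [simp]: "ell2_norm v \<ge> 0"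
  by (simp add: ell2_norm_def infsum_nonneg)

lemma ell2_norm_square: "(ell2_norm v)\<^sup>2 = (\<Sum>\<^sub>\<infinity>i. (cmod (v i))\<^sup>2)"
  by (simp add: ell2_norm_def infsum_nonneg)

lemma basis_vec_ell2 [simp]: "basis_vec m \<in> ell2"
proof -
  have "(\<lambda>i. (cmod (basis_vec m i))\<^sup>2) summable_on {m}" by simp
  then have "(\<lambda>i. (cmod (basis_vec m i))\<^sup>2) summable_on UNIV"
    by (rule summable_on_cong_neutral[THEN iffD1, rotated -1]) (auto simp: basis_vec_def)
  then show ?thesis by (simp add: ell2_def)
qed

lemma ell2_inner_summable:
  assumes "v \<in> ell2" "w \<in> ell2"
  shows "(\<lambda>i. cnj (v i) * w i) summable_on UNIV"
proof -
  have S: "(\<lambda>i. (cmod (v i))\<^sup>2 + (cmod (w i))\<^sup>2) summable_on UNIV"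
    using assms by (auto simp: ell2_def intro: summable_on_add)
  have B: "norm (cnj (v i) * w i) \<le> (cmod (v i))\<^sup>2 + (cmod (w i))\<^sup>2" for i
  proof -
    have "2 * (cmod (v i) * cmod (w i)) \<le> (cmod (v i))\<^sup>2 + (cmod (w i))\<^sup>2"
      using sum_squares_bound[of "cmod (v i)" "cmod (w i)"] by simp
    moreover have "0 \<le> cmod (v i) * cmod (w i)" by simp
    ultimately have "cmod (v i) * cmod (w i) \<le> (cmod (v i))\<^sup>2 + (cmod (w i))\<^sup>2" by linarith
    then show ?thesis by (simp add: norm_mult)
  qed
  have "(\<lambda>i. norm (cnj (v i) * w i)) summable_on UNIV"
    by (rule Infinite_Sum.abs_summable_on_comparison_test'[OF S]) (rule B)
  then show ?thesis by (rule abs_summable_summable)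
qed

lemma ell2_inner_basis_left [simp]: "ell2_inner (basis_vec m) w = w m"
proof -
  have "ell2_inner (basis_vec m) w = (\<Sum>\<^sub>\<infinity>i\<in>{m}. w i)"
    unfolding ell2_inner_def by (rule infsum_cong_neutral) (auto simp: basis_vec_def)
  then show ?thesis by simp
qed

lemma ell2_inner_basis_right [simp]: "ell2_inner v (basis_vec m) = cnj (v m)"
proof -
  have "ell2_inner v (basis_vec m) = (\<Sum>\<^sub>\<infinity>i\<in>{m}. cnj (v i))"
    unfolding ell2_inner_def by (rule infsum_cong_neutral) (auto simp: basis_vec_def)
  then show ?thesis by simp
qed

text \<open>A relation instead of an adjoint operation, since the operators below are defined on all sequences
  and are determined by adjoints only on the square-summable ones.\<close>

definition adjoint_pair :: "(vec \<Rightarrow> vec) \<Rightarrow> (vec \<Rightarrow> vec) \<Rightarrow> bool" where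
  "adjoint_pair T U \<longleftrightarrow> (\<forall>v\<in>ell2. \<forall>w\<in>ell2. ell2_inner (U v) w = ell2_inner v (T w))"

lemma bounded_operator_ell2: "bounded_operator T \<Longrightarrow> v \<in> ell2 \<Longrightarrow> T v \<in> ell2"
  by (simp add: bounded_operator_def)

lemma bounded_operatorI:
  assumes "\<And>v. v \<in> ell2 \<Longrightarrow> T v \<in> ell2"
    "\<And>v w. v \<in> ell2 \<Longrightarrow> w \<in> ell2 \<Longrightarrow> T (\<lambda>i. v i + w i) = (\<lambda>i. T v i + T w i)"
    "\<And>c v. v \<in> ell2 \<Longrightarrow> T (\<lambda>i. c * v i) = (\<lambda>i. c * T v i)"
    "\<And>v. v \<in> ell2 \<Longrightarrow> ell2_norm (T v) \<le> K * ell2_norm v"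
  shows "bounded_operator T"
  using assms unfolding bounded_operator_def by blast

lemma bounded_operatorD:
  assumes "bounded_operator T"
  shows "v \<in> ell2 \<Longrightarrow> T v \<in> ell2"
    "v \<in> ell2 \<Longrightarrow> w \<in> ell2 \<Longrightarrow> T (\<lambda>i. v i + w i) = (\<lambda>i. T v i + T w i)"
    "v \<in> ell2 \<Longrightarrow> T (\<lambda>i. c * v i) = (\<lambda>i. c * T v i)"
  using assms unfolding bounded_operator_def by blast+

lemma bounded_operator_compose:
  assumes "bounded_operator T" "bounded_operator U"
  shows "bounded_operator (\<lambda>v. T (U v))"
proof -
  obtain K where K: "\<And>v. v \<in> ell2 \<Longrightarrow> ell2_norm (T v) \<le> K * ell2_norm v"
    using assms(1) unfolding bounded_operator_def by blast
  obtain L where L: "\<And>v. v \<in> ell2 \<Longrightarrow> ell2_norm (U v) \<le> L * ell2_norm v"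
    using assms(2) unfolding bounded_operator_def by blast
  have "ell2_norm (T (U v)) \<le> (\<bar>K\<bar> * \<bar>L\<bar>) * ell2_norm v" if v: "v \<in> ell2" for v
  proof -
    have "ell2_norm (T (U v)) \<le> K * ell2_norm (U v)" using K assms(2) v by (simp add: bounded_operator_def)
    also have "\<dots> \<le> \<bar>K\<bar> * ell2_norm (U v)" by (intro mult_right_mono) auto
    also have "\<dots> \<le> \<bar>K\<bar> * (\<bar>L\<bar> * ell2_norm v)"
    proof (intro mult_left_mono)
      have "ell2_norm (U v) \<le> L * ell2_norm v" by (rule L[OF v])
      also have "\<dots> \<le> \<bar>L\<bar> * ell2_norm v" by (intro mult_right_mono) auto
      finally show "ell2_norm (U v) \<le> \<bar>L\<bar> * ell2_norm v" .
    qed simp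
    finally show ?thesis by (simp add: mult.assoc)
  qed
  then show ?thesis using assms unfolding bounded_operator_def by auto
qed

lemma bounded_operator_add:
  assumes "bounded_operator T" "bounded_operator U"
  shows "bounded_operator (\<lambda>v i. T v i + U v i)"
proof -
  obtain K where K: "\<And>v. v \<in> ell2 \<Longrightarrow> ell2_norm (T v) \<le> K * ell2_norm v"
    using assms(1) unfolding bounded_operator_def by blast
  obtain L where L: "\<And>v. v \<in> ell2 \<Longrightarrow> ell2_norm (U v) \<le> L * ell2_norm v"
    using assms(2) unfolding bounded_operator_def by blast
  have "ell2_norm (\<lambda>i. T v i + U v i) \<le> sqrt (2 * K\<^sup>2 + 2 * L\<^sup>2) * ell2_norm v" if v: "v \<in> ell2" for v
  proof -
    have "(ell2_norm (\<lambda>i. T v i + U v i))\<^sup>2 \<le> 2 * (ell2_norm (T v))\<^sup>2 + 2 * (ell2_norm (U v))\<^sup>2"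
      unfolding ell2_norm_square
      by (rule ell2_add_bound) (use assms v in \<open>auto simp: bounded_operator_def\<close>)
    also have "\<dots> \<le> 2 * (K * ell2_norm v)\<^sup>2 + 2 * (L * ell2_norm v)\<^sup>2"
      using K[OF v] L[OF v] by (intro add_mono mult_left_mono power_mono) auto
    also have "\<dots> = (sqrt (2 * K\<^sup>2 + 2 * L\<^sup>2) * ell2_norm v)\<^sup>2"
      by (simp add: power_mult_distrib algebra_simps)
    finally show ?thesis by (rule power2_le_imp_le) simp
  qed
  then show ?thesis
    by (intro bounded_operatorI[of _ "sqrt (2 * K\<^sup>2 + 2 * L\<^sup>2)"])
      (use bounded_operatorD[OF assms(1)] bounded_operatorD[OF assms(2)] in
        \<open>auto simp: ell2_add algebra_simps\<close>)
qed

lemma bounded_operator_scale: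
  assumes "bounded_operator T"
  shows "bounded_operator (\<lambda>v i. c * T v i)"
proof -
  obtain K where K: "\<And>v. v \<in> ell2 \<Longrightarrow> ell2_norm (T v) \<le> K * ell2_norm v"
    using assms unfolding bounded_operator_def by blast
  have "ell2_norm (\<lambda>i. c * T v i) \<le> (cmod c * K) * ell2_norm v" if "v \<in> ell2" for v
    using K[OF that] by (simp add: ell2_norm_scale mult_left_mono mult.assoc)
  then show ?thesis
    by (intro bounded_operatorI[of _ "cmod c * K"])
      (use bounded_operatorD[OF assms] in \<open>auto simp: ell2_scale algebra_simps\<close>)
qed

lemma adjoint_pair_compose:
  assumes "adjoint_pair T T'" "adjoint_pair U U'" "bounded_operator T'" "bounded_operator U"
  shows "adjoint_pair (\<lambda>v. T (U v)) (\<lambda>v. U' (T' v))"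
  using assms by (simp add: adjoint_pair_def bounded_operator_def)

lemma adjoint_pair_add:
  assumes "adjoint_pair T T'" "adjoint_pair U U'" "bounded_operator T" "bounded_operator U"
    "bounded_operator T'" "bounded_operator U'"
  shows "adjoint_pair (\<lambda>v i. T v i + U v i) (\<lambda>v i. T' v i + U' v i)"
  unfolding adjoint_pair_def
proof (intro ballI)
  fix v w assume vw: "v \<in> ell2" "w \<in> ell2"
  have "ell2_inner (\<lambda>i. T' v i + U' v i) w = ell2_inner (T' v) w + ell2_inner (U' v) w"
    unfolding ell2_inner_def
    using infsum_add[OF ell2_inner_summable[OF bounded_operator_ell2[OF assms(5) vw(1)] vw(2)]
        ell2_inner_summable[OF bounded_operator_ell2[OF assms(6) vw(1)] vw(2)]]
    by (simp add: algebra_simps)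
  also have "\<dots> = ell2_inner v (T w) + ell2_inner v (U w)"
    using assms(1,2) vw by (simp add: adjoint_pair_def)
  also have "\<dots> = ell2_inner v (\<lambda>i. T w i + U w i)"
    unfolding ell2_inner_def
    using infsum_add[OF ell2_inner_summable[OF vw(1) bounded_operator_ell2[OF assms(3) vw(2)]]
        ell2_inner_summable[OF vw(1) bounded_operator_ell2[OF assms(4) vw(2)]]]
    by (simp add: algebra_simps)
  finally show "ell2_inner (\<lambda>i. T' v i + U' v i) w = ell2_inner v (\<lambda>i. T w i + U w i)" .
qed

lemma adjoint_pair_scale:
  assumes "adjoint_pair T T'"
  shows "adjoint_pair (\<lambda>v i. c * T v i) (\<lambda>v i. cnj c * T' v i)"
  using assms unfolding adjoint_pair_def ell2_inner_def
  by (simp add: infsum_cmult_right'[symmetric] algebra_simps)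
    (simp add: mult.left_commute[of _ c] infsum_cmult_right')


subsection \<open>Weighted substitution operators\<close>

definition wsub :: "(int \<Rightarrow> complex) \<Rightarrow> (int \<Rightarrow> int) \<Rightarrow> vec \<Rightarrow> vec" where
  "wsub g h v = (\<lambda>i. g i * v (h i))"

lemma bounded_operator_wsub:
  assumes g: "\<And>i. cmod (g i) \<le> K" and h: "inj_on h {i. g i \<noteq> 0}"
  shows "bounded_operator (wsub g h)"
proof -
  have K: "K \<ge> 0" using g[of 0] norm_ge_zero order_trans by blast
  let ?D = "{i. g i \<noteq> 0}"
  have *: "(\<lambda>i. (cmod (wsub g h v i))\<^sup>2) summable_on UNIV \<and>
      (\<Sum>\<^sub>\<infinity>i. (cmod (wsub g h v i))\<^sup>2) \<le> K\<^sup>2 * (\<Sum>\<^sub>\<infinity>i. (cmod (v i))\<^sup>2)" if v: "v \<in> ell2" for v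
  proof -
    have s: "(\<lambda>i. (cmod (v i))\<^sup>2) summable_on UNIV" using v by (simp add: ell2_def)
    have s1: "(\<lambda>i. (cmod (v i))\<^sup>2) summable_on h ` ?D" by (rule summable_on_subset_banach[OF s]) simp
    have s2: "(\<lambda>i. (cmod (v (h i)))\<^sup>2) summable_on ?D"
      using s1 summable_on_reindex[OF h, of "\<lambda>i. (cmod (v i))\<^sup>2"] by (simp add: comp_def)
    have b: "(cmod (wsub g h v i))\<^sup>2 \<le> K\<^sup>2 * (cmod (v (h i)))\<^sup>2" for i
      unfolding wsub_def norm_mult power_mult_distrib using g[of i] by (intro mult_right_mono power_mono) auto
    have s3: "(\<lambda>i. (cmod (wsub g h v i))\<^sup>2) summable_on ?D"
      by (rule summable_on_comparison_test[OF summable_on_cmult_right[OF s2, of "K\<^sup>2"]]) (use b in auto)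
    have s4: "(\<lambda>i. (cmod (wsub g h v i))\<^sup>2) summable_on UNIV"
      using s3 by (rule summable_on_cong_neutral[THEN iffD1, rotated -1]) (auto simp: wsub_def)
    have "(\<Sum>\<^sub>\<infinity>i. (cmod (wsub g h v i))\<^sup>2) = (\<Sum>\<^sub>\<infinity>i\<in>?D. (cmod (wsub g h v i))\<^sup>2)"
      by (rule infsum_cong_neutral) (auto simp: wsub_def)
    also have "\<dots> \<le> (\<Sum>\<^sub>\<infinity>i\<in>?D. K\<^sup>2 * (cmod (v (h i)))\<^sup>2)"
      by (rule infsum_mono[OF s3 summable_on_cmult_right[OF s2]]) (rule b)
    also have "\<dots> = K\<^sup>2 * (\<Sum>\<^sub>\<infinity>i\<in>h ` ?D. (cmod (v i))\<^sup>2)"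
      using infsum_reindex[OF h, of "\<lambda>i. (cmod (v i))\<^sup>2"] by (simp add: infsum_cmult_right' comp_def)
    also have "\<dots> \<le> K\<^sup>2 * (\<Sum>\<^sub>\<infinity>i. (cmod (v i))\<^sup>2)"
      by (intro mult_left_mono infsum_mono_neutral s s1) auto
    finally show ?thesis using s4 by blast
  qed
  have "ell2_norm (wsub g h v) \<le> K * ell2_norm v" if "v \<in> ell2" for v
  proof -
    have "(ell2_norm (wsub g h v))\<^sup>2 \<le> (K * ell2_norm v)\<^sup>2"
      using *[OF that] by (simp add: ell2_norm_square power_mult_distrib)
    then show ?thesis by (rule power2_le_imp_le) (simp add: K)
  qed
  moreover have "\<forall>v\<in>ell2. wsub g h v \<in> ell2" using * by (auto simp: ell2_def)
  ultimately show ?thesis unfolding bounded_operator_def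
    by (auto simp: wsub_def algebra_simps)
qed

text \<open>Where the weights do not vanish, the two index maps are inverse to each other, so the two inner
  products are the same sum in different order.\<close>

lemma adjoint_pair_wsub:
  assumes "\<And>i. g i \<noteq> 0 \<Longrightarrow> h' (h i) = i \<and> g' (h i) = cnj (g i)"
    and "\<And>j. g' j \<noteq> 0 \<Longrightarrow> h (h' j) = j \<and> g (h' j) = cnj (g' j)"
  shows "adjoint_pair (wsub g h) (wsub g' h')"
  unfolding adjoint_pair_def
proof (intro ballI)
  fix v w
  have bij: "bij_betw h {i. g i \<noteq> 0} {j. g' j \<noteq> 0}"
    by (rule bij_betw_byWitness[of _ h']) (use assms in \<open>auto simp: complex_cnj_zero_iff\<close>)
  have "ell2_inner (wsub g' h' v) w = (\<Sum>\<^sub>\<infinity>j\<in>{j. g' j \<noteq> 0}. cnj (g' j * v (h' j)) * w j)"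
    unfolding ell2_inner_def wsub_def by (rule infsum_cong_neutral) auto
  also have "\<dots> = (\<Sum>\<^sub>\<infinity>i\<in>{i. g i \<noteq> 0}. cnj (g' (h i) * v (h' (h i))) * w (h i))"
    by (rule infsum_reindex_bij_betw[OF bij, symmetric])
  also have "\<dots> = (\<Sum>\<^sub>\<infinity>i\<in>{i. g i \<noteq> 0}. cnj (v i) * (g i * w (h i)))"
    by (rule infsum_cong) (use assms(1) in auto)
  also have "\<dots> = ell2_inner v (wsub g h w)"
    unfolding ell2_inner_def wsub_def by (rule infsum_cong_neutral) auto
  finally show "ell2_inner (wsub g' h' v) w = ell2_inner v (wsub g h w)" .
qed


subsection \<open>Monoid algebras acting on sequences\<close>

text \<open>A linear action of a monoid on sequences extends to its monoid algebra. This covers words acting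
  by products of operators, and integers acting by shifts. All sequences are admitted, so that no
  convergence enters.\<close>

locale sequence_action =
  fixes \<phi> :: "'m::monoid_add \<Rightarrow> vec \<Rightarrow> vec"
  assumes \<phi>_zero: "\<phi> 0 v = v" and \<phi>_plus: "\<phi> (m + n) v = \<phi> m (\<phi> n v)"
    and \<phi>_add: "\<phi> m (\<lambda>i. v i + w i) = (\<lambda>i. \<phi> m v i + \<phi> m w i)"
    and \<phi>_scale: "\<phi> m (\<lambda>i. c * v i) = (\<lambda>i. c * \<phi> m v i)"
begin

definition act :: "('m \<Rightarrow>\<^sub>0 complex) \<Rightarrow> vec \<Rightarrow> vec" where
  "act f v = (\<lambda>i. \<Sum>m\<in>Poly_Mapping.keys f. poly_mapping.lookup f m * \<phi> m v i)"

lemma act_superset: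
  "finite S \<Longrightarrow> Poly_Mapping.keys f \<subseteq> S \<Longrightarrow> act f v i = (\<Sum>m\<in>S. poly_mapping.lookup f m * \<phi> m v i)"
  unfolding act_def by (rule sum.mono_neutral_left) (auto simp: in_keys_iff)

lemma act_single [simp]: "act (Poly_Mapping.single m c) v = (\<lambda>i. c * \<phi> m v i)"
  by (rule ext, subst act_superset[of "{m}"]) (auto simp: lookup_single)

lemma act_add: "act (f + g) v = (\<lambda>i. act f v i + act g v i)"
proof
  fix i
  let ?S = "Poly_Mapping.keys f \<union> Poly_Mapping.keys g"
  have "act (f + g) v i = (\<Sum>m\<in>?S. poly_mapping.lookup (f + g) m * \<phi> m v i)"
    by (rule act_superset) (auto simp: keys_add)
  also have "\<dots> = act f v i + act g v i"
    by (simp add: act_superset[of ?S] lookup_add distrib_right sum.distrib)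
  finally show "act (f + g) v i = act f v i + act g v i" .
qed

lemma act_add_right: "act f (\<lambda>i. v i + w i) = (\<lambda>i. act f v i + act f w i)"
  by (simp add: act_def \<phi>_add distrib_left sum.distrib)

lemma act_scale_right: "act f (\<lambda>i. c * v i) = (\<lambda>i. c * act f v i)"
  by (simp add: act_def \<phi>_scale sum_distrib_left mult.left_commute)

lemma act_mult: "act (f * g) v = act f (act g v)"
proof (induction f rule: poly_mapping_induct_single)
  case (1 m c)
  show ?case
    by (induction g rule: poly_mapping_induct_single)
      (simp_all add: mult_single \<phi>_plus \<phi>_scale distrib_left act_add \<phi>_add mult.assoc)
next
  case (2 f f')
  then show ?case by (simp add: distrib_right act_add)
qed

lemma act_scal_mult: "act (Poly_Mapping.single 0 c * f) v = (\<lambda>i. c * act f v i)"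
  by (simp add: act_mult \<phi>_zero)

lemma act_one [simp]: "act 1 v = v"
  using act_single[of 0 1 v] by (simp add: \<phi>_zero)

lemma act_zero [simp]: "act 0 v = (\<lambda>i. 0)"
  by (simp add: act_def)

lemma act_uminus: "act (- f) v = (\<lambda>i. - act f v i)"
  by (simp add: act_def sum_negf)

lemma act_diff: "act (f - g) v = (\<lambda>i. act f v i - act g v i)"
  using act_add[of f "- g" v] by (simp add: act_uminus)

lemma bounded_act:
  assumes "\<And>m. bounded_operator (\<phi> m)" shows "bounded_operator (act f)"
proof (induction f rule: poly_mapping_induct_single)
  case (1 w c)
  have "act (Poly_Mapping.single w c) = (\<lambda>v i. c * \<phi> w v i)" by (simp add: fun_eq_iff)
  then show ?case using bounded_operator_scale[OF assms] by simp
next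
  case (2 f g)
  have "act (f + g) = (\<lambda>v i. act f v i + act g v i)" by (simp add: fun_eq_iff act_add)
  then show ?case using bounded_operator_add[OF 2] by simp
qed

lemma adjoint_act:
  assumes bounded: "\<And>m. bounded_operator (\<phi> m)" and adj: "\<And>m. adjoint_pair (\<phi> m) (\<phi> (\<iota> m))"
    and st: "\<And>m c. st (Poly_Mapping.single m c) = Poly_Mapping.single (\<iota> m) (cnj c)"
      "\<And>f g. st (f + g) = st f + st g"
  shows "adjoint_pair (act f) (act (st f))"
proof (induction f rule: poly_mapping_induct_single)
  case (1 w c)
  have "act (Poly_Mapping.single w c) = (\<lambda>v i. c * \<phi> w v i)" for w c by (simp add: fun_eq_iff)
  then show ?case using adjoint_pair_scale[OF adj] by (simp add: st)
next
  case (2 f g)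
  have "act (f + g) = (\<lambda>v i. act f v i + act g v i)" for f g by (simp add: fun_eq_iff act_add)
  then show ?case using adjoint_pair_add[OF 2] bounded_act[OF bounded] by (simp add: st)
qed

end


section \<open>Toeplitz operators and rapidly decaying perturbations\<close>

definition shift :: "int \<Rightarrow> vec \<Rightarrow> vec" where
  "shift d v = (\<lambda>i. v (i - d))"

interpretation shift: sequence_action shift
  by unfold_locales (auto simp: shift_def algebra_simps)

abbreviation toeplitz :: "(int \<Rightarrow>\<^sub>0 complex) \<Rightarrow> vec \<Rightarrow> vec" where
  "toeplitz \<equiv> shift.act"

lemma shift_wsub: "shift d = wsub (\<lambda>_. 1) (\<lambda>i. i - d)"
  by (simp add: shift_def wsub_def fun_eq_iff)

lemma bounded_shift: "bounded_operator (shift d)"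
  unfolding shift_wsub by (rule bounded_operator_wsub[of _ 1]) (auto intro: inj_onI)

lemma adjoint_shift: "adjoint_pair (shift d) (shift (- d))"
  unfolding shift_wsub by (rule adjoint_pair_wsub) auto

definition laurent_star :: "(int \<Rightarrow>\<^sub>0 complex) \<Rightarrow> int \<Rightarrow>\<^sub>0 complex" where
  "laurent_star T = Poly_Mapping.map_key uminus (Poly_Mapping.map cnj T)"

lemma lookup_laurent_star: "poly_mapping.lookup (laurent_star T) d = cnj (poly_mapping.lookup T (- d))"
proof -
  have "poly_mapping.lookup (Poly_Mapping.map cnj T) d = cnj (poly_mapping.lookup T d)" for d
    by (simp add: Poly_Mapping.map.rep_eq when_def)
  moreover have "inj (uminus :: int \<Rightarrow> int)" by (simp add: inj_def)
  ultimately show ?thesis by (simp add: laurent_star_def map_key.rep_eq)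
qed

lemma laurent_star_single: "laurent_star (Poly_Mapping.single d c) = Poly_Mapping.single (- d) (cnj c)"
  by (intro poly_mapping_eqI) (auto simp: lookup_laurent_star lookup_single when_def)

lemma laurent_star_add: "laurent_star (T + U) = laurent_star T + laurent_star U"
  by (intro poly_mapping_eqI) (simp add: lookup_laurent_star lookup_add)

lemma laurent_star_star [simp]: "laurent_star (laurent_star T) = T"
  by (intro poly_mapping_eqI) (simp add: lookup_laurent_star)

lemma laurent_star_mult: "laurent_star (T * U) = laurent_star T * laurent_star U"
proof (induction T rule: poly_mapping_induct_single)
  case (1 m c)
  show ?case
    by (induction U rule: poly_mapping_induct_single)
      (simp_all add: mult_single laurent_star_single distrib_left laurent_star_add)
qed (simp add: laurent_star_add distrib_right)

lemma adjoint_toeplitz: "adjoint_pair (toeplitz T) (toeplitz (laurent_star T))"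
  using bounded_shift adjoint_shift laurent_star_single laurent_star_add by (rule shift.adjoint_act)

lemma bounded_toeplitz: "bounded_operator (toeplitz T)"
  using bounded_shift by (rule shift.bounded_act)

lemma toeplitz_basis: "toeplitz T (basis_vec m) i = poly_mapping.lookup T (i - m)"
proof -
  have "toeplitz T (basis_vec m) i = (\<Sum>d\<in>Poly_Mapping.keys T. if d = i - m then poly_mapping.lookup T d else 0)"
    unfolding shift.act_def by (intro sum.cong) (auto simp: shift_def basis_vec_def)
  then show ?thesis by (simp add: in_keys_iff)
qed

locale decay =
  fixes r :: real
  assumes r: "0 < r" "r < 1"
begin

definition \<omega> :: "int \<Rightarrow> real" where "\<omega> i = r ^ nat \<bar>i\<bar>"

lemma \<omega>_pos [simp]: "\<omega> i > 0" using r by (simp add: \<omega>_def)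

lemma \<omega>_nonneg [simp]: "\<omega> i \<ge> 0" using \<omega>_pos[of i] by linarith

lemma \<omega>_le_1: "\<omega> i \<le> 1" using r by (simp add: \<omega>_def power_le_one)

lemma \<omega>_shift: "\<omega> (i - d) \<le> \<omega> i / \<omega> d"
proof -
  have "nat \<bar>i\<bar> \<le> nat \<bar>i - d\<bar> + nat \<bar>d\<bar>" by linarith
  then have "r ^ (nat \<bar>i - d\<bar> + nat \<bar>d\<bar>) \<le> r ^ nat \<bar>i\<bar>" using r by (intro power_decreasing) auto
  then show ?thesis using r by (simp add: \<omega>_def power_add field_simps)
qed

lemma \<omega>_summable: "\<omega> summable_on UNIV"
proof -
  have g: "(\<lambda>n. r ^ n) summable_on (UNIV :: nat set)"
    using r by (intro norm_summable_imp_summable_on) (simp add: summable_geometric)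
  have *: "\<omega> summable_on range (\<lambda>n::nat. e * int n)" if "\<bar>e\<bar> = 1" for e
  proof -
    have "inj (\<lambda>n::nat. e * int n)" using that by (auto simp: inj_def)
    then show ?thesis using g that
      by (subst summable_on_reindex) (auto simp: comp_def \<omega>_def abs_mult)
  qed
  have "\<omega> summable_on (range (\<lambda>n::nat. 1 * int n) \<union> range (\<lambda>n::nat. - 1 * int n))"
    by (rule summable_on_union; rule *) auto
  also have "range (\<lambda>n::nat. 1 * int n) \<union> range (\<lambda>n::nat. - 1 * int n) = UNIV"
    by (auto simp: image_iff) (metis int_cases2)
  finally show ?thesis .
qed

text \<open>A rapid operator maps sequences of at most exponential growth to sequences of exponential
  decay; being defined by bounds on all such sequences, this notion is stable under composition
  without any discussion of convergence.\<close>

definition rapid :: "(vec \<Rightarrow> vec) \<Rightarrow> bool" where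
  "rapid D \<longleftrightarrow> (\<exists>K\<ge>0. \<forall>v B. (\<forall>j. \<omega> j * cmod (v j) \<le> B) \<longrightarrow> (\<forall>i. cmod (D v i) \<le> K * B * \<omega> i))"

definition tame :: "(vec \<Rightarrow> vec) \<Rightarrow> bool" where
  "tame T \<longleftrightarrow> (\<exists>K\<ge>0. \<forall>v B. (\<forall>j. \<omega> j * cmod (v j) \<le> B) \<longrightarrow> (\<forall>i. \<omega> i * cmod (T v i) \<le> K * B))"

lemma bound_nonneg: "(\<forall>j. \<omega> j * cmod (v j) \<le> B) \<Longrightarrow> B \<ge> 0"
  by (metis \<omega>_nonneg mult_nonneg_nonneg norm_ge_zero order_trans)

lemma rapid_add: assumes "rapid D" "rapid E" shows "rapid (\<lambda>v i. D v i + E v i)"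
proof -
  obtain K where K: "K \<ge> 0" "\<And>v B i. (\<forall>j. \<omega> j * cmod (v j) \<le> B) \<Longrightarrow> cmod (D v i) \<le> K * B * \<omega> i"
    using assms(1) unfolding rapid_def by blast
  obtain L where L: "L \<ge> 0" "\<And>v B i. (\<forall>j. \<omega> j * cmod (v j) \<le> B) \<Longrightarrow> cmod (E v i) \<le> L * B * \<omega> i"
    using assms(2) unfolding rapid_def by blast
  have "cmod (D v i + E v i) \<le> (K + L) * B * \<omega> i" if "\<forall>j. \<omega> j * cmod (v j) \<le> B" for v B i
    using norm_triangle_ineq[of "D v i" "E v i"] K(2)[OF that, of i] L(2)[OF that, of i]
    by (simp add: algebra_simps)
  then show ?thesis unfolding rapid_def using K(1) L(1) by (intro exI[of _ "K + L"]) auto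
qed

lemma rapid_scale: assumes "rapid D" shows "rapid (\<lambda>v i. c * D v i)"
proof -
  obtain K where K: "K \<ge> 0" "\<And>v B i. (\<forall>j. \<omega> j * cmod (v j) \<le> B) \<Longrightarrow> cmod (D v i) \<le> K * B * \<omega> i"
    using assms(1) unfolding rapid_def by blast
  have "cmod (c * D v i) \<le> (cmod c * K) * B * \<omega> i" if "\<forall>j. \<omega> j * cmod (v j) \<le> B" for v B i
    using mult_left_mono[OF K(2)[OF that, of i], of "cmod c"] by (simp add: norm_mult mult.assoc)
  then show ?thesis unfolding rapid_def using K(1) by (intro exI[of _ "cmod c * K"]) auto
qed

lemma rapid_tame: assumes "rapid D" "tame T" shows "rapid (\<lambda>v. D (T v))"
proof -
  obtain K where K: "K \<ge> 0" "\<And>v B i. (\<forall>j. \<omega> j * cmod (v j) \<le> B) \<Longrightarrow> cmod (D v i) \<le> K * B * \<omega> i"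
    using assms(1) unfolding rapid_def by blast
  obtain L where L: "L \<ge> 0" "\<And>v B i. (\<forall>j. \<omega> j * cmod (v j) \<le> B) \<Longrightarrow> \<omega> i * cmod (T v i) \<le> L * B"
    using assms(2) unfolding tame_def by blast
  have "cmod (D (T v) i) \<le> (K * L) * B * \<omega> i" if "\<forall>j. \<omega> j * cmod (v j) \<le> B" for v B i
    using K(2)[of "T v" "L * B" i] L(2)[OF that] by (simp add: mult.assoc)
  then show ?thesis unfolding rapid_def using K(1) L(1) by (intro exI[of _ "K * L"]) auto
qed

lemma tame_add: assumes "tame D" "tame E" shows "tame (\<lambda>v i. D v i + E v i)"
proof -
  obtain K where K: "K \<ge> 0" "\<And>v B i. (\<forall>j. \<omega> j * cmod (v j) \<le> B) \<Longrightarrow> \<omega> i * cmod (D v i) \<le> K * B"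
    using assms(1) unfolding tame_def by blast
  obtain L where L: "L \<ge> 0" "\<And>v B i. (\<forall>j. \<omega> j * cmod (v j) \<le> B) \<Longrightarrow> \<omega> i * cmod (E v i) \<le> L * B"
    using assms(2) unfolding tame_def by blast
  have "\<omega> i * cmod (D v i + E v i) \<le> (K + L) * B" if "\<forall>j. \<omega> j * cmod (v j) \<le> B" for v B i
    using mult_left_mono[OF norm_triangle_ineq[of "D v i" "E v i"], of "\<omega> i"] K(2)[OF that, of i] L(2)[OF that, of i]
    by (simp add: algebra_simps)
  then show ?thesis unfolding tame_def using K(1) L(1) by (intro exI[of _ "K + L"]) auto
qed

lemma tame_rapid: assumes "rapid D" shows "tame D"
proof -
  obtain K where K: "K \<ge> 0" "\<And>v B i. (\<forall>j. \<omega> j * cmod (v j) \<le> B) \<Longrightarrow> cmod (D v i) \<le> K * B * \<omega> i"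
    using assms(1) unfolding rapid_def by blast
  have "\<omega> i * cmod (D v i) \<le> K * B" if "\<forall>j. \<omega> j * cmod (v j) \<le> B" for v B i
  proof -
    have "\<omega> i * cmod (D v i) \<le> 1 * cmod (D v i)" by (intro mult_right_mono \<omega>_le_1) simp
    also have "\<dots> \<le> K * B * \<omega> i" using K(2)[OF that] by simp
    also have "\<dots> \<le> K * B * 1" using K(1) bound_nonneg[OF that] by (intro mult_left_mono \<omega>_le_1) simp
    finally show ?thesis by simp
  qed
  then show ?thesis unfolding tame_def using K(1) by blast
qed

lemma tame_toeplitz: "tame (toeplitz T)"
proof (induction T rule: poly_mapping_induct_single)
  case (1 d c)
  have "\<omega> i * cmod (toeplitz (Poly_Mapping.single d c) v i) \<le> (cmod c / \<omega> (- d)) * B"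
    if v: "\<forall>j. \<omega> j * cmod (v j) \<le> B" for v B i
  proof -
    have "\<omega> i \<le> \<omega> (i - d) / \<omega> (- d)" using \<omega>_shift[of "i - d" "- d"] by simp
    then have "\<omega> i * cmod (v (i - d)) \<le> \<omega> (i - d) / \<omega> (- d) * cmod (v (i - d))" by (intro mult_right_mono) auto
    also have "\<dots> \<le> B / \<omega> (- d)" using v[rule_format, of "i - d"] \<omega>_pos[of "- d"] by (simp add: divide_right_mono)
    finally have "cmod c * (\<omega> i * cmod (v (i - d))) \<le> cmod c * (B / \<omega> (- d))" by (intro mult_left_mono) auto
    then show ?thesis by (simp add: shift_def norm_mult mult_ac)
  qed
  then show ?case unfolding tame_def by (intro exI[of _ "cmod c / \<omega> (- d)"]) auto
next
  case (2 f g)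
  have "toeplitz (f + g) = (\<lambda>v i. toeplitz f v i + toeplitz g v i)" by (simp add: fun_eq_iff shift.act_add)
  then show ?case using tame_add[OF 2] by simp
qed

lemma toeplitz_rapid: assumes "rapid D" shows "rapid (\<lambda>v. toeplitz T (D v))"
proof (induction T rule: poly_mapping_induct_single)
  case (1 d c)
  obtain K where K: "K \<ge> 0" "\<And>v B i. (\<forall>j. \<omega> j * cmod (v j) \<le> B) \<Longrightarrow> cmod (D v i) \<le> K * B * \<omega> i"
    using assms(1) unfolding rapid_def by blast
  have "cmod (toeplitz (Poly_Mapping.single d c) (D v) i) \<le> (cmod c * K / \<omega> d) * B * \<omega> i"
    if v: "\<forall>j. \<omega> j * cmod (v j) \<le> B" for v B i
  proof -
    have "cmod (D v (i - d)) \<le> K * B * \<omega> (i - d)" by (rule K(2)[OF v])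
    also have "\<dots> \<le> K * B * (\<omega> i / \<omega> d)" using K(1) bound_nonneg[OF v] by (intro mult_left_mono \<omega>_shift) simp
    finally have "cmod c * cmod (D v (i - d)) \<le> cmod c * (K * B * (\<omega> i / \<omega> d))" by (intro mult_left_mono) auto
    then show ?thesis by (simp add: shift_def norm_mult mult_ac)
  qed
  then show ?case unfolding rapid_def using K(1) by (intro exI[of _ "cmod c * K / \<omega> d"]) auto
next
  case (2 f g)
  have "toeplitz (f + g) = (\<lambda>v i. toeplitz f v i + toeplitz g v i)" by (simp add: fun_eq_iff shift.act_add)
  then show ?case using rapid_add[OF 2] by simp
qed

text \<open>Far out in both directions \<open>X\<close> looks like the Toeplitz operator with symbol \<open>T\<close>.\<close>

definition has_symbol :: "(vec \<Rightarrow> vec) \<Rightarrow> (int \<Rightarrow>\<^sub>0 complex) \<Rightarrow> bool" where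
  "has_symbol X T \<longleftrightarrow> rapid (\<lambda>v i. X v i - toeplitz T v i)"

lemma has_symbol_tame: assumes "has_symbol X T" shows "tame X"
  using tame_add[OF tame_rapid[OF assms[unfolded has_symbol_def]] tame_toeplitz[of T]]
  by simp

lemma has_symbol_add:
  assumes "has_symbol X T" "has_symbol Y U" shows "has_symbol (\<lambda>v i. X v i + Y v i) (T + U)"
  using rapid_add[OF assms[unfolded has_symbol_def]]
  by (simp add: has_symbol_def shift.act_add algebra_simps)

lemma has_symbol_mult:
  assumes "has_symbol X T" "has_symbol Y U" shows "has_symbol (\<lambda>v. X (Y v)) (T * U)"
proof -
  have "rapid (\<lambda>v i. X (Y v) i - toeplitz T (Y v) i)"
    using rapid_tame[OF assms(1)[unfolded has_symbol_def] has_symbol_tame[OF assms(2)]] .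
  moreover have "rapid (\<lambda>v. toeplitz T (\<lambda>i. Y v i - toeplitz U v i))"
    by (rule toeplitz_rapid[OF assms(2)[unfolded has_symbol_def]])
  moreover have "toeplitz T (\<lambda>i. Y v i - toeplitz U v i) = (\<lambda>i. toeplitz T (Y v) i - toeplitz T (toeplitz U v) i)" for v
    using shift.act_add_right[of T "Y v" "\<lambda>i. (- 1) * toeplitz U v i"]
      shift.act_scale_right[of T "- 1" "toeplitz U v"] by simp
  ultimately show ?thesis
    using rapid_add by (fastforce simp: has_symbol_def shift.act_mult)
qed

lemma has_symbol_scale:
  assumes "has_symbol X T" shows "has_symbol (\<lambda>v i. c * X v i) (Poly_Mapping.single 0 c * T)"
  using rapid_scale[OF assms[unfolded has_symbol_def], of c]
  by (simp add: has_symbol_def shift.act_scal_mult right_diff_distrib)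

lemma has_symbol_id: "has_symbol (\<lambda>v. v) 1"
  unfolding has_symbol_def rapid_def by (intro exI[of _ 0]) simp

lemma has_symbolD:
  assumes "has_symbol X T"
  shows "\<exists>K\<ge>0. \<forall>m i. cmod (X (basis_vec m) i - poly_mapping.lookup T (i - m)) \<le> K * \<omega> m * \<omega> i"
proof -
  obtain K where K: "K \<ge> 0" "\<And>v B i. (\<forall>j. \<omega> j * cmod (v j) \<le> B) \<Longrightarrow> cmod (X v i - toeplitz T v i) \<le> K * B * \<omega> i"
    using assms unfolding has_symbol_def rapid_def by blast
  have "\<forall>j. \<omega> j * cmod (basis_vec m j) \<le> \<omega> m" for m by (auto simp: basis_vec_def)
  from K(2)[OF this] have "cmod (X (basis_vec m) i - poly_mapping.lookup T (i - m)) \<le> K * \<omega> m * \<omega> i" for m i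
    by (simp add: toeplitz_basis)
  with K(1) show ?thesis by blast
qed

text \<open>The matrix entries of \<open>X\<close> along a diagonal converge to the corresponding coefficient of the
  symbol.\<close>

lemma has_symbol_unique:
  assumes "has_symbol X T" "has_symbol X U" shows "T = U"
proof (rule poly_mapping_eqI)
  fix d
  obtain K where K: "K \<ge> 0" "\<And>m i. cmod (X (basis_vec m) i - poly_mapping.lookup T (i - m)) \<le> K * \<omega> m * \<omega> i"
    using has_symbolD[OF assms(1)] by blast
  obtain L where L: "L \<ge> 0" "\<And>m i. cmod (X (basis_vec m) i - poly_mapping.lookup U (i - m)) \<le> L * \<omega> m * \<omega> i"
    using has_symbolD[OF assms(2)] by blast
  let ?c = "cmod (poly_mapping.lookup T d - poly_mapping.lookup U d)"
  have "?c \<le> (K + L) * r ^ n" for n :: nat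
  proof -
    have "K * \<omega> (int n) * \<omega> (int n + d) \<le> K * \<omega> (int n) * 1" using K(1) by (intro mult_left_mono \<omega>_le_1) simp
    moreover have "L * \<omega> (int n) * \<omega> (int n + d) \<le> L * \<omega> (int n) * 1" using L(1) by (intro mult_left_mono \<omega>_le_1) simp
    ultimately show ?thesis
      using K(2)[of "int n" "int n + d"] L(2)[of "int n" "int n + d"]
        norm_triangle_ineq4[of "X (basis_vec (int n)) (int n + d) - poly_mapping.lookup U d"
          "X (basis_vec (int n)) (int n + d) - poly_mapping.lookup T d"]
      by (simp add: \<omega>_def algebra_simps)
  qed
  moreover have "(\<lambda>n. (K + L) * r ^ n) \<longlonglongrightarrow> (K + L) * 0"
    using r by (intro tendsto_mult_left LIMSEQ_power_zero) simp
  ultimately have "?c \<le> (K + L) * 0" by (intro LIMSEQ_le_const) auto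
  then show "poly_mapping.lookup T d = poly_mapping.lookup U d" by simp
qed

lemma has_symbol_diag:
  assumes "\<And>i. cmod (g i) \<le> K * \<omega> i * \<omega> i" shows "has_symbol (\<lambda>v i. g i * v i) 0"
proof -
  have K: "K \<ge> 0" using assms[of 0] norm_ge_zero[of "g 0"] by (simp add: \<omega>_def del: norm_ge_zero) 
  have "cmod (g i * v i) \<le> K * B * \<omega> i" if v: "\<forall>j. \<omega> j * cmod (v j) \<le> B" for v B i
  proof -
    have "cmod (g i * v i) \<le> K * \<omega> i * \<omega> i * cmod (v i)" unfolding norm_mult by (intro mult_right_mono assms) simp
    also have "\<dots> = K * \<omega> i * (\<omega> i * cmod (v i))" by simp
    also have "\<dots> \<le> K * \<omega> i * B" using v K by (intro mult_left_mono) auto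
    finally show ?thesis by (simp add: mult_ac)
  qed
  then show ?thesis unfolding has_symbol_def rapid_def using K by auto
qed

lemma has_symbol_shift:
  assumes "\<And>i. cmod (g i - 1) \<le> K * \<omega> i * \<omega> i"
  shows "has_symbol (\<lambda>v i. g i * v (i - d)) (Poly_Mapping.single d 1)"
proof -
  have "has_symbol (\<lambda>v. (\<lambda>v i. (g i - 1) * v i) (shift d v)) (0 * Poly_Mapping.single d 1)"
    by (rule has_symbol_mult[OF has_symbol_diag[OF assms]])
      (simp add: has_symbol_def rapid_def, auto)
  from this[unfolded has_symbol_def] show ?thesis
    by (simp add: has_symbol_def shift_def algebra_simps)
qed

end


section \<open>A representation of the sphere by weighted shifts\<close>

lemma free_star_zero [simp]: "free_star 0 = 0"
  using free_star_single[of 0 0] by simp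

lemma free_star_one [simp]: "free_star 1 = 1"
  using free_star_scal[of 1] by simp

lemma free_star_diff: "free_star (f - g) = free_star f - free_star g"
  using free_star_add[of "f - g" g] by simp

locale sphere_representation =
  fixes p q \<theta> :: real and k l s t :: nat
  assumes p: "0 < p" "p < 1" and q: "0 < q" "q < 1" and kl: "0 < k" "0 < l"
    and st: "s < l" "t < k"
begin

definition lam :: "int \<Rightarrow> complex" where
  "lam i = cis (2 * pi * \<theta> * of_int i)"

lemma lam_add: "lam (i + j) = lam i * lam j"
  by (simp add: lam_def cis_mult algebra_simps)

lemma lam_0 [simp]: "lam 0 = 1" by (simp add: lam_def)

lemma cnj_lam [simp]: "cnj (lam i) = lam (- i)" by (simp add: lam_def cis_cnj)

lemma lam_1: "lam 1 = exp (2 * pi * \<i> * \<theta>)" and lam_minus_1: "lam (- 1) = exp (- (2 * pi * \<i> * \<theta>))"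
  by (simp_all add: lam_def cis_conv_exp algebra_simps)

lemma lam_nonzero [simp]: "lam i \<noteq> 0" by (simp add: lam_def)

lemma norm_lam [simp]: "cmod (lam i) = 1" by (simp add: lam_def)

lemma lam_cancel: "i + j = 0 \<Longrightarrow> lam i * lam j = 1"
  by (simp flip: lam_add)

lemma lam_cancel_left: "i + j = 0 \<Longrightarrow> lam i * (lam j * c) = c"
  using lam_cancel[of i j] by (simp flip: mult.assoc)

text \<open>The weights of the two shifts carry a phase at one place of every period. The phases are
  chosen so that the product of the weights over a period, multiplied by the phase that comes from
  the other generator, is real.\<close>

definition alpha :: "int \<Rightarrow> complex" where
  "alpha j = (if j mod int l = int s then lam (- (j * int k)) else 1) * of_real (sqrt (1 - p powi (j + 1)))"

definition beta :: "int \<Rightarrow> complex" where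
  "beta i = (if i mod int k = int t then lam (i * int l) else 1) * of_real (sqrt (1 - q powi (i + 1)))"

lemma alpha_minus_one [simp]: "alpha (- 1) = 0" and beta_minus_one [simp]: "beta (- 1) = 0"
  by (simp_all add: alpha_def beta_def)

lemma powi_le_one: "0 < x \<Longrightarrow> x < 1 \<Longrightarrow> i \<ge> 0 \<Longrightarrow> x powi i \<le> (1::real)"
  by (simp add: power_int_def power_le_one)

lemma alpha_cnj:
  assumes "j \<ge> - 1" shows "alpha j * cnj (alpha j) = of_real (1 - p powi (j + 1))"
proof -
  have "(cmod (alpha j))\<^sup>2 = 1 - p powi (j + 1)"
    using powi_le_one[of p "j + 1"] p assms by (auto simp: alpha_def norm_mult power_mult_distrib)
  then show ?thesis by (simp only: complex_norm_square[symmetric])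
qed

lemma beta_cnj:
  assumes "i \<ge> - 1" shows "beta i * cnj (beta i) = of_real (1 - q powi (i + 1))"
proof -
  have "(cmod (beta i))\<^sup>2 = 1 - q powi (i + 1)"
    using powi_le_one[of q "i + 1"] q assms by (auto simp: beta_def norm_mult power_mult_distrib)
  then show ?thesis by (simp only: complex_norm_square[symmetric])
qed

lemma norm_alpha: assumes "j \<ge> - 1" shows "cmod (alpha j) \<le> 1"
proof -
  have "p powi (j + 1) > 0" using p by (simp add: zero_less_power_int)
  then show ?thesis using powi_le_one[of p "j + 1"] p assms by (auto simp: alpha_def norm_mult)
qed

lemma norm_beta: assumes "i \<ge> - 1" shows "cmod (beta i) \<le> 1"
proof -
  have "q powi (i + 1) > 0" using q by (simp add: zero_less_power_int)
  then show ?thesis using powi_le_one[of q "i + 1"] q assms by (auto simp: beta_def norm_mult)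
qed

text \<open>On the half line \<open>j \<ge> 0\<close> the element \<open>a\<close> is a weighted shift and \<open>b\<close> is diagonal; on
  \<open>j < 0\<close>, numbered by \<open>- j - 1\<close>, they exchange their roles.\<close>

fun letter_op :: "gen letter \<Rightarrow> vec \<Rightarrow> vec" where
  "letter_op (Gen gen_a) v = (\<lambda>j. if j \<ge> 0 then alpha (j - 1) * v (j - 1) else lam (- j - 1) * v j)"
| "letter_op (Adj gen_a) v = (\<lambda>j. if j \<ge> 0 then cnj (alpha j) * v (j + 1) else lam (j + 1) * v j)"
| "letter_op (Gen gen_b) v = (\<lambda>j. if j \<ge> 0 then lam (- j) * v j else beta (- j - 2) * v (j + 1))"
| "letter_op (Adj gen_b) v = (\<lambda>j. if j \<ge> 0 then lam j * v j else cnj (beta (- j - 1)) * v (j - 1))"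

definition word_op :: "gen word \<Rightarrow> vec \<Rightarrow> vec" where
  "word_op w v = foldr letter_op (letters w) v"

lemma letter_op_linear:
  "letter_op x (\<lambda>i. v i + v' i) = (\<lambda>i. letter_op x v i + letter_op x v' i)"
  "letter_op x (\<lambda>i. c * v i) = (\<lambda>i. c * letter_op x v i)"
  by (cases x; rename_tac g; case_tac g; auto simp: fun_eq_iff algebra_simps)+

sublocale sequence_action word_op
proof
  fix m n :: "gen word" and v w :: vec and c :: complex
  show "word_op 0 v = v" by (simp add: word_op_def zero_word_def)
  show "word_op (m + n) v = word_op m (word_op n v)" by (simp add: word_op_def plus_word_def)
  have "foldr letter_op xs (\<lambda>i. v i + w i) = (\<lambda>i. foldr letter_op xs v i + foldr letter_op xs w i)" for xs
    by (induction xs) (simp_all add: letter_op_linear)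
  then show "word_op m (\<lambda>i. v i + w i) = (\<lambda>i. word_op m v i + word_op m w i)" by (simp add: word_op_def)
  have "foldr letter_op xs (\<lambda>i. c * v i) = (\<lambda>i. c * foldr letter_op xs v i)" for xs
    by (induction xs) (simp_all add: letter_op_linear)
  then show "word_op m (\<lambda>i. c * v i) = (\<lambda>i. c * word_op m v i)" by (simp add: word_op_def)
qed

lemma act_gen: "act (free_gen g) v = letter_op (Gen g) v"
  and act_star_gen: "act (free_star (free_gen g)) v = letter_op (Adj g) v"
  by (simp_all add: free_gen_def free_star_single adj_word_def word_op_def)

definition letter_weight :: "gen letter \<Rightarrow> int \<Rightarrow> complex" where
  "letter_weight x j = (case x of
     Gen gen_a \<Rightarrow> (if j \<ge> 0 then alpha (j - 1) else lam (- j - 1))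
   | Adj gen_a \<Rightarrow> (if j \<ge> 0 then cnj (alpha j) else lam (j + 1))
   | Gen gen_b \<Rightarrow> (if j \<ge> 0 then lam (- j) else beta (- j - 2))
   | Adj gen_b \<Rightarrow> (if j \<ge> 0 then lam j else cnj (beta (- j - 1))))"

definition letter_shift :: "gen letter \<Rightarrow> int \<Rightarrow> int" where
  "letter_shift x j = (case x of
     Gen gen_a \<Rightarrow> (if j \<ge> 0 then j - 1 else j)
   | Adj gen_a \<Rightarrow> (if j \<ge> 0 then j + 1 else j)
   | Gen gen_b \<Rightarrow> (if j \<ge> 0 then j else j + 1)
   | Adj gen_b \<Rightarrow> (if j \<ge> 0 then j else j - 1))"

lemma letter_op_wsub: "letter_op x = wsub (letter_weight x) (letter_shift x)"
  by (cases x; rename_tac g; case_tac g; auto simp: fun_eq_iff wsub_def letter_weight_def letter_shift_def)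

lemma letter_inverse:
  assumes "letter_weight x j \<noteq> 0"
  shows "letter_shift (adj_letter x) (letter_shift x j) = j \<and>
    letter_weight (adj_letter x) (letter_shift x j) = cnj (letter_weight x j)"
proof -
  have j: "j = 0 \<or> j \<ge> 1 \<or> j = - 1 \<or> j \<le> - 2" by linarith
  show ?thesis
    by (cases x; rename_tac g; case_tac g; insert assms j;
        auto simp: letter_weight_def letter_shift_def split: if_splits
          intro!: arg_cong[of _ _ lam] arg_cong[of _ _ beta])
qed

lemma adjoint_letter_op: "adjoint_pair (letter_op x) (letter_op (adj_letter x))"
  unfolding letter_op_wsub
  using letter_inverse[of x] letter_inverse[of "adj_letter x"]
  by (intro adjoint_pair_wsub) auto

lemma bounded_letter_op: "bounded_operator (letter_op x)"
  unfolding letter_op_wsub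
proof (rule bounded_operator_wsub[of _ 1])
  show "cmod (letter_weight x i) \<le> 1" for i
    using norm_alpha[of i] norm_alpha[of "i - 1"] norm_beta[of "- i - 1"] norm_beta[of "- i - 2"]
    by (cases x; rename_tac g; case_tac g; auto simp: letter_weight_def)
  show "inj_on (letter_shift x) {i. letter_weight x i \<noteq> 0}"
    by (rule inj_on_inverseI[of _ "letter_shift (adj_letter x)"]) (simp add: letter_inverse)
qed

lemma bounded_word_op: "bounded_operator (word_op w)"
proof (cases w)
  case (Word xs)
  have "bounded_operator (foldr letter_op xs)"
  proof (induction xs)
    case Nil
    show ?case by (rule bounded_operatorI[of _ 1]) auto
  next
    case (Cons x xs)
    have "bounded_operator (\<lambda>v. letter_op x (foldr letter_op xs v))"
      by (rule bounded_operator_compose[where T = "letter_op x" and U = "foldr letter_op xs",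
            OF bounded_letter_op Cons])
    then show ?case by (simp add: comp_def)
  qed
  then show ?thesis by (simp add: Word word_op_def[abs_def])
qed

lemma adjoint_word_op: "adjoint_pair (word_op w) (word_op (adj_word w))"
proof (cases w)
  case (Word xs)
  have b: "bounded_operator (foldr letter_op xs)" for xs
    using bounded_word_op[of "Word xs"] by (simp add: word_op_def[abs_def])
  have "adjoint_pair (foldr letter_op xs) (foldr letter_op (rev (map adj_letter xs)))"
  proof (induction xs)
    case Nil
    show ?case by (simp add: adjoint_pair_def)
  next
    case (Cons x xs)
    have "adjoint_pair (\<lambda>v. letter_op x (foldr letter_op xs v))
        (\<lambda>v. foldr letter_op (rev (map adj_letter xs)) (letter_op (adj_letter x) v))"
      by (rule adjoint_pair_compose[where T = "letter_op x" and U = "foldr letter_op xs",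
            OF adjoint_letter_op Cons bounded_letter_op b])
    then show ?case by (simp add: comp_def)
  qed
  then show ?thesis by (simp add: Word word_op_def[abs_def] adj_word_def)
qed

text \<open>The relations and their adjoints are checked coordinate by coordinate. The indices \<open>0\<close> and \<open>- 1\<close>,
  where the half lines meet, are separate cases: there the weights that would connect the half lines
  vanish.\<close>

lemma act_relations:
  assumes "f \<in> sphere_relations p q \<theta>"
  shows "act f v = (\<lambda>_. 0) \<and> act (free_star f) v = (\<lambda>_. 0)"
proof -
  let ?a = "free_gen gen_a" and ?b = "free_gen gen_b"
  have lam: "exp (2 * pi * \<i> * \<theta>) = lam 1" "exp (- (2 * pi * \<i> * \<theta>)) = lam (- 1)"
    by (simp_all add: lam_1 lam_minus_1)
  have lam': "lam (i - j) = lam i / lam j" "lam (- j) = 1 / lam j" for i j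
    using lam_add[of "i - j" j] lam_add[of "- j" j] by (simp_all add: field_simps)
  have lam2: "lam 2 = lam 1 * lam 1" using lam_add[of 1 1] by simp
  have pw: "p powi (j + 1) = p * p powi j" "q powi (- j) = q * q powi (- j - 1)" for j
    using p q power_int_add[of p j 1] power_int_add[of q "- j - 1" 1] by simp_all
  have ca: "alpha (j - 1) * (cnj (alpha (j - 1)) * e) = of_real (1 - p powi j) * e"
    "cnj (alpha j) * (alpha j * e) = of_real (1 - p * p powi j) * e" if "j \<ge> 0" for j e
  proof -
    have "alpha (j - 1) * cnj (alpha (j - 1)) = of_real (1 - p powi j)" using alpha_cnj[of "j - 1"] that by simp
    then show "alpha (j - 1) * (cnj (alpha (j - 1)) * e) = of_real (1 - p powi j) * e"
      by (simp only: mult.assoc[symmetric])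
    have "cnj (alpha j) * alpha j = of_real (1 - p * p powi j)"
      using alpha_cnj[of j] that pw(1)[of j] by (simp add: mult.commute)
    then show "cnj (alpha j) * (alpha j * e) = of_real (1 - p * p powi j) * e"
      by (simp only: mult.assoc[symmetric])
  qed
  have cb: "beta (- j - 2) * (cnj (beta (- j - 2)) * e) = of_real (1 - q powi (- j - 1)) * e"
    "cnj (beta (- j - 1)) * (beta (- j - 1) * e) = of_real (1 - q * q powi (- j - 1)) * e" if "j < 0" for j e
  proof -
    have e: "- j - 2 + 1 = - j - 1" "- j - 1 + 1 = - j" by simp_all
    have "beta (- j - 2) * cnj (beta (- j - 2)) = of_real (1 - q powi (- j - 1))"
      using beta_cnj[of "- j - 2"] that unfolding e by simp
    then show "beta (- j - 2) * (cnj (beta (- j - 2)) * e) = of_real (1 - q powi (- j - 1)) * e"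
      by (simp only: mult.assoc[symmetric])
    have "cnj (beta (- j - 1)) * beta (- j - 1) = of_real (1 - q * q powi (- j - 1))"
      using beta_cnj[of "- j - 1"] that pw(2)[of j] unfolding e by (simp add: mult.commute)
    then show "cnj (beta (- j - 1)) * (beta (- j - 1) * e) = of_real (1 - q * q powi (- j - 1)) * e"
      by (simp only: mult.assoc[symmetric])
  qed
  have cb0: "cnj (beta 0) * (beta 0 * e) = of_real (1 - q) * e" for e
    using cb(2)[of "- 1" e] by simp
  have ord: "beta (- 1 - j) = beta (- j - 1)" "beta (- 2 - j) = beta (- j - 2)" if "j \<le> - 2" for j :: int
    by (rule arg_cong[of _ _ beta], simp)+
  note simps = act_diff act_mult act_scal_mult act_gen act_star_gen free_star_diff free_star_mult \<phi>_zero
  have cases: "(\<And>j. j \<ge> 1 \<Longrightarrow> u j = 0) \<Longrightarrow> u 0 = 0 \<Longrightarrow> u (- 1) = 0 \<Longrightarrow> (\<And>j. j \<le> - 2 \<Longrightarrow> u j = 0) \<Longrightarrow> u = (\<lambda>_. 0)" for u :: vec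
  proof
    fix j :: int
    assume "\<And>j. j \<ge> 1 \<Longrightarrow> u j = 0" "u 0 = 0" "u (- 1) = 0" "\<And>j. j \<le> - 2 \<Longrightarrow> u j = 0"
    then show "u j = 0" by (cases "j \<ge> 1"; cases "j = 0"; cases "j = - 1"; cases "j \<le> - 2") auto
  qed
  have 1: "act (?a * ?b - scal (lam 1) * (?b * ?a)) v = (\<lambda>_. 0)"
    "act (free_star (?a * ?b - scal (lam 1) * (?b * ?a))) v = (\<lambda>_. 0)"
    by (rule cases; simp add: simps lam_add lam' lam2 field_simps)+
  have 2: "act (?a * free_star ?b - scal (lam (- 1)) * (free_star ?b * ?a)) v = (\<lambda>_. 0)"
    "act (free_star (?a * free_star ?b - scal (lam (- 1)) * (free_star ?b * ?a))) v = (\<lambda>_. 0)"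
    by (rule cases; simp add: simps lam_add lam' lam2 field_simps)+
  have 3: "act (free_star ?a * ?a - scal (of_real p) * (?a * free_star ?a) - scal (of_real (1 - p))) v = (\<lambda>_. 0)"
    "act (free_star (free_star ?a * ?a - scal (of_real p) * (?a * free_star ?a) - scal (of_real (1 - p)))) v = (\<lambda>_. 0)"
    by (rule cases; simp add: simps lam' lam_add ca left_diff_distrib right_diff_distrib distrib_left distrib_right)+
  have 4: "act (free_star ?b * ?b - scal (of_real q) * (?b * free_star ?b) - scal (of_real (1 - q))) v = (\<lambda>_. 0)"
    "act (free_star (free_star ?b * ?b - scal (of_real q) * (?b * free_star ?b) - scal (of_real (1 - q)))) v = (\<lambda>_. 0)"
    by (rule cases; simp add: simps ord cb0 lam' lam_add cb left_diff_distrib right_diff_distrib distrib_left distrib_right)+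
  have 5: "act ((1 - ?a * free_star ?a) * (1 - ?b * free_star ?b)) v = (\<lambda>_. 0)"
    "act (free_star ((1 - ?a * free_star ?a) * (1 - ?b * free_star ?b))) v = (\<lambda>_. 0)"
    by (rule cases; simp add: simps ord cb0 lam' lam_add ca cb left_diff_distrib right_diff_distrib distrib_left distrib_right)+
  show ?thesis
    using assms 1 2 3 4 5 unfolding sphere_relations_def Let_def free_star_alg_simps lam by blast
qed

lemma act_relation_ideal: "f \<in> relation_ideal (sphere_relations p q \<theta>) \<Longrightarrow> act f v = (\<lambda>_. 0)"
proof -
  have z: "act f (\<lambda>_. 0) = (\<lambda>_. 0)" for f using act_scale_right[of f 0 "\<lambda>_. 0"] by simp
  have "relation_ideal (sphere_relations p q \<theta>) \<subseteq> {f. \<forall>v. act f v = (\<lambda>_. 0)}"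
    by (rule relation_ideal_minimal) (auto simp: act_add act_mult z act_relations)
  then show "f \<in> relation_ideal (sphere_relations p q \<theta>) \<Longrightarrow> act f v = (\<lambda>_. 0)" by blast
qed

sublocale S: graded_quantum_sphere "S3 p q \<theta>" "S3_a p q \<theta>" "S3_b p q \<theta>" p q
    "exp (2 * pi * \<i> * \<theta>)" k l "presented_component (sphere_relations p q \<theta>) (sphere_degree k l)"
  by (rule graded_quantum_sphere_S3[OF p(1) q(1) kl])

abbreviation "\<R> \<equiv> sphere_relations p q \<theta>"

text \<open>The choice of a representative does not matter, since the ideal of relations acts by zero.\<close>

definition sphere_act :: "sphere \<Rightarrow> vec \<Rightarrow> vec" where
  "sphere_act X = act (SOME f. f \<in> X)"

lemma sphere_act_cls: "sphere_act (cls \<R> f) = act f"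
proof
  fix v
  have "(SOME g. g \<in> cls \<R> f) \<in> cls \<R> f" by (rule someI[of _ f]) simp
  then have "(SOME g. g \<in> cls \<R> f) - f \<in> relation_ideal \<R>" by (simp add: cls_def)
  from act_relation_ideal[OF this, of v] show "sphere_act (cls \<R> f) v = act f v"
    by (simp add: sphere_act_def act_diff fun_eq_iff)
qed

lemmas sphere_ops = presented_ops[of \<R>, folded S3_def]

lemma sphere_carrier: "X \<in> carrier (S3 p q \<theta>) \<Longrightarrow> \<exists>f. X = cls \<R> f"
  by (auto simp: S3_def presented_carrier)

lemma sphere_act_add: "X \<in> carrier (S3 p q \<theta>) \<Longrightarrow> Y \<in> carrier (S3 p q \<theta>) \<Longrightarrow>
    sphere_act (X \<oplus>\<^bsub>S3 p q \<theta>\<^esub> Y) v = (\<lambda>i. sphere_act X v i + sphere_act Y v i)"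
  and sphere_act_mult: "X \<in> carrier (S3 p q \<theta>) \<Longrightarrow> Y \<in> carrier (S3 p q \<theta>) \<Longrightarrow>
    sphere_act (X \<otimes>\<^bsub>S3 p q \<theta>\<^esub> Y) v = sphere_act X (sphere_act Y v)"
  and sphere_act_smult: "X \<in> carrier (S3 p q \<theta>) \<Longrightarrow>
    sphere_act (c \<odot>\<^bsub>S3 p q \<theta>\<^esub> X) v = (\<lambda>i. c * sphere_act X v i)"
  by (auto dest!: sphere_carrier simp: sphere_ops sphere_act_cls act_add act_mult act_scal_mult \<phi>_zero)

lemma sphere_act_one: "sphere_act \<one>\<^bsub>S3 p q \<theta>\<^esub> v = v"
  by (simp add: sphere_ops sphere_act_cls)

lemma sphere_act_diff: "X \<in> carrier (S3 p q \<theta>) \<Longrightarrow> Y \<in> carrier (S3 p q \<theta>) \<Longrightarrow>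
    sphere_act (X \<ominus>\<^bsub>S3 p q \<theta>\<^esub> Y) v = (\<lambda>i. sphere_act X v i - sphere_act Y v i)"
  by (simp add: a_minus_def S.minus_eq_smult sphere_act_add sphere_act_smult)

lemma bounded_sphere_act: "X \<in> carrier (S3 p q \<theta>) \<Longrightarrow> bounded_operator (sphere_act X)"
  using bounded_act[OF bounded_word_op] by (auto dest!: sphere_carrier simp: sphere_act_cls)

lemma adjoint_sphere_act:
  "X \<in> carrier (S3 p q \<theta>) \<Longrightarrow> adjoint_pair (sphere_act X) (sphere_act (star (S3 p q \<theta>) X))"
  using adjoint_act[OF bounded_word_op adjoint_word_op free_star_single free_star_add]
  by (auto dest!: sphere_carrier simp: sphere_act_cls sphere_ops)

lemma sphere_act_gens:
  "sphere_act (S3_a p q \<theta>) v = letter_op (Gen gen_a) v"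
  "sphere_act (S3_b p q \<theta>) v = letter_op (Gen gen_b) v"
  "sphere_act (star (S3 p q \<theta>) (S3_a p q \<theta>)) v = letter_op (Adj gen_a) v"
  "sphere_act (star (S3 p q \<theta>) (S3_b p q \<theta>)) v = letter_op (Adj gen_b) v"
  by (simp_all add: S3_a_def S3_b_def presented_gen_def coset_eq_cls sphere_act_cls
      sphere_ops act_gen act_star_gen del: letter_op.simps)

lemma sphere_act_pow:
  "X \<in> carrier (S3 p q \<theta>) \<Longrightarrow> sphere_act (X [^]\<^bsub>S3 p q \<theta>\<^esub> n) v = (sphere_act X ^^ n) v"
  by (induction n arbitrary: v) (simp_all add: sphere_act_one sphere_act_mult funpow_swap1)

end


context sphere_representation
begin

subsection \<open>Powers of the generators and the element \<open>C\<close>\<close>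

lemma pow_a: "(letter_op (Gen gen_a) ^^ n) v = wsub (\<lambda>j. if j \<ge> 0 then \<Prod>i<n. alpha (j - 1 - int i) else lam (int n * (- j - 1)))
    (\<lambda>j. if j \<ge> 0 then j - int n else j) v"
proof (induction n arbitrary: v)
  case 0
  then show ?case by (auto simp: wsub_def fun_eq_iff)
next
  case (Suc n)
  show ?case
  proof
    fix j :: int
    have z: "(\<Prod>i<n. alpha (j - 1 - int i)) = 0" if "0 \<le> j" "j < int n"
      using that by (intro prod_zero bexI[of _ "nat j"]) auto
    have "(letter_op (Gen gen_a) ^^ Suc n) v j = (letter_op (Gen gen_a) ^^ n) (letter_op (Gen gen_a) v) j"
      by (simp only: funpow_Suc_right comp_def)
    also have "\<dots> = wsub (\<lambda>j. if j \<ge> 0 then \<Prod>i<Suc n. alpha (j - 1 - int i) else lam (int (Suc n) * (- j - 1)))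
      (\<lambda>j. if j \<ge> 0 then j - int (Suc n) else j) v j"
    proof (cases "0 \<le> j \<and> j < int n")
      case True
      then show ?thesis unfolding Suc.IH by (simp add: wsub_def z)
    next
      case False
      have "alpha (j - int n - 1) = alpha (j - 1 - int n)" by (rule arg_cong[of _ _ alpha]) simp
      moreover have "lam (int (Suc n) * (- j - 1)) = lam (int n * (- j - 1)) * lam (- j - 1)"
        by (simp add: lam_add[symmetric] algebra_simps)
      ultimately show ?thesis using False unfolding Suc.IH
        by (auto simp: wsub_def mult_ac diff_diff_eq add_ac)
    qed
    finally show "(letter_op (Gen gen_a) ^^ Suc n) v j = \<dots>" .
  qed
qed

lemma pow_star_a: "(letter_op (Adj gen_a) ^^ n) v = wsub (\<lambda>j. if j \<ge> 0 then \<Prod>i<n. cnj (alpha (j + int i)) else lam (int n * (j + 1)))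
    (\<lambda>j. if j \<ge> 0 then j + int n else j) v"
proof (induction n arbitrary: v)
  case 0
  then show ?case by (auto simp: wsub_def fun_eq_iff)
next
  case (Suc n)
  show ?case
  proof
    fix j :: int
    have "(letter_op (Adj gen_a) ^^ Suc n) v j = (letter_op (Adj gen_a) ^^ n) (letter_op (Adj gen_a) v) j"
      by (simp only: funpow_Suc_right comp_def)
    moreover have "lam (int (Suc n) * (j + 1)) = lam (int n * (j + 1)) * lam (j + 1)"
      by (simp add: lam_add[symmetric] algebra_simps)
    ultimately show "(letter_op (Adj gen_a) ^^ Suc n) v j = wsub (\<lambda>j. if j \<ge> 0 then \<Prod>i<Suc n. cnj (alpha (j + int i)) else lam (int (Suc n) * (j + 1)))
      (\<lambda>j. if j \<ge> 0 then j + int (Suc n) else j) v j"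
      unfolding Suc.IH by (auto simp: wsub_def mult_ac add_ac)
  qed
qed

lemma pow_b: "(letter_op (Gen gen_b) ^^ n) v = wsub (\<lambda>j. if j \<ge> 0 then lam (- int n * j) else \<Prod>i<n. beta (- j - 2 - int i))
    (\<lambda>j. if j \<ge> 0 then j else j + int n) v"
proof (induction n arbitrary: v)
  case 0
  then show ?case by (auto simp: wsub_def fun_eq_iff)
next
  case (Suc n)
  show ?case
  proof
    fix j :: int
    have z: "(\<Prod>i<n. beta (- j - 2 - int i)) = 0" if "j < 0" "j + int n \<ge> 0"
      using that by (intro prod_zero bexI[of _ "nat (- j - 1)"]) auto
    have "(letter_op (Gen gen_b) ^^ Suc n) v j = (letter_op (Gen gen_b) ^^ n) (letter_op (Gen gen_b) v) j"
      by (simp only: funpow_Suc_right comp_def)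
    also have "\<dots> = wsub (\<lambda>j. if j \<ge> 0 then lam (- int (Suc n) * j) else \<Prod>i<Suc n. beta (- j - 2 - int i))
      (\<lambda>j. if j \<ge> 0 then j else j + int (Suc n)) v j"
    proof (cases "j < 0 \<and> j + int n \<ge> 0")
      case True
      then show ?thesis unfolding Suc.IH by (simp add: wsub_def z)
    next
      case False
      have "beta (- (j + int n) - 2) = beta (- j - 2 - int n)" by (rule arg_cong[of _ _ beta]) simp
      moreover have "lam (- int (Suc n) * j) = lam (- (int n * j)) * lam (- j)"
        by (simp add: algebra_simps flip: lam_add)
      ultimately show ?thesis using False unfolding Suc.IH
        by (auto simp: wsub_def mult_ac add_ac)
    qed
    finally show "(letter_op (Gen gen_b) ^^ Suc n) v j = \<dots>" .
  qed
qed

lemma pow_star_b: "(letter_op (Adj gen_b) ^^ n) v = wsub (\<lambda>j. if j \<ge> 0 then lam (int n * j) else \<Prod>i<n. cnj (beta (- j - 1 + int i)))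
    (\<lambda>j. if j \<ge> 0 then j else j - int n) v"
proof (induction n arbitrary: v)
  case 0
  then show ?case by (auto simp: wsub_def fun_eq_iff)
next
  case (Suc n)
  show ?case
  proof
    fix j :: int
    have "(letter_op (Adj gen_b) ^^ Suc n) v j = (letter_op (Adj gen_b) ^^ n) (letter_op (Adj gen_b) v) j"
      by (simp only: funpow_Suc_right comp_def)
    moreover have "beta (- (j - int n) - 1) = beta (- j - 1 + int n)" by (rule arg_cong[of _ _ beta]) simp
    moreover have "lam (int (Suc n) * j) = lam (int n * j) * lam j"
      by (simp add: algebra_simps flip: lam_add)
    ultimately show "(letter_op (Adj gen_b) ^^ Suc n) v j = wsub (\<lambda>j. if j \<ge> 0 then lam (int (Suc n) * j) else \<Prod>i<Suc n. cnj (beta (- j - 1 + int i)))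
      (\<lambda>j. if j \<ge> 0 then j else j - int (Suc n)) v j"
      unfolding Suc.IH by (auto simp: wsub_def mult_ac diff_diff_eq add_ac)
  qed
qed

lemma closed_gens [simp]: "S3_a p q \<theta> \<in> carrier (S3 p q \<theta>)" "S3_b p q \<theta> \<in> carrier (S3 p q \<theta>)"
  by (rule S.osc_a.a_closed S.osc_b.a_closed)+

lemma act_z: "sphere_act S.z v = (\<lambda>j. (if j \<ge> 0 then of_real (p powi j) else 0) * v j)"
proof
  fix j :: int
  have "alpha (j - 1) * (cnj (alpha (j - 1)) * v j) = of_real (1 - p powi j) * v j" if "j \<ge> 0"
    using alpha_cnj[of "j - 1"] that by (simp only: mult.assoc[symmetric]) simp
  moreover have "lam (- j - 1) * (lam (j + 1) * v j) = v j" by (rule lam_cancel_left) simp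
  ultimately show "sphere_act S.z v j = (if j \<ge> 0 then of_real (p powi j) else 0) * v j"
    by (cases "j = 0") (auto simp: S.z_def sphere_act_diff sphere_act_mult sphere_act_one sphere_act_gens
        left_diff_distrib)
qed

lemma act_w: "sphere_act S.w v = (\<lambda>j. (if j \<ge> 0 then 0 else of_real (q powi (- j - 1))) * v j)"
proof
  fix j :: int
  have e: "- j - 2 + 1 = - j - 1" by simp
  have "beta (- j - 2) * (cnj (beta (- j - 2)) * v j) = of_real (1 - q powi (- j - 1)) * v j" if "j < 0"
    using beta_cnj[of "- j - 2"] that unfolding e by (simp only: mult.assoc[symmetric])
  moreover have "lam (- j) * (lam j * v j) = v j" by (rule lam_cancel_left) simp
  moreover have "beta (- (j + 1) - 1) = beta (- j - 2)" by (rule arg_cong[of _ _ beta]) simp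
  ultimately show "sphere_act S.w v j = (if j \<ge> 0 then 0 else of_real (q powi (- j - 1))) * v j"
    by (cases "j = - 1") (auto simp: S.w_def sphere_act_diff sphere_act_mult sphere_act_one
        sphere_act_gens left_diff_distrib)
qed

definition C_weight :: "int \<Rightarrow> complex" where
  "C_weight j = (if j \<ge> 0 then (\<Prod>i<l. alpha (j - 1 - int i)) * lam (int k * (j - int l))
     else lam (int l * (- j - 1)) * (\<Prod>i<k. cnj (beta (- j - 1 + int i))))"

definition C_shift :: "int \<Rightarrow> int" where
  "C_shift j = (if j \<ge> 0 then j - int l else j - int k)"

definition C'_weight :: "int \<Rightarrow> complex" where
  "C'_weight j = (if j \<ge> 0 then lam (- int k * j) * (\<Prod>i<l. cnj (alpha (j + int i)))
     else (\<Prod>i<k. beta (- j - 2 - int i)) * lam (int l * (j + int k + 1)))"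

definition C'_shift :: "int \<Rightarrow> int" where
  "C'_shift j = (if j \<ge> 0 then j + int l else j + int k)"

lemma prod_alpha_zero: "0 \<le> j \<Longrightarrow> j < int l \<Longrightarrow> (\<Prod>i<l. alpha (j - 1 - int i)) = 0"
  by (intro prod_zero bexI[of _ "nat j"]) auto

lemma prod_beta_zero: "j < 0 \<Longrightarrow> j + int k \<ge> 0 \<Longrightarrow> (\<Prod>i<k. beta (- j - 2 - int i)) = 0"
  by (intro prod_zero bexI[of _ "nat (- j - 1)"]) auto

lemma act_C: "sphere_act S.C v = wsub C_weight C_shift v"
proof -
  have "sphere_act S.C v = (letter_op (Gen gen_a) ^^ l) ((letter_op (Adj gen_b) ^^ k) v)"
    by (simp add: S.C_def S.x_def S.y_def S.star_pow sphere_act_mult sphere_act_pow sphere_act_gens[abs_def] del: letter_op.simps)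
  also have "\<dots> = wsub C_weight C_shift v"
    unfolding pow_a pow_star_b
    using prod_alpha_zero by (auto simp: wsub_def C_weight_def C_shift_def fun_eq_iff)
  finally show ?thesis .
qed

lemma act_star_C: "sphere_act (star (S3 p q \<theta>) S.C) v = wsub C'_weight C'_shift v"
proof -
  have "sphere_act (star (S3 p q \<theta>) S.C) v = (letter_op (Gen gen_b) ^^ k) ((letter_op (Adj gen_a) ^^ l) v)"
    by (simp add: S.C_def S.x_def S.y_def S.star_mult S.star_pow sphere_act_mult sphere_act_pow sphere_act_gens[abs_def] del: letter_op.simps)
  also have "\<dots> = wsub C'_weight C'_shift v"
    unfolding pow_b pow_star_a
    using prod_beta_zero by (auto simp: wsub_def C'_weight_def C'_shift_def fun_eq_iff)
  finally show ?thesis .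
qed


subsection \<open>Compression to one residue class on each half line\<close>

text \<open>The position of \<open>f\<^sub>m\<close> among the basis vectors of the representation of the sphere: the residue
  class of \<open>s\<close> modulo \<open>l\<close> on the half line \<open>j \<ge> 0\<close> and the class of \<open>t\<close> modulo \<open>k\<close> on the other one,
  where indices are counted backwards from \<open>- 1\<close>.\<close>

definition \<sigma> :: "int \<Rightarrow> int" where
  "\<sigma> m = (if m \<ge> 0 then m * int l + int s else - ((- m - 1) * int k + int t) - 1)"

definition in_range :: "int \<Rightarrow> bool" where
  "in_range j \<longleftrightarrow> (if j \<ge> 0 then j mod int l = int s else (- j - 1) mod int k = int t)"

definition \<sigma>' :: "int \<Rightarrow> int" where
  "\<sigma>' j = (if j \<ge> 0 then j div int l else - ((- j - 1) div int k) - 1)"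

lemma \<sigma>_sign: "\<sigma> m \<ge> 0 \<longleftrightarrow> m \<ge> 0"
proof (cases "m \<ge> 0")
  case False
  then have "(- m - 1) * int k \<ge> 0" by (intro mult_nonneg_nonneg) auto
  then have "- ((- m - 1) * int k + int t) - 1 < 0" by linarith
  then show ?thesis using False unfolding \<sigma>_def by simp
qed (simp add: \<sigma>_def)

lemma in_range_\<sigma> [simp]: "in_range (\<sigma> m)" and \<sigma>'_\<sigma> [simp]: "\<sigma>' (\<sigma> m) = m"
  using \<sigma>_sign[of m] st kl by (auto simp: in_range_def \<sigma>'_def) (auto simp: \<sigma>_def)

lemma \<sigma>_\<sigma>': "in_range j \<Longrightarrow> \<sigma> (\<sigma>' j) = j"
proof (cases "j \<ge> 0")
  case True
  assume "in_range j"
  then have "j mod int l = int s" using True by (simp add: in_range_def)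
  moreover have "j div int l \<ge> 0" using True kl by (simp add: pos_imp_zdiv_nonneg_iff)
  ultimately show ?thesis using True div_mult_mod_eq[of j "int l"] by (simp add: \<sigma>_def \<sigma>'_def)
next
  case False
  assume "in_range j"
  then have "(- j - 1) mod int k = int t" using False by (simp add: in_range_def)
  moreover have "(- j - 1) div int k \<ge> 0" using False kl by (simp add: pos_imp_zdiv_nonneg_iff)
  ultimately show ?thesis using False div_mult_mod_eq[of "- j - 1" "int k"] by (simp add: \<sigma>_def \<sigma>'_def)
qed

lemma inj_\<sigma>: "inj \<sigma>" by (metis \<sigma>'_\<sigma> injI)

definition emb :: "vec \<Rightarrow> vec" where "emb = wsub (\<lambda>j. if in_range j then 1 else 0) \<sigma>'"
definition res :: "vec \<Rightarrow> vec" where "res = wsub (\<lambda>_. 1) \<sigma>"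
definition cut :: "vec \<Rightarrow> vec" where "cut v = (\<lambda>j. if in_range j then v j else 0)"

lemma res_emb [simp]: "res (emb v) = v" by (simp add: res_def emb_def wsub_def)
lemma emb_res: "emb (res v) = cut v" by (auto simp: res_def emb_def cut_def wsub_def fun_eq_iff \<sigma>_\<sigma>')
lemma cut_emb [simp]: "cut (emb v) = emb v" by (auto simp: emb_def cut_def wsub_def fun_eq_iff)
lemma emb_\<sigma> [simp]: "emb v (\<sigma> m) = v m" by (simp add: emb_def wsub_def)

lemma bounded_emb: "bounded_operator emb"
  unfolding emb_def
proof (rule bounded_operator_wsub[of _ 1])
  show "inj_on \<sigma>' {i. (if in_range i then 1 else 0) \<noteq> (0::complex)}"
    by (rule inj_on_inverseI[of _ \<sigma>]) (auto simp: \<sigma>_\<sigma>' split: if_splits)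
qed auto

lemma bounded_res: "bounded_operator res"
  unfolding res_def by (rule bounded_operator_wsub[of _ 1]) (use inj_\<sigma> in \<open>auto simp: inj_on_def\<close>)

lemma adjoint_res: "adjoint_pair res emb" and adjoint_emb: "adjoint_pair emb res"
  unfolding res_def emb_def by (rule adjoint_pair_wsub; auto simp: \<sigma>_\<sigma>' split: if_splits)+

text \<open>Commuting with the projection to the chosen positions makes the compression multiplicative.\<close>

definition compatible :: "sphere set" where
  "compatible = {X \<in> carrier (S3 p q \<theta>). \<forall>v. sphere_act X (cut v) = cut (sphere_act X v)}"

definition rep :: "sphere \<Rightarrow> vec \<Rightarrow> vec" where
  "rep X v = res (sphere_act X (emb v))"

lemma cut_linear: "cut (\<lambda>i. v i + w i) = (\<lambda>i. cut v i + cut w i)" "cut (\<lambda>i. c * v i) = (\<lambda>i. c * cut v i)"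
  by (auto simp: cut_def)

lemma compatible_wsub:
  assumes "X \<in> carrier (S3 p q \<theta>)" "\<And>v. sphere_act X v = wsub g h v"
    "\<And>j. g j \<noteq> 0 \<Longrightarrow> in_range (h j) \<longleftrightarrow> in_range j"
  shows "X \<in> compatible"
  using assms by (auto simp: compatible_def cut_def wsub_def fun_eq_iff)

lemma rep_wsub:
  assumes "\<And>v. sphere_act X v = wsub g h v" "g (\<sigma> m) \<noteq> 0 \<Longrightarrow> h (\<sigma> m) = \<sigma> m'"
  shows "rep X v m = g (\<sigma> m) * v m'"
  using assms by (cases "g (\<sigma> m) = 0") (auto simp: rep_def res_def wsub_def)

lemma C_shift_in_range: "C_weight j \<noteq> 0 \<Longrightarrow> in_range (C_shift j) \<longleftrightarrow> in_range j"
proof -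
  assume nz: "C_weight j \<noteq> 0"
  show ?thesis
  proof (cases "j \<ge> 0")
    case True
    then have "j \<ge> int l" using nz prod_alpha_zero[of j] by (force simp: C_weight_def)
    then show ?thesis using True by (simp add: in_range_def C_shift_def)
  next
    case False
    have "(- (j - int k) - 1) mod int k = (- j - 1 + int k) mod int k" by (simp add: algebra_simps)
    then show ?thesis using False by (simp add: in_range_def C_shift_def)
  qed
qed

lemma C'_shift_in_range: "C'_weight j \<noteq> 0 \<Longrightarrow> in_range (C'_shift j) \<longleftrightarrow> in_range j"
proof -
  assume nz: "C'_weight j \<noteq> 0"
  show ?thesis
  proof (cases "j \<ge> 0")
    case True
    then show ?thesis by (simp add: in_range_def C'_shift_def)
  next
    case False
    then have neg: "j + int k < 0" using nz prod_beta_zero[of j] by (force simp: C'_weight_def)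
    have "(- (j + int k) - 1) mod int k = (- j - 1 - int k) mod int k" by (simp add: algebra_simps)
    then show ?thesis using False neg by (simp add: in_range_def C'_shift_def)
  qed
qed

text \<open>The factor in \<open>C f\<^sub>m = weight m f\<^sub>m\<^sub>+\<^sub>1\<close>. It vanishes for \<open>m = - 1\<close>, even where some of the square
  roots are taken of negative numbers.\<close>

definition weight :: "int \<Rightarrow> real" where
  "weight m = (if m \<ge> 0 then \<Prod>j=1..l. sqrt (1 - p powi (int j + m * int l + int s))
     else \<Prod>j=1..k. sqrt (1 - q powi (int j + (- m - 2) * int k + int t)))"

lemma period_prod:
  fixes F :: "int \<Rightarrow> complex"
  assumes "c < N" "J mod int N = int c"
  shows "(\<Prod>i<N. (if (J + int i) mod int N = int c then F (J + int i) else 1)) = F J"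
proof -
  have "(J + int i) mod int N = int c \<longleftrightarrow> i = 0" if "i < N" for i
  proof -
    have "(J + int i) mod int N = int c \<longleftrightarrow> (J + int i) mod int N = J mod int N" using assms by simp
    also have "\<dots> \<longleftrightarrow> int N dvd int i" by (simp add: mod_eq_dvd_iff)
    also have "\<dots> \<longleftrightarrow> i = 0" using that by (auto dest: dvd_imp_le)
    finally show ?thesis .
  qed
  then have "(\<Prod>i<N. (if (J + int i) mod int N = int c then F (J + int i) else 1)) = (\<Prod>i<N. if i = 0 then F J else 1)"
    by (intro prod.cong) auto
  then show ?thesis using assms by simp
qed

text \<open>A period contains one index with a phase, and by the choice of the phases this one is \<open>J\<close>.\<close>

lemma prod_alpha:
  assumes "J mod int l = int s"
  shows "(\<Prod>i<l. alpha (J + int i)) = lam (- (J * int k)) * of_real (\<Prod>j=1..l. sqrt (1 - p powi (int j + J)))"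
proof -
  have "(\<Prod>j=1..l. sqrt (1 - p powi (int j + J))) = (\<Prod>i<l. sqrt (1 - p powi (J + int i + 1)))"
    unfolding One_nat_def prod.atLeast1_atMost_eq by (intro prod.cong) (auto simp: algebra_simps)
  then show ?thesis
    using period_prod[OF st(1) assms, of "\<lambda>j. lam (- (j * int k))"] by (simp add: alpha_def prod.distrib)
qed

lemma prod_beta:
  assumes "J mod int k = int t"
  shows "(\<Prod>i<k. beta (J + int i)) = lam (J * int l) * of_real (\<Prod>j=1..k. sqrt (1 - q powi (int j + J)))"
proof -
  have "(\<Prod>j=1..k. sqrt (1 - q powi (int j + J))) = (\<Prod>i<k. sqrt (1 - q powi (J + int i + 1)))"
    unfolding One_nat_def prod.atLeast1_atMost_eq by (intro prod.cong) (auto simp: algebra_simps)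
  then show ?thesis
    using period_prod[OF st(2) assms, of "\<lambda>j. lam (j * int l)"] by (simp add: beta_def prod.distrib)
qed

lemma prod_reverse: "(\<Prod>i<N. F (J - 1 - int i)) = (\<Prod>i<N. F (J - int N + int i) :: complex)"
  by (rule prod.reindex_bij_witness[of _ "\<lambda>i. N - 1 - i" "\<lambda>i. N - 1 - i"]) (auto simp: of_nat_diff algebra_simps)

lemma weight_minus_one [simp]: "weight (- 1) = 0"
proof -
  have "(\<Prod>j=1..k. sqrt (1 - q powi (int j + (- 1) * int k + int t))) = 0"
    using st by (intro prod_zero bexI[of _ "k - t"]) auto
  then show ?thesis by (simp add: weight_def)
qed

lemma C_weight_\<sigma>: "C_weight (\<sigma> m) = of_real (weight (m - 1))"
proof (cases "m \<ge> 0")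
  case True
  let ?J = "(m - 1) * int l + int s"
  have J: "\<sigma> m = ?J + int l" "?J mod int l = int s" using True st by (auto simp: \<sigma>_def algebra_simps)
  have "C_weight (\<sigma> m) = (\<Prod>i<l. alpha (?J + int i)) * lam (int k * ?J)"
    using True \<sigma>_sign[of m] prod_reverse[of alpha "?J + int l" l] unfolding C_weight_def J(1) by simp
  also have "\<dots> = of_real (\<Prod>j=1..l. sqrt (1 - p powi (int j + ?J)))"
    unfolding prod_alpha[OF J(2)] by (simp add: mult_ac lam_cancel_left)
  also have "\<dots> = of_real (weight (m - 1))"
  proof (cases "m = 0")
    case True
    then have "(\<Prod>j=1..l. sqrt (1 - p powi (int j + ?J))) = 0"
      using st by (intro prod_zero bexI[of _ "l - s"]) auto
    then show ?thesis using True by simp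
  next
    case False
    then show ?thesis using True by (simp add: weight_def add.assoc)
  qed
  finally show ?thesis .
next
  case False
  let ?J = "(- m - 1) * int k + int t"
  have J: "- \<sigma> m - 1 = ?J" "?J mod int k = int t" using False st by (auto simp: \<sigma>_def)
  have e: "- (m - 1) - 2 = - m - 1" by simp
  have "C_weight (\<sigma> m) = lam (int l * ?J) * cnj (\<Prod>i<k. beta (?J + int i))"
    using False \<sigma>_sign[of m] unfolding C_weight_def J(1) by simp
  also have "\<dots> = of_real (\<Prod>j=1..k. sqrt (1 - q powi (int j + ?J)))"
    unfolding prod_beta[OF J(2)] by (simp add: mult_ac lam_cancel_left)
  also have "\<dots> = of_real (weight (m - 1))"
    using False unfolding weight_def e by (simp add: add.assoc)
  finally show ?thesis .
qed

lemma C'_weight_\<sigma>: "C'_weight (\<sigma> m) = of_real (weight m)"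
proof (cases "m \<ge> 0")
  case True
  let ?J = "m * int l + int s"
  have J: "\<sigma> m = ?J" "?J mod int l = int s" using True st by (auto simp: \<sigma>_def)
  have "C'_weight (\<sigma> m) = lam (- int k * ?J) * cnj (\<Prod>i<l. alpha (?J + int i))"
    using True \<sigma>_sign[of m] unfolding C'_weight_def J(1) by simp
  also have "\<dots> = of_real (\<Prod>j=1..l. sqrt (1 - p powi (int j + ?J)))"
    unfolding prod_alpha[OF J(2)] by (simp add: mult_ac lam_cancel_left)
  finally show ?thesis using True by (simp add: weight_def add.assoc)
next
  case False
  let ?J = "(- m - 2) * int k + int t"
  have J: "- \<sigma> m - 1 = ?J + int k" using False by (simp add: \<sigma>_def algebra_simps)
  have J2: "?J mod int k = int t" using st by simp
  have e: "- \<sigma> m - 2 = (?J + int k) - 1" "\<sigma> m + int k + 1 = - ?J" using J by linarith+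
  have "C'_weight (\<sigma> m) = (\<Prod>i<k. beta (?J + int i)) * lam (int l * (- ?J))"
    using False \<sigma>_sign[of m] prod_reverse[of beta "?J + int k" k] unfolding C'_weight_def e by simp
  also have "\<dots> = of_real (\<Prod>j=1..k. sqrt (1 - q powi (int j + ?J)))"
  proof -
    have c: "lam (?J * int l) * lam (int l * (- ?J)) = 1" by (rule lam_cancel) (simp add: algebra_simps)
    have "lam (?J * int l) * X * lam (int l * (- ?J)) = lam (?J * int l) * lam (int l * (- ?J)) * X" for X
      by (simp only: mult_ac)
    then show ?thesis by (simp only: prod_beta[OF J2] c mult_1)
  qed
  finally show ?thesis using False by (simp add: weight_def add.assoc)
qed

definition zeta :: "int \<Rightarrow> complex" where
  "zeta m = (if m \<ge> 0 then of_real (p powi (m * int l + int s)) else 0)"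

definition eta :: "int \<Rightarrow> complex" where
  "eta m = (if m \<ge> 0 then 0 else of_real (q powi ((- m - 1) * int k + int t)))"

lemma rep_z: "rep S.z v m = zeta m * v m"
  using \<sigma>_sign[of m] by (simp add: rep_def act_z res_def wsub_def zeta_def) (simp add: \<sigma>_def)

lemma rep_w: "rep S.w v m = eta m * v m"
  using \<sigma>_sign[of m] by (simp add: rep_def act_w res_def wsub_def eta_def) (simp add: \<sigma>_def)

lemma rep_C: "rep S.C v m = of_real (weight (m - 1)) * v (m - 1)"
  unfolding C_weight_\<sigma>[symmetric]
proof (rule rep_wsub[OF act_C])
  assume "C_weight (\<sigma> m) \<noteq> 0"
  then have "m \<noteq> 0" by (auto simp: C_weight_\<sigma>)
  then show "C_shift (\<sigma> m) = \<sigma> (m - 1)"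
    using \<sigma>_sign[of m] by (auto simp: C_shift_def) (auto simp: \<sigma>_def algebra_simps)
qed

lemma rep_star_C: "rep (star (S3 p q \<theta>) S.C) v m = of_real (weight m) * v (m + 1)"
  unfolding C'_weight_\<sigma>[symmetric]
proof (rule rep_wsub[OF act_star_C])
  assume "C'_weight (\<sigma> m) \<noteq> 0"
  then have "m \<noteq> - 1" by (auto simp: C'_weight_\<sigma>)
  then show "C'_shift (\<sigma> m) = \<sigma> (m + 1)"
    using \<sigma>_sign[of m] by (auto simp: C'_shift_def) (auto simp: \<sigma>_def algebra_simps)
qed

end


context sphere_representation
begin

lemma base_compatible: "X \<in> S.base \<Longrightarrow> X \<in> compatible"
proof -
  let ?S = "{X \<in> carrier (S3 p q \<theta>). X \<in> compatible \<and> star (S3 p q \<theta>) X \<in> compatible}"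
  have "star_subalgebra ?S (S3 p q \<theta>)"
    by (rule S.star_subalgebraI)
      (auto simp: compatible_def sphere_act_add sphere_act_mult sphere_act_smult sphere_act_one
        S.star_add S.star_mult S.star_smult cut_linear)
  moreover have "S.z \<in> compatible" "S.w \<in> compatible"
    by (auto simp: compatible_def act_z act_w cut_def fun_eq_iff)
  moreover have "S.C \<in> compatible" "star (S3 p q \<theta>) S.C \<in> compatible"
    using compatible_wsub[OF _ act_C C_shift_in_range] compatible_wsub[OF _ act_star_C C'_shift_in_range]
      S.base_carrier[OF S.zwC_base(3)] by auto
  ultimately have "S.base \<subseteq> ?S"
    unfolding S.base_def using S.base_carrier[OF S.zwC_base(3)]
    by (intro S.generated_star_subalgebra_least) auto
  then show "X \<in> S.base \<Longrightarrow> X \<in> compatible" by blast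
qed

lemma rep_add: "X \<in> carrier (S3 p q \<theta>) \<Longrightarrow> Y \<in> carrier (S3 p q \<theta>) \<Longrightarrow>
    rep (X \<oplus>\<^bsub>S3 p q \<theta>\<^esub> Y) v = (\<lambda>i. rep X v i + rep Y v i)"
  by (simp add: rep_def sphere_act_add res_def wsub_def)

lemma rep_smult: "X \<in> carrier (S3 p q \<theta>) \<Longrightarrow>
    rep (c \<odot>\<^bsub>S3 p q \<theta>\<^esub> X) v = (\<lambda>i. c * rep X v i)"
  by (simp add: rep_def sphere_act_smult res_def wsub_def)

lemma rep_one: "rep \<one>\<^bsub>S3 p q \<theta>\<^esub> v = v"
  by (simp add: rep_def sphere_act_one)

lemma rep_mult:
  assumes "X \<in> S.base" "Y \<in> S.base"
  shows "rep (X \<otimes>\<^bsub>S3 p q \<theta>\<^esub> Y) v = rep X (rep Y v)"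
proof -
  have "sphere_act Y (emb v) = emb (rep Y v)"
    using base_compatible[OF assms(2)] unfolding rep_def emb_res compatible_def by (metis (mono_tags, lifting) cut_emb mem_Collect_eq)
  then show ?thesis using assms by (simp add: rep_def sphere_act_mult S.base_carrier)
qed

lemma bounded_rep:
  assumes "X \<in> carrier (S3 p q \<theta>)" shows "bounded_operator (rep X)"
  unfolding rep_def[abs_def]
  by (rule bounded_operator_compose[where T = res and U = "\<lambda>v. sphere_act X (emb v)", OF bounded_res
        bounded_operator_compose[where T = "sphere_act X" and U = emb, OF bounded_sphere_act[OF assms] bounded_emb]])

lemma adjoint_rep:
  assumes "X \<in> carrier (S3 p q \<theta>)" shows "adjoint_pair (rep X) (rep (star (S3 p q \<theta>) X))"
proof -
  have "adjoint_pair (\<lambda>v. sphere_act X (emb v)) (\<lambda>v. res (sphere_act (star (S3 p q \<theta>) X) v))"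
    using assms by (intro adjoint_pair_compose[where T = "sphere_act X" and U = emb]
        adjoint_sphere_act adjoint_emb bounded_sphere_act bounded_emb) auto
  then show ?thesis
    unfolding rep_def[abs_def] using assms
    by (intro adjoint_pair_compose[where T = res and U = "\<lambda>v. sphere_act X (emb v)" and T' = emb
          and U' = "\<lambda>v. res (sphere_act (star (S3 p q \<theta>) X) v)"] adjoint_res bounded_emb
        bounded_operator_compose[where T = "sphere_act X" and U = emb] bounded_sphere_act) auto
qed

lemma S2_base: "S2 p q \<theta> k l = (S3 p q \<theta>)\<lparr>carrier := S.base\<rparr>"
  by (rule S2_eq[OF p(1) q(1) kl])

lemma star_representation_S2I:
  assumes "\<And>X. X \<in> S.base \<Longrightarrow> bounded_operator (\<pi> X)"
    "\<And>v. \<pi> \<one>\<^bsub>S3 p q \<theta>\<^esub> v = v"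
    "\<And>X Y v. X \<in> S.base \<Longrightarrow> Y \<in> S.base \<Longrightarrow> \<pi> (X \<oplus>\<^bsub>S3 p q \<theta>\<^esub> Y) v = (\<lambda>i. \<pi> X v i + \<pi> Y v i)"
    "\<And>X Y v. X \<in> S.base \<Longrightarrow> Y \<in> S.base \<Longrightarrow> \<pi> (X \<otimes>\<^bsub>S3 p q \<theta>\<^esub> Y) v = \<pi> X (\<pi> Y v)"
    "\<And>c X v. X \<in> S.base \<Longrightarrow> \<pi> (c \<odot>\<^bsub>S3 p q \<theta>\<^esub> X) v = (\<lambda>i. c * \<pi> X v i)"
    "\<And>X. X \<in> S.base \<Longrightarrow> adjoint_pair (\<pi> X) (\<pi> (star (S3 p q \<theta>) X))"
  shows "star_representation (S2 p q \<theta> k l) \<pi>"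
  using assms unfolding star_representation_def S2_base adjoint_pair_def by auto

lemma rep_star_representation: "star_representation (S2 p q \<theta> k l) rep"
  by (rule star_representation_S2I)
    (simp_all add: bounded_rep rep_one rep_add rep_mult rep_smult adjoint_rep S.base_carrier)


subsection \<open>The symbol\<close>

definition r :: real where "r = sqrt (max p q)"

lemma r_square: "r * r = max p q" using p by (simp add: r_def)

sublocale decay r
  by unfold_locales (use p q in \<open>auto simp: r_def\<close>)

lemma \<omega>_square: "\<omega> m * \<omega> m = max p q ^ nat \<bar>m\<bar>"
  unfolding \<omega>_def r_square[symmetric] by (simp add: power_mult_distrib)

lemma powi_bound:
  assumes "x = p \<or> x = q" "e \<ge> \<bar>m\<bar>" shows "x powi e \<le> \<omega> m * \<omega> m"
proof -
  have x: "0 < x" "x < 1" "x \<le> max p q" using assms p q by auto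
  have "x powi e = x ^ nat e" using assms(2) by (simp add: power_int_def)
  also have "\<dots> \<le> x ^ nat \<bar>m\<bar>" using x assms(2) by (intro power_decreasing) auto
  also have "\<dots> \<le> max p q ^ nat \<bar>m\<bar>" using x by (intro power_mono) auto
  finally show ?thesis by (simp add: \<omega>_square)
qed

lemma prod_sqrt_bound:
  assumes x: "x = p \<or> x = q" and e: "\<And>j. j \<in> {1..N} \<Longrightarrow> e j \<ge> 0"
    and b: "\<And>j. j \<in> {1..N} \<Longrightarrow> x powi e j \<le> B"
  shows "\<bar>(\<Prod>j=1..N. sqrt (1 - x powi e j)) - 1\<bar> \<le> real N * B"
proof -
  have x01: "0 < x" "x < 1" using x p q by auto
  have y: "0 < x powi e j" "x powi e j \<le> 1" if "j \<in> {1..N}" for j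
    using x01 e[OF that] powi_le_one by (auto intro: zero_less_power_int)
  have "\<bar>sqrt (1 - y) - 1\<bar> \<le> y" if "0 < y" "y \<le> 1" for y :: real
  proof -
    have "(1 - y)\<^sup>2 \<le> 1 - y" using that by (simp add: power2_eq_square mult_left_le)
    then have "1 - y \<le> sqrt (1 - y)" by (rule real_le_rsqrt)
    moreover have "sqrt (1 - y) \<le> 1" using that by simp
    ultimately show ?thesis by simp
  qed
  note s = this
  have "norm ((\<Prod>j=1..N. sqrt (1 - x powi e j)) - (\<Prod>j=1..N. 1)) \<le> (\<Sum>j=1..N. norm (sqrt (1 - x powi e j) - 1))"
    using y by (intro norm_prod_diff) (auto simp: less_imp_le)
  also have "\<dots> \<le> (\<Sum>j=1..N. B)"
  proof (rule sum_mono)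
    fix j assume j: "j \<in> {1..N}"
    show "norm (sqrt (1 - x powi e j) - 1) \<le> B"
      unfolding real_norm_def by (rule order_trans[OF s[OF y[OF j]] b[OF j]])
  qed
  finally show ?thesis by simp
qed

text \<open>For negative \<open>m\<close> an exponent can be smaller by one than the absolute value of \<open>m\<close>; the denominator
  compensates for this.\<close>

lemma weight_bound: "\<bar>weight m - 1\<bar> \<le> (real (k + l) / (r * r)) * \<omega> m * \<omega> m"
proof -
  have r1: "0 < r * r" "r * r < 1" using p q by (auto simp: r_square)
  have grow: "e \<le> f \<Longrightarrow> 0 \<le> B \<Longrightarrow> real e * B \<le> real f * B / (r * r)" for e f B
  proof -
    assume a: "e \<le> f" "0 \<le> B"
    have "real e * B \<le> real f * B * 1" using a by (simp add: mult_right_mono)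
    also have "\<dots> \<le> real f * B * (1 / (r * r))" using r1 a by (intro mult_left_mono) auto
    finally show ?thesis by simp
  qed
  consider "m \<ge> 0" | "m = - 1" | "m \<le> - 2" by linarith
  then show ?thesis
  proof cases
    case 1
    have ge: "int j + m * int l + int s \<ge> \<bar>m\<bar>" if "j \<in> {1..l}" for j
    proof -
      have "m * int l \<ge> m * 1" using 1 kl by (intro mult_left_mono) auto
      then show ?thesis using 1 by simp
    qed
    have "\<bar>weight m - 1\<bar> \<le> real l * (\<omega> m * \<omega> m)"
      using 1 ge unfolding weight_def by (simp only: if_True) (intro prod_sqrt_bound powi_bound; force)
    also have "\<dots> \<le> real (k + l) * (\<omega> m * \<omega> m) / (r * r)" by (rule grow) auto
    finally show ?thesis by (simp add: mult.assoc)
  next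
    case 2
    then show ?thesis using r1 kl r by (simp add: \<omega>_def)
  next
    case 3
    have ge: "int j + (- m - 2) * int k + int t \<ge> \<bar>m + 1\<bar>" if "j \<in> {1..k}" for j
    proof -
      have "(- m - 2) * int k \<ge> (- m - 2) * 1" using 3 kl by (intro mult_left_mono) auto
      then show ?thesis using 3 that by auto
    qed
    have w: "\<omega> m = \<omega> (m + 1) * r"
    proof -
      have "nat \<bar>m\<bar> = Suc (nat \<bar>m + 1\<bar>)" using 3 by simp
      then show ?thesis unfolding \<omega>_def by (simp only: power_Suc mult.commute)
    qed
    have "\<bar>weight m - 1\<bar> \<le> real k * (\<omega> (m + 1) * \<omega> (m + 1))"
    proof -
      have "\<not> 0 \<le> m" using 3 by simp
      then show ?thesis unfolding weight_def if_not_P[OF \<open>\<not> 0 \<le> m\<close>]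
        using ge by (intro prod_sqrt_bound powi_bound) force+
    qed
    also have "\<dots> \<le> real (k + l) * (\<omega> (m + 1) * \<omega> (m + 1))" by (intro mult_right_mono) auto
    also have "\<dots> = (real (k + l) / (r * r)) * \<omega> m * \<omega> m" using r by (simp add: w)
    finally show ?thesis .
  qed
qed

lemma symbol_z: "has_symbol (rep S.z) 0" and symbol_w: "has_symbol (rep S.w) 0"
proof -
  have "cmod (zeta m) \<le> 1 * \<omega> m * \<omega> m" for m
  proof (cases "m \<ge> 0")
    case True
    have "m * int l \<ge> m * 1" using True kl by (intro mult_left_mono) auto
    then have "p powi (m * int l + int s) \<le> \<omega> m * \<omega> m" using True by (intro powi_bound) auto
    then show ?thesis using True p by (simp add: zeta_def norm_power_int)
  qed (simp add: zeta_def)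
  from has_symbol_diag[OF this] show "has_symbol (rep S.z) 0" by (simp add: rep_z[abs_def])
  have "cmod (eta m) \<le> (1 / (r * r)) * \<omega> m * \<omega> m" for m
  proof (cases "m \<ge> 0")
    case False
    have "(- m - 1) * int k \<ge> (- m - 1) * 1" using False kl by (intro mult_left_mono) auto
    then have "q powi ((- m - 1) * int k + int t) \<le> \<omega> (m + 1) * \<omega> (m + 1)" using False by (intro powi_bound) auto
    moreover have "nat \<bar>m\<bar> = Suc (nat \<bar>m + 1\<bar>)" using False by simp
    then have "\<omega> m = \<omega> (m + 1) * r" unfolding \<omega>_def by (simp only: power_Suc mult.commute)
    ultimately show ?thesis using False q r by (simp add: eta_def norm_power_int)
  qed (use r_square p in \<open>simp add: eta_def\<close>)
  from has_symbol_diag[OF this] show "has_symbol (rep S.w) 0" by (simp add: rep_w[abs_def])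
qed

lemma symbol_C: "has_symbol (rep S.C) (Poly_Mapping.single 1 1)"
  and symbol_star_C: "has_symbol (rep (star (S3 p q \<theta>) S.C)) (Poly_Mapping.single (- 1) 1)"
proof -
  let ?K = "real (k + l) / (r * r)"
  have n: "cmod (of_real (weight m) - 1) = \<bar>weight m - 1\<bar>" for m
    by (metis norm_of_real of_real_1 of_real_diff real_norm_def)
  have K: "?K \<ge> 0" using r_square p by simp
  have "cmod (of_real (weight (m - 1)) - 1) \<le> (?K / (\<omega> 1 * \<omega> 1)) * \<omega> m * \<omega> m" for m
  proof -
    have "\<bar>weight (m - 1) - 1\<bar> \<le> ?K * (\<omega> (m - 1) * \<omega> (m - 1))" using weight_bound[of "m - 1"] by (simp add: mult.assoc)
    also have "\<dots> \<le> ?K * ((\<omega> m / \<omega> 1) * (\<omega> m / \<omega> 1))"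
      using K by (intro mult_left_mono mult_mono \<omega>_shift) auto
    finally show ?thesis by (simp add: n mult_ac)
  qed
  from has_symbol_shift[OF this, of 1] show "has_symbol (rep S.C) (Poly_Mapping.single 1 1)"
    by (simp add: rep_C[abs_def])
  have "cmod (of_real (weight m) - 1) \<le> ?K * \<omega> m * \<omega> m" for m
    using weight_bound[of m] by (simp add: n)
  from has_symbol_shift[OF this, of "- 1"] show "has_symbol (rep (star (S3 p q \<theta>) S.C)) (Poly_Mapping.single (- 1) 1)"
    by (simp add: rep_star_C[abs_def])
qed

lemma rep_ext:
  assumes "X \<in> S.base" "Y \<in> S.base"
  shows "rep (X \<oplus>\<^bsub>S3 p q \<theta>\<^esub> Y) = (\<lambda>v i. rep X v i + rep Y v i)"
    "rep (X \<otimes>\<^bsub>S3 p q \<theta>\<^esub> Y) = (\<lambda>v. rep X (rep Y v))"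
    "rep (c \<odot>\<^bsub>S3 p q \<theta>\<^esub> X) = (\<lambda>v i. c * rep X v i)"
  using assms by (auto simp: rep_add rep_mult rep_smult S.base_carrier)

text \<open>In the limit \<open>z\<close> and \<open>w\<close> vanish and \<open>C\<close> becomes the bilateral shift.\<close>

lemma base_has_symbol:
  assumes "X \<in> S.base"
  shows "\<exists>T. has_symbol (rep X) T \<and> has_symbol (rep (star (S3 p q \<theta>) X)) (laurent_star T)"
proof -
  let ?P = "\<lambda>X T. has_symbol (rep X) T \<and> has_symbol (rep (star (S3 p q \<theta>) X)) (laurent_star T)"
  let ?S = "{X \<in> S.base. \<exists>T. ?P X T}"
  have "star_subalgebra ?S (S3 p q \<theta>)"
  proof (rule S.star_subalgebraI)
    have "rep \<one>\<^bsub>S3 p q \<theta>\<^esub> = (\<lambda>v. v)" by (simp add: rep_one fun_eq_iff)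
    moreover have "laurent_star 1 = 1" using laurent_star_single[of 0 1] by simp
    ultimately have "?P \<one>\<^bsub>S3 p q \<theta>\<^esub> 1" using has_symbol_id by simp
    then show "\<one>\<^bsub>S3 p q \<theta>\<^esub> \<in> ?S" using S.base_closed(2) by blast
  next
    fix X Y assume XY: "X \<in> ?S" "Y \<in> ?S"
    then obtain T U where TU: "?P X T" "?P Y U" by blast
    have b: "X \<in> S.base" "Y \<in> S.base" using XY by auto
    note bs = S.base_closed(9)[OF b(1)] S.base_closed(9)[OF b(2)]
    have "?P (X \<oplus>\<^bsub>S3 p q \<theta>\<^esub> Y) (T + U)"
      using TU has_symbol_add b bs by (simp add: S.star_add S.base_carrier rep_ext laurent_star_add)
    then show "X \<oplus>\<^bsub>S3 p q \<theta>\<^esub> Y \<in> ?S" using b S.base_closed(4) by blast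
    have "?P (X \<otimes>\<^bsub>S3 p q \<theta>\<^esub> Y) (T * U)"
      using TU has_symbol_mult[of "rep X" T "rep Y" U]
        has_symbol_mult[of "rep (star (S3 p q \<theta>) Y)" "laurent_star U" "rep (star (S3 p q \<theta>) X)" "laurent_star T"] b bs
      by (simp add: S.star_mult S.base_carrier rep_ext laurent_star_mult mult.commute)
    then show "X \<otimes>\<^bsub>S3 p q \<theta>\<^esub> Y \<in> ?S" using b S.base_closed(7) by blast
  next
    fix X c assume X: "X \<in> ?S"
    then obtain T where T: "?P X T" by blast
    have b: "X \<in> S.base" "star (S3 p q \<theta>) X \<in> S.base" using X S.base_closed(9) by auto
    have "?P (c \<odot>\<^bsub>S3 p q \<theta>\<^esub> X) (Poly_Mapping.single 0 c * T)"
      using T has_symbol_scale b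
      by (simp add: S.star_smult S.base_carrier rep_ext(3)[OF _ b(1)] laurent_star_mult laurent_star_single)
    then show "c \<odot>\<^bsub>S3 p q \<theta>\<^esub> X \<in> ?S" using b S.base_closed(8) by blast
    have "?P (star (S3 p q \<theta>) X) (laurent_star T)" using T b by (simp add: S.base_carrier)
    then show "star (S3 p q \<theta>) X \<in> ?S" using b by blast
  qed (use S.base_carrier in auto)
  moreover have "laurent_star 0 = 0" using laurent_star_single[of 0 0] by simp
  then have "?P S.z 0" "?P S.w 0" "?P S.C (Poly_Mapping.single 1 1)"
    using symbol_z symbol_w symbol_C symbol_star_C by (simp_all add: laurent_star_single)
  then have "{S.z, S.w, S.C} \<subseteq> ?S" using S.zwC_base by blast
  ultimately have "S.base \<subseteq> ?S" unfolding S.base_def by (rule S.generated_star_subalgebra_least)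
  then show ?thesis using assms by blast
qed

definition symbol :: "sphere \<Rightarrow> int \<Rightarrow>\<^sub>0 complex" where
  "symbol X = (THE T. has_symbol (rep X) T)"

lemma symbol_eq: "has_symbol (rep X) T \<Longrightarrow> symbol X = T"
  unfolding symbol_def using has_symbol_unique by blast

lemma has_symbol_symbol: "X \<in> S.base \<Longrightarrow> has_symbol (rep X) (symbol X)"
  using base_has_symbol symbol_eq by blast

text \<open>The representation \<open>\<pi>\<^sub>c\<close> is the behaviour at infinity of \<open>\<pi>\<^sub>s\<^sub>,\<^sub>t\<close>. Since symbols are unique, it
  inherits all laws of a representation.\<close>

definition limit_rep :: "sphere \<Rightarrow> vec \<Rightarrow> vec" where
  "limit_rep X = toeplitz (symbol X)"

lemma symbol_hom:
  assumes "X \<in> S.base" "Y \<in> S.base"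
  shows "symbol (X \<oplus>\<^bsub>S3 p q \<theta>\<^esub> Y) = symbol X + symbol Y"
    "symbol (X \<otimes>\<^bsub>S3 p q \<theta>\<^esub> Y) = symbol X * symbol Y"
    "symbol (c \<odot>\<^bsub>S3 p q \<theta>\<^esub> X) = Poly_Mapping.single 0 c * symbol X"
    "symbol (star (S3 p q \<theta>) X) = laurent_star (symbol X)"
proof -
  note h = has_symbol_symbol[OF assms(1)] has_symbol_symbol[OF assms(2)]
  show "symbol (X \<oplus>\<^bsub>S3 p q \<theta>\<^esub> Y) = symbol X + symbol Y"
    using has_symbol_add[OF h] assms by (intro symbol_eq) (simp add: rep_ext)
  show "symbol (X \<otimes>\<^bsub>S3 p q \<theta>\<^esub> Y) = symbol X * symbol Y"
    using has_symbol_mult[OF h] assms by (intro symbol_eq) (simp add: rep_ext)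
  show "symbol (c \<odot>\<^bsub>S3 p q \<theta>\<^esub> X) = Poly_Mapping.single 0 c * symbol X"
    using has_symbol_scale[OF h(1)] assms by (intro symbol_eq) (simp add: rep_ext(3)[OF _ assms(1)])
  show "symbol (star (S3 p q \<theta>) X) = laurent_star (symbol X)"
    using base_has_symbol[OF assms(1)] symbol_eq by blast
qed

lemma symbol_one: "symbol \<one>\<^bsub>S3 p q \<theta>\<^esub> = 1"
  using has_symbol_id by (intro symbol_eq) (simp add: rep_one[abs_def])

lemma limit_rep_star_representation: "star_representation (S2 p q \<theta> k l) limit_rep"
  by (rule star_representation_S2I)
    (simp_all add: limit_rep_def bounded_toeplitz symbol_hom(1,2,4) symbol_hom(3)[OF _ S.base_closed(2)] symbol_one shift.act_add shift.act_mult
      shift.act_scal_mult adjoint_toeplitz fun_eq_iff shift.\<phi>_zero)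


subsection \<open>Uniqueness of the representations\<close>

text \<open>Because adjoints are prescribed, a representation is determined on all vectors by the
  generators on basis vectors: a coordinate of \<open>\<pi> X v\<close> is an inner product of \<open>v\<close> with a value of
  \<open>\<pi> X*\<close> on a basis vector.\<close>

lemma star_representation_unique:
  assumes \<pi>: "star_representation (S2 p q \<theta> k l) \<pi>" and \<pi>': "star_representation (S2 p q \<theta> k l) \<pi>'"
    and gens: "\<And>g m. g \<in> {S.z, S.w, S.C} \<Longrightarrow> \<pi> g (basis_vec m) = \<pi>' g (basis_vec m)"
    and X: "X \<in> S.base" and v: "v \<in> ell2"
  shows "\<pi> X v = \<pi>' X v"
proof -
  let ?st = "star (S3 p q \<theta>)"
  have adj: "ell2_inner (\<rho> (?st X) v) w = ell2_inner v (\<rho> X w)"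
    if "star_representation (S2 p q \<theta> k l) \<rho>" "X \<in> S.base" "v \<in> ell2" "w \<in> ell2" for \<rho> X v w
    using that unfolding star_representation_def S2_base by simp
  have hom: "\<rho> (X \<oplus>\<^bsub>S3 p q \<theta>\<^esub> Y) v = (\<lambda>i. \<rho> X v i + \<rho> Y v i)" "\<rho> (X \<otimes>\<^bsub>S3 p q \<theta>\<^esub> Y) v = \<rho> X (\<rho> Y v)"
    "\<rho> (c \<odot>\<^bsub>S3 p q \<theta>\<^esub> X) v = (\<lambda>i. c * \<rho> X v i)" "\<rho> \<one>\<^bsub>S3 p q \<theta>\<^esub> v = v" "\<rho> X v \<in> ell2"
    if "star_representation (S2 p q \<theta> k l) \<rho>" "X \<in> S.base" "Y \<in> S.base" "v \<in> ell2" for \<rho> X Y v c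
    using that unfolding star_representation_def S2_base by (simp_all add: bounded_operatorD(1))
  have star_eq: "\<pi> (?st Y) v = \<pi>' (?st Y) v"
    if Y: "Y \<in> S.base" "\<And>m. \<pi> Y (basis_vec m) = \<pi>' Y (basis_vec m)" and v: "v \<in> ell2" for Y v
  proof
    fix i
    have "cnj (\<pi> (?st Y) v i) = cnj (\<pi>' (?st Y) v i)"
      using adj[OF \<pi> Y(1) v basis_vec_ell2[of i]] adj[OF \<pi>' Y(1) v basis_vec_ell2[of i]] Y(2)[of i] by simp
    then show "\<pi> (?st Y) v i = \<pi>' (?st Y) v i" by simp
  qed
  let ?S = "{X \<in> S.base. \<forall>v\<in>ell2. \<pi> X v = \<pi>' X v \<and> \<pi> (?st X) v = \<pi>' (?st X) v}"
  have "star_subalgebra ?S (S3 p q \<theta>)"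
  proof (rule S.star_subalgebraI)
    show "\<one>\<^bsub>S3 p q \<theta>\<^esub> \<in> ?S"
      using hom(4)[OF \<pi> S.base_closed(2) S.base_closed(2)] hom(4)[OF \<pi>' S.base_closed(2) S.base_closed(2)]
        S.base_closed(2) by simp
  next
    fix X Y assume XY: "X \<in> ?S" "Y \<in> ?S"
    then have b: "X \<in> S.base" "Y \<in> S.base" "?st X \<in> S.base" "?st Y \<in> S.base"
      using S.base_closed(9) by auto
    have e: "\<pi> X v = \<pi>' X v" "\<pi> Y v = \<pi>' Y v" "\<pi> (?st X) v = \<pi>' (?st X) v" "\<pi> (?st Y) v = \<pi>' (?st Y) v"
      if "v \<in> ell2" for v using XY that by auto
    show "X \<oplus>\<^bsub>S3 p q \<theta>\<^esub> Y \<in> ?S"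
      using b S.base_closed(4)[OF b(1,2)]
      by (simp add: hom(1)[OF \<pi>] hom(1)[OF \<pi>'] e S.star_add S.base_carrier)
    show "X \<otimes>\<^bsub>S3 p q \<theta>\<^esub> Y \<in> ?S"
      using b S.base_closed(7)[OF b(1,2)] hom(5)[OF \<pi>' b(2) b(2)] hom(5)[OF \<pi>' b(3) b(3)]
      by (simp add: hom(2)[OF \<pi>] hom(2)[OF \<pi>'] e S.star_mult S.base_carrier)
  next
    fix X c assume X: "X \<in> ?S"
    then have b: "X \<in> S.base" "?st X \<in> S.base" using S.base_closed(9) by auto
    show "c \<odot>\<^bsub>S3 p q \<theta>\<^esub> X \<in> ?S"
      using X b S.base_closed(8) by (simp add: hom(3)[OF \<pi> _ b(1)] hom(3)[OF \<pi>' _ b(1)] S.star_smult S.base_carrier)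
    show "?st X \<in> ?S" using X b by (simp add: S.base_carrier)
  qed (use S.base_carrier in auto)
  moreover have "g \<in> ?S" if g: "g \<in> {S.z, S.w, S.C}" for g
  proof -
    have "g \<in> S.base" using g S.zwC_base by blast
    then have b: "g \<in> S.base" "?st g \<in> S.base" "?st (?st g) = g"
      by (simp_all add: S.base_closed(9) S.base_carrier)
    have s: "\<pi> (?st g) v = \<pi>' (?st g) v" if "v \<in> ell2" for v
      using star_eq[OF b(1) gens[OF g] that] .
    have "\<pi> g v = \<pi>' g v" if "v \<in> ell2" for v
      using star_eq[OF b(2) s[OF basis_vec_ell2] that] unfolding b(3) .
    then show ?thesis using s b(1) by simp
  qed
  then have "{S.z, S.w, S.C} \<subseteq> ?S" by blast
  ultimately have "S.base \<subseteq> ?S" unfolding S.base_def by (rule S.generated_star_subalgebra_least)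
  then show ?thesis using X v by blast
qed

lemma sphere_gens': "S3_A p q \<theta> = S.z" "S3_B p q \<theta> = S.w" "C_plus p q \<theta> k l = S.C"
  using sphere_gens[OF p(1) q(1) kl] by simp_all

text \<open>The constructed representation satisfies the specification from which \<open>\<pi>\<^sub>s\<^sub>,\<^sub>t\<close> is chosen, and any two
  solutions agree on square-summable sequences.\<close>

lemma pi_st_eq:
  assumes X: "X \<in> S.base" and v: "v \<in> ell2"
  shows "pi_st p q \<theta> k l s t X v = rep X v"
proof -
  let ?P = "\<lambda>\<pi>. star_representation (S2 p q \<theta> k l) \<pi> \<and>
       (\<forall>m\<ge>0.
          \<pi> (S3_A p q \<theta>) (basis_vec m) =
            (\<lambda>i. of_real (p powi (m * int l + int s)) * basis_vec m i) \<and>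
          \<pi> (S3_B p q \<theta>) (basis_vec m) = (\<lambda>_. 0) \<and>
          \<pi> (C_plus p q \<theta> k l) (basis_vec m) =
            (\<lambda>i. of_real (\<Prod>j=1..l. sqrt (1 - p powi (int j + m * int l + int s))) *
                 basis_vec (m + 1) i)) \<and>
       (\<forall>m<0. \<forall>n. m = - n - 1 \<longrightarrow>
          \<pi> (S3_A p q \<theta>) (basis_vec m) = (\<lambda>_. 0) \<and>
          \<pi> (S3_B p q \<theta>) (basis_vec m) =
            (\<lambda>i. of_real (q powi (n * int k + int t)) * basis_vec m i) \<and>
          \<pi> (C_plus p q \<theta> k l) (basis_vec m) =
            (\<lambda>i. of_real (\<Prod>j=1..k. sqrt (1 - q powi (int j + (n - 1) * int k + int t))) *
                 basis_vec (m + 1) i))"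
  have z: "rep S.z (basis_vec m) = (\<lambda>i. zeta m * basis_vec m i)" for m
    by (auto simp: fun_eq_iff rep_z basis_vec_def)
  have w: "rep S.w (basis_vec m) = (\<lambda>i. eta m * basis_vec m i)" for m
    by (auto simp: fun_eq_iff rep_w basis_vec_def)
  have C: "rep S.C (basis_vec m) = (\<lambda>i. of_real (weight m) * basis_vec (m + 1) i)" for m
    by (auto simp: fun_eq_iff rep_C basis_vec_def)
  have e: "- (- n - 1) - 1 = n" "- (- n - 1) - 2 = n - 1" for n :: int by simp_all
  have rep: "?P rep"
    unfolding sphere_gens' z w C
  proof (intro conjI allI impI)
    fix m n :: int assume m: "m < 0" "m = - n - 1"
    then show "(\<lambda>i. eta m * basis_vec m i) = (\<lambda>i. of_real (q powi (n * int k + int t)) * basis_vec m i)"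
      by (simp add: eta_def)
    show "(\<lambda>i. complex_of_real (weight m) * basis_vec (m + 1) i) =
        (\<lambda>i. complex_of_real (\<Prod>j=1..k. sqrt (1 - q powi (int j + (n - 1) * int k + int t))) * basis_vec (m + 1) i)"
      using m(1) unfolding weight_def m(2) e by simp
  qed (auto simp: rep_star_representation zeta_def eta_def weight_def)
  have P: "?P (pi_st p q \<theta> k l s t)"
    unfolding pi_st_def by (rule someI[of ?P, OF rep])
  show ?thesis
  proof (rule star_representation_unique[OF _ rep_star_representation _ X v])
    show "star_representation (S2 p q \<theta> k l) (pi_st p q \<theta> k l s t)" using P by blast
    fix g m assume g: "g \<in> {S.z, S.w, S.C}"
    show "pi_st p q \<theta> k l s t g (basis_vec m) = rep g (basis_vec m)"
    proof (cases "m \<ge> 0")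
      case True
      then show ?thesis using g P rep unfolding sphere_gens' by auto
    next
      case False
      have n: "m < 0" "m = - (- m - 1) - 1" using False by simp_all
      from g consider "g = S.z" | "g = S.w" | "g = S.C" by blast
      then show ?thesis
        using conjunct2[OF conjunct2[OF P], rule_format, OF n] conjunct2[OF conjunct2[OF rep], rule_format, OF n]
        unfolding sphere_gens' by cases simp_all
    qed
  qed
qed

lemma pi_c_eq:
  assumes X: "X \<in> S.base" and v: "v \<in> ell2"
  shows "pi_c p q \<theta> k l X v = limit_rep X v"
proof -
  let ?P = "\<lambda>\<pi>. star_representation (S2 p q \<theta> k l) \<pi> \<and>
       (\<forall>m. \<pi> (S3_A p q \<theta>) (basis_vec m) = (\<lambda>_. 0) \<and>
            \<pi> (S3_B p q \<theta>) (basis_vec m) = (\<lambda>_. 0) \<and>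
            \<pi> (C_plus p q \<theta> k l) (basis_vec m) = basis_vec (m + 1))"
  have sym: "symbol S.z = 0" "symbol S.w = 0" "symbol S.C = Poly_Mapping.single 1 1"
    by (rule symbol_eq symbol_z symbol_w symbol_C)+
  have rep: "?P limit_rep"
    using limit_rep_star_representation unfolding sphere_gens' limit_rep_def sym
    by (auto simp: shift_def basis_vec_def fun_eq_iff)
  have P: "?P (pi_c p q \<theta> k l)"
    unfolding pi_c_def by (rule someI[of ?P, OF rep])
  show ?thesis
  proof (rule star_representation_unique[OF _ limit_rep_star_representation _ X v])
    show "star_representation (S2 p q \<theta> k l) (pi_c p q \<theta> k l)" using P by blast
    show "pi_c p q \<theta> k l g (basis_vec m) = limit_rep g (basis_vec m)" if "g \<in> {S.z, S.w, S.C}" for g m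
      using that P rep unfolding sphere_gens' by auto
  qed
qed

end


section \<open>The trace\<close>

text \<open>Matrix multiplication, obtained by expanding an inner product with a value of the adjoint.\<close>

lemma adjoint_matrix:
  assumes adj: "adjoint_pair T T'" and b: "bounded_operator T'" and u: "u \<in> ell2"
  shows "(\<lambda>j. T (basis_vec j) i * u j) summable_on UNIV" and "T u i = (\<Sum>\<^sub>\<infinity>j. T (basis_vec j) i * u j)"
proof -
  have "cnj (T' (basis_vec i) j) = T (basis_vec j) i" for j
  proof -
    have "ell2_inner (T' (basis_vec i)) (basis_vec j) = ell2_inner (basis_vec i) (T (basis_vec j))"
      using adj basis_vec_ell2 unfolding adjoint_pair_def by blast
    then show ?thesis by simp
  qed
  note e = this
  show "(\<lambda>j. T (basis_vec j) i * u j) summable_on UNIV"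
    using ell2_inner_summable[OF bounded_operator_ell2[OF b basis_vec_ell2] u, of i] by (simp add: e)
  have "ell2_inner (T' (basis_vec i)) u = ell2_inner (basis_vec i) (T u)"
    using adj u basis_vec_ell2 unfolding adjoint_pair_def by blast
  then show "T u i = (\<Sum>\<^sub>\<infinity>j. T (basis_vec j) i * u j)"
    by (simp add: e ell2_inner_def[of "T' _"])
qed

context sphere_representation
begin

definition defect :: "sphere \<Rightarrow> int \<Rightarrow> complex" where
  "defect X m = rep X (basis_vec m) m - poly_mapping.lookup (symbol X) 0"

abbreviation "\<tau> \<equiv> tau p q \<theta> k l s t"

lemma tau_defect: "X \<in> S.base \<Longrightarrow> \<tau> X = (\<Sum>\<^sub>\<infinity>m. defect X m)"
  unfolding tau_def operator_trace_def
  by (simp add: pi_st_eq pi_c_eq limit_rep_def toeplitz_basis defect_def)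

lemma \<omega>_mult_summable: "(\<lambda>m. \<omega> m * \<omega> m) summable_on UNIV"
  by (rule summable_on_comparison_test[OF \<omega>_summable]) (use \<omega>_le_1 in \<open>auto intro: mult_left_le\<close>)

lemma defect_summable: assumes "X \<in> S.base" shows "defect X summable_on UNIV"
proof -
  obtain K where K: "\<And>m i. cmod (rep X (basis_vec m) i - poly_mapping.lookup (symbol X) (i - m)) \<le> K * \<omega> m * \<omega> i"
    using has_symbolD[OF has_symbol_symbol[OF assms]] by blast
  have "cmod (defect X m) \<le> K * (\<omega> m * \<omega> m)" for m
    using K[of m m] by (simp add: defect_def mult.assoc)
  then have "(\<lambda>m. norm (defect X m)) summable_on UNIV"
    by (intro Infinite_Sum.abs_summable_on_comparison_test'[OF summable_on_cmult_right[OF \<omega>_mult_summable]])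
  then show ?thesis by (rule abs_summable_summable)
qed

lemma tau_add:
  assumes "X \<in> S.base" "Y \<in> S.base" shows "\<tau> (X \<oplus>\<^bsub>S3 p q \<theta>\<^esub> Y) = \<tau> X + \<tau> Y"
proof -
  have "defect (X \<oplus>\<^bsub>S3 p q \<theta>\<^esub> Y) m = defect X m + defect Y m" for m
    using assms by (simp add: defect_def rep_ext symbol_hom lookup_add)
  then show ?thesis
    using assms S.base_closed(4)[OF assms] by (simp add: tau_defect infsum_add defect_summable)
qed

lemma tau_one: "\<tau> \<one>\<^bsub>S3 p q \<theta>\<^esub> = 0"
proof -
  have "defect \<one>\<^bsub>S3 p q \<theta>\<^esub> m = 0" for m
    by (simp add: defect_def rep_one symbol_one basis_vec_def lookup_one)
  then show ?thesis using S.base_closed(2) by (simp add: tau_defect)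
qed

text \<open>The double series of products of matrix entries that would give the trace of a product need
  not converge. After subtracting the products of Toeplitz entries it converges absolutely, and the
  subtracted terms are symmetric in the two factors. So the trace property is an exchange of
  summations.\<close>

definition product_defect :: "sphere \<Rightarrow> sphere \<Rightarrow> int \<Rightarrow> int \<Rightarrow> complex" where
  "product_defect X Y m j = rep X (basis_vec j) m * rep Y (basis_vec m) j -
     poly_mapping.lookup (symbol X) (m - j) * poly_mapping.lookup (symbol Y) (j - m)"

lemma defect_mult:
  assumes X: "X \<in> S.base" and Y: "Y \<in> S.base"
  shows "defect (X \<otimes>\<^bsub>S3 p q \<theta>\<^esub> Y) m = (\<Sum>\<^sub>\<infinity>j. product_defect X Y m j)"
proof -
  have X': "star (S3 p q \<theta>) X \<in> S.base" using X by (rule S.base_closed(9))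
  have u: "rep Y (basis_vec m) \<in> ell2"
    using bounded_rep[OF S.base_carrier[OF Y]] basis_vec_ell2 by (rule bounded_operator_ell2)
  note r = adjoint_matrix[OF adjoint_rep[OF S.base_carrier[OF X]] bounded_rep[OF S.base_carrier[OF X']] u]
  have u': "toeplitz (symbol Y) (basis_vec m) \<in> ell2"
    using bounded_toeplitz basis_vec_ell2 by (rule bounded_operator_ell2)
  note s = adjoint_matrix[OF adjoint_toeplitz bounded_toeplitz u', of "symbol X" m]
  have "rep (X \<otimes>\<^bsub>S3 p q \<theta>\<^esub> Y) (basis_vec m) m = (\<Sum>\<^sub>\<infinity>j. rep X (basis_vec j) m * rep Y (basis_vec m) j)"
    using r(2)[of m] X Y by (simp add: rep_mult)
  moreover have "poly_mapping.lookup (symbol (X \<otimes>\<^bsub>S3 p q \<theta>\<^esub> Y)) 0 =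
      toeplitz (symbol X) (toeplitz (symbol Y) (basis_vec m)) m"
    using toeplitz_basis[of "symbol X * symbol Y" m m] by (simp add: symbol_hom(2)[OF X Y] shift.act_mult)
  moreover have "toeplitz (symbol X) (toeplitz (symbol Y) (basis_vec m)) m =
      (\<Sum>\<^sub>\<infinity>j. poly_mapping.lookup (symbol X) (m - j) * poly_mapping.lookup (symbol Y) (j - m))"
    by (subst s(2)) (simp only: toeplitz_basis)
  ultimately show ?thesis
    using infsum_add[OF r(1)[of m] summable_on_uminus[THEN iffD2, OF s(1)[unfolded toeplitz_basis]]]
    by (simp add: defect_def product_defect_def infsum_uminus)
qed

lemma product_defect_summable:
  assumes X: "X \<in> S.base" and Y: "Y \<in> S.base"
  shows "(\<lambda>(m, j). product_defect X Y m j) summable_on (UNIV \<times> UNIV)"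
proof -
  obtain K where K: "K \<ge> 0" "\<And>m i. cmod (rep X (basis_vec m) i - poly_mapping.lookup (symbol X) (i - m)) \<le> K * \<omega> m * \<omega> i"
    using has_symbolD[OF has_symbol_symbol[OF X]] by blast
  obtain L where L: "L \<ge> 0" "\<And>m i. cmod (rep Y (basis_vec m) i - poly_mapping.lookup (symbol Y) (i - m)) \<le> L * \<omega> m * \<omega> i"
    using has_symbolD[OF has_symbol_symbol[OF Y]] by blast
  have bnd: "\<exists>B\<ge>0. \<forall>d. cmod (poly_mapping.lookup T d) \<le> B" for T :: "int \<Rightarrow>\<^sub>0 complex"
  proof (intro exI conjI allI)
    show "0 \<le> (\<Sum>e\<in>Poly_Mapping.keys T. cmod (poly_mapping.lookup T e))" by (simp add: sum_nonneg)
    show "cmod (poly_mapping.lookup T d) \<le> (\<Sum>e\<in>Poly_Mapping.keys T. cmod (poly_mapping.lookup T e))" for d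
      by (cases "d \<in> Poly_Mapping.keys T") (auto intro: member_le_sum simp: in_keys_iff sum_nonneg)
  qed
  obtain B where B: "B \<ge> 0" "\<And>d. cmod (poly_mapping.lookup (symbol X) d) \<le> B" using bnd by blast
  obtain B' where B': "B' \<ge> 0" "\<And>d. cmod (poly_mapping.lookup (symbol Y) d) \<le> B'" using bnd by blast
  have Yb: "cmod (rep Y (basis_vec m) j) \<le> L + B'" for m j
  proof -
    have "L * \<omega> m * \<omega> j \<le> L * 1 * 1" using L(1) by (intro mult_mono \<omega>_le_1) auto
    then show ?thesis
      using norm_triangle_ineq[of "rep Y (basis_vec m) j - poly_mapping.lookup (symbol Y) (j - m)" "poly_mapping.lookup (symbol Y) (j - m)"]
        L(2)[of m j] B'(2)[of "j - m"] by simp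
  qed
  have F: "cmod (product_defect X Y m j) \<le> (K * (L + B') + B * L) * (\<omega> m * \<omega> j)" for m j
  proof -
    have "product_defect X Y m j = (rep X (basis_vec j) m - poly_mapping.lookup (symbol X) (m - j)) * rep Y (basis_vec m) j
        + poly_mapping.lookup (symbol X) (m - j) * (rep Y (basis_vec m) j - poly_mapping.lookup (symbol Y) (j - m))"
      by (simp add: product_defect_def algebra_simps)
    also have "cmod \<dots> \<le> (K * \<omega> j * \<omega> m) * (L + B') + B * (L * \<omega> m * \<omega> j)"
      using K L B B' Yb unfolding norm_mult[symmetric]
      by (intro order_trans[OF norm_triangle_ineq] add_mono) (auto simp: norm_mult intro!: mult_mono)
    finally show ?thesis by (simp add: algebra_simps)
  qed
  have "(\<lambda>(m, j). \<omega> m * \<omega> j) summable_on (SIGMA m:UNIV. UNIV)"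
  proof (rule summable_on_SigmaI)
    show "((\<lambda>j. case (m, j) of (m, j) \<Rightarrow> \<omega> m * \<omega> j) has_sum \<omega> m * infsum \<omega> UNIV) UNIV" for m
      using has_sum_cmult_right[OF has_sum_infsum[OF \<omega>_summable]] by simp
    show "(\<lambda>m. \<omega> m * infsum \<omega> UNIV) summable_on UNIV"
      by (rule summable_on_cmult_left[OF \<omega>_summable])
  qed auto
  then have "(\<lambda>mj. (K * (L + B') + B * L) * (\<lambda>(m, j). \<omega> m * \<omega> j) mj) summable_on (UNIV \<times> UNIV)"
    by (rule summable_on_cmult_right)
  then have "(\<lambda>mj. norm ((\<lambda>(m, j). product_defect X Y m j) mj)) summable_on (UNIV \<times> UNIV)"
    by (rule Infinite_Sum.abs_summable_on_comparison_test') (use F in auto)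
  then show ?thesis by (rule abs_summable_summable)
qed

lemma tau_mult_commute:
  assumes X: "X \<in> S.base" and Y: "Y \<in> S.base"
  shows "\<tau> (X \<otimes>\<^bsub>S3 p q \<theta>\<^esub> Y) = \<tau> (Y \<otimes>\<^bsub>S3 p q \<theta>\<^esub> X)"
proof -
  have "\<tau> (X \<otimes>\<^bsub>S3 p q \<theta>\<^esub> Y) = (\<Sum>\<^sub>\<infinity>m. \<Sum>\<^sub>\<infinity>j. product_defect X Y m j)"
    using S.base_closed(7)[OF X Y] by (simp add: tau_defect defect_mult[OF X Y])
  also have "\<dots> = (\<Sum>\<^sub>\<infinity>j. \<Sum>\<^sub>\<infinity>m. product_defect X Y m j)"
    by (rule infsum_swap_banach[OF product_defect_summable[OF X Y]])
  also have "\<dots> = (\<Sum>\<^sub>\<infinity>j. \<Sum>\<^sub>\<infinity>m. product_defect Y X j m)"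
    by (simp add: product_defect_def mult.commute)
  also have "\<dots> = \<tau> (Y \<otimes>\<^bsub>S3 p q \<theta>\<^esub> X)"
    using S.base_closed(7)[OF Y X] by (simp add: tau_defect defect_mult[OF Y X])
  finally show ?thesis .
qed


subsection \<open>The trace of a polynomial in \<open>z\<close>\<close>

text \<open>On a polynomial in \<open>z\<close> both representations are diagonal, with entries \<open>g(zeta m)\<close> and \<open>g 0\<close>.\<close>

lemma poly_z_rep:
  assumes "S.poly_in S.z X g"
  shows "X \<in> S.base \<and> (\<forall>v m. rep X v m = g (zeta m) * v m) \<and> symbol X = Poly_Mapping.single 0 (g 0)"
  using assms
proof induction
  case (const c)
  then show ?case
    using S.base_closed(2,8) by (simp add: rep_smult rep_one symbol_hom(3)[OF S.base_closed(2) S.base_closed(2)] symbol_one)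
next
  case var
  then show ?case using S.zwC_base by (simp add: rep_z symbol_eq[OF symbol_z])
next
  case (add c g d h)
  then show ?case using S.base_closed(4) by (auto simp: rep_ext symbol_hom(1) algebra_simps single_add)
next
  case (mult c g d h)
  then show ?case using S.base_closed(7) by (auto simp: rep_ext symbol_hom(2) mult_single)
qed

text \<open>The eigenvalues of \<open>z\<close> on the basis vectors \<open>f\<^sub>n\<close> with \<open>n \<ge> 0\<close>.\<close>

definition Z :: "nat \<Rightarrow> complex" where
  "Z n = of_real (p ^ (n * l + s))"

lemma tau_poly_z:
  assumes X: "S.poly_in S.z X g"
  shows "(\<lambda>n. g (Z n) - g 0) sums \<tau> X"
proof -
  have b: "X \<in> S.base" using poly_z_rep[OF X] by blast
  have d: "defect X m = g (zeta m) - g 0" for m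
    using poly_z_rep[OF X] by (simp add: defect_def basis_vec_def)
  have "(defect X has_sum \<tau> X) UNIV"
    unfolding tau_defect[OF b] by (rule has_sum_infsum[OF defect_summable[OF b]])
  \<comment> \<open>\<open>z\<close> vanishes on the basis vectors with negative index, so they contribute nothing.\<close>
  then have "(defect X has_sum \<tau> X) (range int)"
    by (rule has_sum_cong_neutral[THEN iffD1, rotated -1])
      (auto simp: d zeta_def image_iff split: if_splits, metis int_nat_eq nat_0_le)
  then have "((\<lambda>n. defect X (int n)) has_sum \<tau> X) UNIV"
    by (subst (asm) has_sum_reindex) (auto simp: comp_def)
  then have "(\<lambda>n. defect X (int n)) sums \<tau> X" by (rule has_sum_imp_sums)
  moreover have "zeta (int n) = Z n" for n
  proof -
    have "int n * int l + int s = int (n * l + s)" by simp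
    then show ?thesis unfolding zeta_def Z_def by (simp only: power_int_of_nat) simp
  qed
  ultimately show ?thesis by (simp add: d)
qed

lemma Z_Suc: "Z (Suc n) = of_real (p ^ l) * Z n"
  by (simp add: Z_def power_add algebra_simps)

lemma Z_tendsto: "Z \<longlonglongrightarrow> 0"
proof -
  have "(\<lambda>n. (p ^ l) ^ n) \<longlonglongrightarrow> 0" using p kl by (intro LIMSEQ_power_zero) (simp add: power_less_one_iff)
  then have "(\<lambda>n. of_real ((p ^ l) ^ n * p ^ s)) \<longlonglongrightarrow> (of_real (0 * p ^ s) :: complex)"
    by (intro tendsto_of_real tendsto_mult_right)
  moreover have "Z = (\<lambda>n. of_real ((p ^ l) ^ n * p ^ s))"
    by (simp add: Z_def power_add power_mult[symmetric] mult.commute fun_eq_iff)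
  ultimately show ?thesis by simp
qed

lemma h_Z_0: "S.h (Z 0) = 0"
proof -
  have "(1::complex) - of_real (inverse p ^ s) * Z 0 = 0"
    using p by (simp add: Z_def power_inverse)
  then show ?thesis unfolding S.h_def using st by (intro prod_zero) auto
qed

lemma isCont_h: "isCont S.h c"
  using S.isCont_poly_in[OF S.x_star_x] .

definition unit_trace :: "(complex \<Rightarrow> complex) \<Rightarrow> complex \<Rightarrow> bool" where
  "unit_trace g v \<longleftrightarrow> (\<forall>t. isCont g t) \<and> g 0 = 1 \<and> (\<lambda>n. g (Z n) - g 0) sums v"

text \<open>Both recursions change the sum by a telescoping series; only the end at infinity contributes,
  since \<open>h\<close> vanishes at the first spectral value \<open>p\<^sup>s\<close>.\<close>

lemma unit_trace_step:
  assumes g: "unit_trace g v"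
  shows "unit_trace (S.\<Phi> g) (v - 1)" "unit_trace (S.\<Phi>' g) (v + 1)"
proof -
  have cont: "isCont g t" for t using g by (simp add: unit_trace_def)
  have g0: "g 0 = 1" using g by (simp add: unit_trace_def)
  have c1: "isCont (\<lambda>t. g (c * t)) t" "isCont (\<lambda>t. S.h (c * t)) t" for c t
    by (rule isCont_o2[OF _ cont] isCont_o2[OF _ isCont_h]; simp)+
  have \<Phi>0: "S.\<Phi> g 0 = 1" "S.\<Phi>' g 0 = 1" by (simp_all add: S.\<Phi>_def S.\<Phi>'_def g0)
  define H where "H n = g (of_real (inverse p ^ l) * Z n) * S.h (Z n)" for n
  define H' where "H' n = g (Z n) * S.h (Z n)" for n
  have lim: "(\<lambda>n. F (Z n)) \<longlonglongrightarrow> F 0" if "isCont F 0" for F :: "complex \<Rightarrow> complex"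
    using isCont_tendsto_compose[OF that Z_tendsto] .
  have "H \<longlonglongrightarrow> 1"
    using lim[OF isCont_mult[OF c1(1) isCont_h], of "of_real (inverse p ^ l)"] by (simp add: H_def[abs_def] g0)
  from telescope_sums'[OF this] have "(\<lambda>n. H n - H (Suc n)) sums (- 1)" by (simp add: H_def h_Z_0)
  moreover have "S.\<Phi> g (Z n) - g (Z n) = H n - H (Suc n)" for n
  proof -
    have "of_real (inverse p ^ l) * (of_real (p ^ l) * Z n) = Z n" using p by (simp add: power_inverse)
    then show ?thesis by (simp only: S.\<Phi>_def H_def Z_Suc) (simp add: right_diff_distrib)
  qed
  ultimately have "(\<lambda>n. S.\<Phi> g (Z n) - g (Z n)) sums (- 1)" by simp
  from sums_add[OF this, of "\<lambda>n. g (Z n) - g 0" v] have "(\<lambda>n. S.\<Phi> g (Z n) - S.\<Phi> g 0) sums (v - 1)"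
    using g by (simp add: unit_trace_def \<Phi>0 g0)
  then show "unit_trace (S.\<Phi> g) (v - 1)"
    using \<Phi>0 c1 cont isCont_h by (auto simp: unit_trace_def S.\<Phi>_def[abs_def] intro!: continuous_intros)
  have "H' \<longlonglongrightarrow> 1" using lim[OF isCont_mult[OF cont isCont_h]] by (simp add: H'_def[abs_def] g0)
  from sums_minus[OF telescope_sums'[OF this]] have "(\<lambda>n. H' (Suc n) - H' n) sums 1" by (simp add: H'_def h_Z_0)
  moreover have "S.\<Phi>' g (Z n) - g (Z n) = H' (Suc n) - H' n" for n
    by (simp add: S.\<Phi>'_def H'_def Z_Suc algebra_simps)
  ultimately have "(\<lambda>n. S.\<Phi>' g (Z n) - g (Z n)) sums 1" by simp
  from sums_add[OF this, of "\<lambda>n. g (Z n) - g 0" v] have "(\<lambda>n. S.\<Phi>' g (Z n) - S.\<Phi>' g 0) sums (v + 1)"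
    using g by (simp add: unit_trace_def \<Phi>0 g0 add.commute)
  then show "unit_trace (S.\<Phi>' g) (v + 1)"
    using \<Phi>0 c1 cont isCont_h by (auto simp: unit_trace_def S.\<Phi>'_def[abs_def] intro!: continuous_intros)
qed

lemma unit_trace_iterate:
  "unit_trace ((S.\<Phi> ^^ n) (\<lambda>_. 1)) (- of_nat n)" "unit_trace ((S.\<Phi>' ^^ n) (\<lambda>_. 1)) (of_nat n)"
proof (induction n)
  case 0
  show "unit_trace ((S.\<Phi> ^^ 0) (\<lambda>_. 1)) (- of_nat 0)" "unit_trace ((S.\<Phi>' ^^ 0) (\<lambda>_. 1)) (of_nat 0)"
    by (simp_all add: unit_trace_def)
next
  case (Suc n)
  show "unit_trace ((S.\<Phi> ^^ Suc n) (\<lambda>_. 1)) (- of_nat (Suc n))"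
    using unit_trace_step(1)[OF Suc(1)] by (simp add: minus_diff_commute)
  show "unit_trace ((S.\<Phi>' ^^ Suc n) (\<lambda>_. 1)) (of_nat (Suc n))"
    using unit_trace_step(2)[OF Suc(2)] by (simp add: algebra_simps)
qed

lemma tau_Tr_E: "\<tau> (Tr_E p q \<theta> k l n) = - of_int n"
proof -
  let ?g = "if n \<ge> 0 then (S.\<Phi> ^^ nat n) (\<lambda>_. 1) else (S.\<Phi>' ^^ nat (- n)) (\<lambda>_. 1)"
  have "unit_trace ?g (- of_int n)"
    using unit_trace_iterate[of "nat n"] unit_trace_iterate[of "nat (- n)"] by auto
  then have "(\<lambda>n. ?g (Z n) - ?g 0) sums (- of_int n)" unfolding unit_trace_def by blast
  then show ?thesis
    using tau_poly_z[OF Tr_E_poly[OF p(1) q(1) kl, of \<theta> n]] by (rule sums_unique2[symmetric])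
qed

lemma line_bundle_not_free:
  assumes "n \<noteq> 0"
  shows "\<not> free_left_module (S2 p q \<theta> k l) (line_bundle p q \<theta> k l n)"
proof
  assume "free_left_module (S2 p q \<theta> k l) (line_bundle p q \<theta> k l n)"
  from line_bundle_free_trace[OF p(1) q(1) kl tau_add tau_mult_commute tau_one this]
  have "\<tau> (Tr_E p q \<theta> k l n) = 0" by blast
  then show False using assms by (simp add: tau_Tr_E)
qed

end

theorem theorem4p2:
  fixes p q \<theta> :: real and k l s t :: nat and n :: int
  assumes "0 < p" "p < 1" "0 < q" "q < 1" "0 < \<theta>" "\<theta> < 1" "\<theta> \<notin> \<rat>"
    and "k > 0" "l > 0" "coprime k l"
    and "s < l" "t < k"
  shows "tau p q \<theta> k l s t (Tr_E p q \<theta> k l n) = - of_int n \<and>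
    (n \<noteq> 0 \<longrightarrow> \<not> free_left_module (S2 p q \<theta> k l) (line_bundle p q \<theta> k l n))"
proof -
  interpret sphere_representation p q \<theta> k l s t
    by unfold_locales (use assms in auto)
  show ?thesis using tau_Tr_E line_bundle_not_free by blast
qed

end
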